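(* Let $s > 1/2$. There is a constant $C_s > 0$ depending only on $s$ such that for every nonzero $v_0 = (\eta_0,u_0)^T \in X^s$, with $T = (7C_s\|v_0\|_{X^s})^{-1}$, there exists a unique solution $v = (\eta,u)^T \in X^s_T$ of the equation $$v = \mathcal A(v;v_0),$$ where $$\mathcal A(v;v_0)(t) = \mathcal S(t)v_0 - \int_0^t \mathcal S(t-t')K\partial_x\begin{pmatrix}\eta u\\ u^2/2\end{pmatrix}(t')\,dt', \qquad t \in [0,T].$$ Moreover, for any $R > 0$ there exists $T = T(R) > 0$ such that the flow map $v_0 \mapsto v$ associated with the equation $v = \mathcal A(v;v_0)$ (sending $v_0$ to the solution $v \in X^s_T$) is a real analytic mapping of the open ball $B_R(0) \subset X^s$ to $X^s_T$.
   Context: All functions are real-valued functions of $x\in\mathbb R$ (and time). $D = -i\partial_x$, and $K = \frac{\tanh D}{D}$ is the Fourier multiplier operator with symbol $\tanh(\xi)/\xi$ (equal to $1$ at $\xi=0$), so $K\partial_x = i\tanh D$. $H^s = H^s(\mathbb R)$ is the $L^2$-based Sobolev space with norm $\|f\|_{H^s}^2 = \int(1+\xi^2)^s|\widehat f(\xi)|^2d\xi$ (up to normalization of the Fourier transform). $X^s = H^s\times H^s$ with norm $\|(\eta,u)\|_{X^s}^2 = \|\eta\|_{H^s}^2+\|u\|_{H^s}^2$. $X^s_T$ is the space of continuous functions $[0,T]\to X^s$ with the supremum norm. $\mathcal S(t)$ is the unitary group on $X^s$ $$\mathcal S(t) = \frac{1}{\sqrt 2}\begin{pmatrix}1&1\\1&-1\end{pmatrix}\begin{pmatrix}e^{-itD}&0\\0&e^{itD}\end{pmatrix}\frac1{\sqrt2}\begin{pmatrix}1&1\\1&-1\end{pmatrix}.$$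 The equation $v=\mathcal A(v;v_0)$ is the integral form of the Cauchy problem $\eta_t+u_x+K(\eta u)_x=0$, $u_t+\eta_x+K(u^2/2)_x=0$, $(\eta,u)(0)=v_0$. *)

theory Defs
  imports "HOL-Analysis.Analysis" "HOL-Library.Function_Algebras" "HOL-Library.Multiset"
begin

section \<open>The space \<open>L\<^sup>2\<close> of the real line\<close>

definition square_integrable :: "(real \<Rightarrow> 'a::euclidean_space) \<Rightarrow> bool" where
  "square_integrable f \<longleftrightarrow>
     f \<in> borel_measurable lborel \<and> integrable lborel (\<lambda>x. (norm (f x))\<^sup>2)"

lemma square_integrable_add:
  assumes "square_integrable f" "square_integrable g"
  shows "square_integrable (\<lambda>x. f x + g x)"
proof -
  have [measurable]: "f \<in> borel_measurable lborel" "g \<in> borel_measurable lborel"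
    using assms by (auto simp: square_integrable_def)
  have "integrable lborel (\<lambda>x. (norm (f x + g x))\<^sup>2)"
  proof (rule Bochner_Integration.integrable_bound)
    show "integrable lborel (\<lambda>x. 2 * (norm (f x))\<^sup>2 + 2 * (norm (g x))\<^sup>2)"
      using assms by (auto simp: square_integrable_def)
    have "(norm (f x + g x))\<^sup>2 \<le> 2 * (norm (f x))\<^sup>2 + 2 * (norm (g x))\<^sup>2" for x
    proof -
      have "(norm (f x + g x))\<^sup>2 \<le> (norm (f x) + norm (g x))\<^sup>2"
        by (intro power_mono norm_triangle_ineq) auto
      also have "\<dots> \<le> 2 * (norm (f x))\<^sup>2 + 2 * (norm (g x))\<^sup>2"
        using sum_squares_bound[of "norm (f x)" "norm (g x)"] by (simp add: power2_sum)
      finally show ?thesis .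
    qed
    then show "AE x in lborel. norm ((norm (f x + g x))\<^sup>2)
        \<le> norm (2 * (norm (f x))\<^sup>2 + 2 * (norm (g x))\<^sup>2)"
      by auto
  qed measurable
  then show ?thesis
    by (auto simp: square_integrable_def)
qed

lemma square_integrable_scaleR:
  assumes "square_integrable f"
  shows "square_integrable (\<lambda>x. c *\<^sub>R f x)"
  using assms by (auto simp: square_integrable_def power_mult_distrib)

lemma square_integrable_zero: "square_integrable (\<lambda>x. 0)"
  by (auto simp: square_integrable_def)

lemma square_integrable_inner:
  assumes "square_integrable f" "square_integrable g"
  shows "integrable lborel (\<lambda>x. f x \<bullet> g x)"
proof -
  have [measurable]: "f \<in> borel_measurable lborel" "g \<in> borel_measurable lborel"
    using assms by (auto simp: square_integrable_def)
  show ?thesis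
  proof (rule Bochner_Integration.integrable_bound)
    show "integrable lborel (\<lambda>x. (norm (f x))\<^sup>2 + (norm (g x))\<^sup>2)"
      using assms by (auto simp: square_integrable_def)
    have "\<bar>f x \<bullet> g x\<bar> \<le> (norm (f x))\<^sup>2 + (norm (g x))\<^sup>2" for x
      using sum_squares_bound[of "norm (f x)" "norm (g x)"] Cauchy_Schwarz_ineq2[of "f x" "g x"]
        mult_nonneg_nonneg[OF norm_ge_zero[of "f x"] norm_ge_zero[of "g x"]]
      by linarith
    then show "AE x in lborel. norm (f x \<bullet> g x) \<le> norm ((norm (f x))\<^sup>2 + (norm (g x))\<^sup>2)"
      by auto
  qed measurable
qed

definition l2_rel :: "(real \<Rightarrow> 'a::euclidean_space) \<Rightarrow> (real \<Rightarrow> 'a) \<Rightarrow> bool" where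
  "l2_rel f g \<longleftrightarrow>
     square_integrable f \<and> square_integrable g \<and> (AE x in lborel. f x = g x)"

lemma part_equivp_l2_rel: "part_equivp l2_rel"
proof (rule part_equivpI)
  show "\<exists>f. l2_rel f f"
    using square_integrable_zero by (auto simp: l2_rel_def)
  show "symp l2_rel"
    by (auto simp: symp_def l2_rel_def)
  show "transp l2_rel"
    unfolding transp_def l2_rel_def by (auto elim: eventually_elim2)
qed

text \<open>
  Elements of \<open>'a l2\<close> are almost-everywhere equivalence classes, so equality in this type is
  equality almost everywhere. \<open>abs_l2 f\<close> is meaningful only for square integrable \<open>f\<close>,
  and \<open>rep_l2 f\<close> is an arbitrary representative.
\<close>

quotient_type (overloaded) 'a l2 = "real \<Rightarrow> 'a::euclidean_space" / partial: l2_rel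
  by (rule part_equivp_l2_rel)

instantiation l2 :: (euclidean_space) real_inner
begin

lift_definition zero_l2 :: "'a l2" is "\<lambda>x. 0"
  by (auto simp: l2_rel_def square_integrable_zero)

lift_definition plus_l2 :: "'a l2 \<Rightarrow> 'a l2 \<Rightarrow> 'a l2" is "\<lambda>f g x. f x + g x"
  by (auto simp: l2_rel_def intro: square_integrable_add)

lift_definition scaleR_l2 :: "real \<Rightarrow> 'a l2 \<Rightarrow> 'a l2" is "\<lambda>c f x. c *\<^sub>R f x"
  by (auto simp: l2_rel_def intro: square_integrable_scaleR)

lift_definition uminus_l2 :: "'a l2 \<Rightarrow> 'a l2" is "\<lambda>f x. - f x"
  by (auto simp: l2_rel_def dest: square_integrable_scaleR[where c = "-1"])

lift_definition minus_l2 :: "'a l2 \<Rightarrow> 'a l2 \<Rightarrow> 'a l2" is "\<lambda>f g x. f x - g x"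
proof -
  fix f f' g g' :: "real \<Rightarrow> 'a"
  assume *: "l2_rel f f'" "l2_rel g g'"
  have "square_integrable (\<lambda>x. u x - w x)"
    if "square_integrable u" "square_integrable w" for u w :: "real \<Rightarrow> 'a"
    using square_integrable_add[OF that(1) square_integrable_scaleR[OF that(2), of "-1"]] by simp
  then show "l2_rel (\<lambda>x. f x - g x) (\<lambda>x. f' x - g' x)"
    using * by (auto simp: l2_rel_def)
qed

lift_definition inner_l2 :: "'a l2 \<Rightarrow> 'a l2 \<Rightarrow> real" is "\<lambda>f g. LINT x|lborel. f x \<bullet> g x"
proof -
  fix f f' g g' :: "real \<Rightarrow> 'a"
  assume *: "l2_rel f f'" "l2_rel g g'"
  have "f \<in> borel_measurable lborel" "f' \<in> borel_measurable lborel"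
    "g \<in> borel_measurable lborel" "g' \<in> borel_measurable lborel"
    using * by (auto simp: l2_rel_def square_integrable_def)
  note [measurable] = this
  have "AE x in lborel. f x \<bullet> g x = f' x \<bullet> g' x"
    using * by (auto simp: l2_rel_def)
  then show "(LINT x|lborel. f x \<bullet> g x) = (LINT x|lborel. f' x \<bullet> g' x)"
    by (intro integral_cong_AE) measurable
qed

definition norm_l2 :: "'a l2 \<Rightarrow> real" where
  "norm_l2 f = sqrt (f \<bullet> f)"

definition dist_l2 :: "'a l2 \<Rightarrow> 'a l2 \<Rightarrow> real" where
  "dist_l2 f g = norm (f - g)"

definition sgn_l2 :: "'a l2 \<Rightarrow> 'a l2" where
  "sgn_l2 f = inverse (norm f) *\<^sub>R f"

definition uniformity_l2 :: "('a l2 \<times> 'a l2) filter" where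
  "uniformity_l2 = (INF e\<in>{0<..}. principal {(f, g). dist f g < e})"

definition open_l2 :: "'a l2 set \<Rightarrow> bool" where
  "open_l2 U \<longleftrightarrow> (\<forall>f\<in>U. \<forall>\<^sub>F (f', g) in uniformity. f' = f \<longrightarrow> g \<in> U)"

instance
proof
  fix f g h :: "'a l2" and a b :: real
  show "f + g + h = f + (g + h)"
    by transfer (auto simp: l2_rel_def add.assoc intro!: square_integrable_add)
  show "f + g = g + f"
    by transfer (auto simp: l2_rel_def add.commute intro!: square_integrable_add)
  show "0 + f = f"
    by transfer (auto simp: l2_rel_def)
  show "- f + f = 0"
    by transfer (auto simp: l2_rel_def square_integrable_zero)
  show "f - g = f + - g"
    by transfer (use square_integrable_add square_integrable_scaleR[where c = "-1"] in
        \<open>fastforce simp: l2_rel_def\<close>)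
  show "a *\<^sub>R (f + g) = a *\<^sub>R f + a *\<^sub>R g"
    by transfer (auto simp: l2_rel_def scaleR_add_right
        intro!: square_integrable_add square_integrable_scaleR)
  show "(a + b) *\<^sub>R f = a *\<^sub>R f + b *\<^sub>R f"
    by transfer (auto simp: l2_rel_def scaleR_add_left
        intro!: square_integrable_add square_integrable_scaleR)
  show "a *\<^sub>R b *\<^sub>R f = (a * b) *\<^sub>R f"
    by transfer (auto simp: l2_rel_def intro!: square_integrable_scaleR)
  show "1 *\<^sub>R f = f"
    by transfer (auto simp: l2_rel_def)
  show "f \<bullet> g = g \<bullet> f"
    by transfer (simp add: inner_commute)
  show "(f + g) \<bullet> h = f \<bullet> h + g \<bullet> h"
    by transfer (auto simp: l2_rel_def inner_add_left
        intro!: Bochner_Integration.integral_add square_integrable_inner)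
  show "(a *\<^sub>R f) \<bullet> g = a * (f \<bullet> g)"
    by transfer simp
  show "0 \<le> f \<bullet> f"
    by transfer simp
  show "f \<bullet> f = 0 \<longleftrightarrow> f = 0"
  proof transfer
    fix f :: "real \<Rightarrow> 'a"
    assume "l2_rel f f"
    then have f: "square_integrable f"
      by (simp add: l2_rel_def)
    have "(LINT x|lborel. f x \<bullet> f x) = 0 \<longleftrightarrow> (AE x in lborel. f x \<bullet> f x = 0)"
      by (rule integral_nonneg_eq_0_iff_AE) (use square_integrable_inner[OF f f] in auto)
    then show "(LINT x|lborel. f x \<bullet> f x) = 0 \<longleftrightarrow> l2_rel f (\<lambda>x. 0)"
      using f by (simp add: l2_rel_def square_integrable_zero)
  qed
qed (rule norm_l2_def dist_l2_def sgn_l2_def uniformity_l2_def open_l2_def)+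

end

text \<open>Pointwise product; meaningful when the product is square integrable.\<close>

definition mult_l2 :: "real l2 \<Rightarrow> real l2 \<Rightarrow> real l2" where
  "mult_l2 f g = abs_l2 (\<lambda>x. rep_l2 f x * rep_l2 g x)"

section \<open>Fourier transform and Fourier multipliers\<close>

text \<open>
  The Plancherel transform as a limit in \<open>L\<^sup>2\<close> of truncated integrals, with the normalization
  \<open>\<integral> e\<^sup>-\<^sup>i\<^sup>x\<^sup>\<xi> f(x) dx\<close>.
\<close>

definition fourier :: "real l2 \<Rightarrow> complex l2" where
  "fourier f = lim (\<lambda>n. abs_l2 (\<lambda>\<xi>.
     LINT x:{- real n..real n}|lborel. cis (- (x * \<xi>)) * complex_of_real (rep_l2 f x)))"

text \<open>
  \<open>fourier_mult m f\<close> is the real-valued function \<open>m(D) f\<close>. For bounded measurable \<open>m\<close> it exists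
  provided \<open>m (- \<xi>) = cnj (m \<xi>)\<close>, as is the case for all the symbols used below.
\<close>

definition fourier_mult :: "(real \<Rightarrow> complex) \<Rightarrow> real l2 \<Rightarrow> real l2" where
  "fourier_mult m f = (THE g. fourier g = abs_l2 (\<lambda>\<xi>. m \<xi> * rep_l2 (fourier f) \<xi>))"

definition K_symbol :: "real \<Rightarrow> real" where
  "K_symbol \<xi> = (if \<xi> = 0 then 1 else tanh \<xi> / \<xi>)"

text \<open>
  \<open>K \<partial>\<^sub>x\<close> is taken as a single multiplier, since \<open>\<partial>\<^sub>x\<close> alone does not map \<open>H\<^sup>s\<close> into \<open>L\<^sup>2\<close>
  for \<open>s < 1\<close>.
\<close>

definition K_dx :: "real l2 \<Rightarrow> real l2" where
  "K_dx = fourier_mult (\<lambda>\<xi>. complex_of_real (K_symbol \<xi>) * (\<i> * complex_of_real \<xi>))"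

section \<open>Sobolev spaces\<close>

text \<open>Intended for \<open>s \<ge> 0\<close>, where \<open>H\<^sup>s\<close> is a subspace of \<open>L\<^sup>2\<close>.\<close>

definition sobolev :: "real \<Rightarrow> real l2 set" where
  "sobolev s = {f. integrable lborel (\<lambda>\<xi>. (1 + \<xi>\<^sup>2) powr s * (norm (rep_l2 (fourier f) \<xi>))\<^sup>2)}"

definition sobolev_norm :: "real \<Rightarrow> real l2 \<Rightarrow> real" where
  "sobolev_norm s f =
     sqrt (LINT \<xi>|lborel. (1 + \<xi>\<^sup>2) powr s * (norm (rep_l2 (fourier f) \<xi>))\<^sup>2)"

type_synonym state = "real l2 \<times> real l2"

definition X_space :: "real \<Rightarrow> state set" where
  "X_space s = sobolev s \<times> sobolev s"

definition X_norm :: "real \<Rightarrow> state \<Rightarrow> real" where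
  "X_norm s v = sqrt ((sobolev_norm s (fst v))\<^sup>2 + (sobolev_norm s (snd v))\<^sup>2)"

text \<open>
  Functions on \<open>[0,T]\<close> are represented by functions on \<open>\<real>\<close> that vanish off \<open>[0,T]\<close>, so that
  equality of functions is equality on \<open>[0,T]\<close>.
\<close>

definition XT_space :: "real \<Rightarrow> real \<Rightarrow> (real \<Rightarrow> state) set" where
  "XT_space s T = {v.
     (\<forall>t\<in>{0..T}. v t \<in> X_space s) \<and>
     (\<forall>t\<in>{0..T}. ((\<lambda>t'. X_norm s (v t' - v t)) \<longlongrightarrow> 0) (at t within {0..T})) \<and>
     (\<forall>t. t \<notin> {0..T} \<longrightarrow> v t = 0)}"

definition XT_norm :: "real \<Rightarrow> real \<Rightarrow> (real \<Rightarrow> state) \<Rightarrow> real" where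
  "XT_norm s T v = (SUP t\<in>{0..T}. X_norm s (v t))"

section \<open>The integral equation\<close>

definition rot :: "state \<Rightarrow> state" where
  "rot = (\<lambda>(a, b). ((1 / sqrt 2) *\<^sub>R (a + b), (1 / sqrt 2) *\<^sub>R (a - b)))"

definition evol :: "real \<Rightarrow> state \<Rightarrow> state" where
  "evol t = rot \<circ>
     (\<lambda>(a, b). (fourier_mult (\<lambda>\<xi>. cis (- (t * \<xi>))) a, fourier_mult (\<lambda>\<xi>. cis (t * \<xi>)) b)) \<circ> rot"

definition nonlin :: "state \<Rightarrow> state" where
  "nonlin = (\<lambda>(\<eta>, u). (K_dx (mult_l2 \<eta> u), K_dx ((1 / 2) *\<^sub>R mult_l2 u u)))"

text \<open>
  The integral is the vector-valued integral in \<open>L\<^sup>2 \<times> L\<^sup>2\<close>. For \<open>v\<close> in \<open>XT_space s T\<close> with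
  \<open>s > 1/2\<close> the integrand is continuous into \<open>X_space s\<close>, and the integral in that space is the
  same element.
\<close>

definition duhamel :: "(real \<Rightarrow> state) \<Rightarrow> state \<Rightarrow> real \<Rightarrow> state" where
  "duhamel v v0 t = evol t v0 - integral {0..t} (\<lambda>t'. evol (t - t') (nonlin (v t')))"

definition solves :: "real \<Rightarrow> real \<Rightarrow> state \<Rightarrow> (real \<Rightarrow> state) \<Rightarrow> bool" where
  "solves s T v0 v \<longleftrightarrow> v \<in> XT_space s T \<and> (\<forall>t\<in>{0..T}. v t = duhamel v v0 t)"

definition flow :: "real \<Rightarrow> real \<Rightarrow> state \<Rightarrow> (real \<Rightarrow> state)" where
  "flow s T v0 = (THE v. solves s T v0 v)"

section \<open>Real analytic maps between normed spaces\<close>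

instantiation "fun" :: (type, real_vector) real_vector
begin

definition scaleR_fun :: "real \<Rightarrow> ('a \<Rightarrow> 'b) \<Rightarrow> 'a \<Rightarrow> 'b" where
  "scaleR_fun c f = (\<lambda>x. c *\<^sub>R f x)"

instance
  by standard (auto simp: scaleR_fun_def fun_eq_iff algebra_simps)

end

text \<open>
  Normed spaces are given by a carrier (a linear subspace of some type) and a norm on it.
  A \<open>k\<close>-linear map is represented by its values on lists of length \<open>k\<close>.
\<close>

definition multilinear_on :: "'a::real_vector set \<Rightarrow> 'b::real_vector set \<Rightarrow> nat \<Rightarrow> ('a list \<Rightarrow> 'b) \<Rightarrow> bool"
  where
  "multilinear_on E F k A \<longleftrightarrow>
     (\<forall>xs. length xs = k \<and> set xs \<subseteq> E \<longrightarrow> A xs \<in> F \<and>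
        (\<forall>i<k. \<forall>y\<in>E. \<forall>z\<in>E. \<forall>c d.
           A (xs[i := c *\<^sub>R y + d *\<^sub>R z]) = c *\<^sub>R A (xs[i := y]) + d *\<^sub>R A (xs[i := z])))"

definition symmetric_on :: "'a set \<Rightarrow> nat \<Rightarrow> ('a list \<Rightarrow> 'b) \<Rightarrow> bool" where
  "symmetric_on E k A \<longleftrightarrow>
     (\<forall>xs ys. length xs = k \<and> set xs \<subseteq> E \<and> mset ys = mset xs \<longrightarrow> A ys = A xs)"

text \<open>
  \<open>f\<close> is real analytic on the open set \<open>U\<close> if near every \<open>a \<in> U\<close> it is the sum of a power
  series \<open>\<Sum>k. A k (h, \<dots>, h)\<close> of bounded symmetric \<open>k\<close>-linear maps \<open>A k\<close> with
  \<open>\<Sum>k. \<parallel>A k\<parallel> r\<^sup>k < \<infinity>\<close>; \<open>M k\<close> below is an upper bound for \<open>\<parallel>A k\<parallel>\<close>.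
\<close>

definition real_analytic_map ::
  "'a::real_vector set \<Rightarrow> ('a \<Rightarrow> real) \<Rightarrow> 'b::real_vector set \<Rightarrow> ('b \<Rightarrow> real) \<Rightarrow> 'a set \<Rightarrow> ('a \<Rightarrow> 'b) \<Rightarrow> bool"
  where
  "real_analytic_map E nE F nF U f \<longleftrightarrow>
     U \<subseteq> E \<and> f ` U \<subseteq> F \<and>
     (\<forall>a\<in>U. \<exists>r>0. \<exists>A M.
        (\<forall>k. multilinear_on E F k (A k) \<and> symmetric_on E k (A k)) \<and>
        (\<forall>k xs. length xs = k \<and> set xs \<subseteq> E \<longrightarrow> nF (A k xs) \<le> M k * prod_list (map nE xs)) \<and>
        (\<forall>k. 0 \<le> M k) \<and> summable (\<lambda>k. M k * r ^ k) \<and>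
        (\<forall>h\<in>E. nE h < r \<longrightarrow> a + h \<in> U \<and>
           (\<lambda>N. nF (f (a + h) - (\<Sum>k<N. A k (replicate k h)))) \<longlonglongrightarrow> 0))"

end

theory Submission
  imports Defs "HOL-Probability.Characteristic_Functions" "HOL-Combinatorics.Permutations"
begin

text \<open>
  The equation is solved by a contraction argument, and analyticity is read off the power series
  of the fixed point. Three facts about the equation make this work: the linear group acts by
  isometries, \<open>K \<partial>\<^sub>x\<close> is bounded because its symbol is \<open>\<i> tanh \<xi>\<close>, and \<open>H\<^sup>s\<close> is an algebra for
  \<open>s > 1/2\<close>. Hence the integral term is a bounded quadratic map of paths whose norm is proportional
  to the length \<open>T\<close> of the time interval.

  The Fourier side. Plancherel's identity for \<open>f\<close> in \<open>L\<^sup>1 \<inter> L\<^sup>2\<close> (\<open>plancherel\<close>) comes from pairing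
  \<open>\<bar>FT f\<bar>\<^sup>2\<close>, the transform of the autocorrelation of \<open>f\<close>, with wide Gaussians. The autocorrelation
  is continuous at the origin because translations are continuous in \<open>L\<^sup>2\<close>. The transform
  then extends to \<open>L\<^sup>2\<close>, and since it is a multiple of an isometry whose adjoint is the conjugated
  transform, it is onto (\<open>plancherel_transform_inverse\<close>). Real functions correspond to Hermitian
  transforms (\<open>fourier_surj\<close>), which gives a meaning to the multipliers \<open>m(D)\<close>.

  The function spaces. The Bessel potential \<open>J = (1 - \<partial>\<^sub>x\<^sup>2)\<^sup>-\<^sup>s\<^sup>/\<^sup>2\<close> maps \<open>L\<^sup>2\<close> onto \<open>H\<^sup>s\<close> and multiplies
  norms by the constant \<open>sqrt (2 \<pi>)\<close> (\<open>sobolev_eq_range_bessel\<close>, \<open>bessel_in_sobolev\<close>). All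
  operators in the equation commute with \<open>J\<close> or are carried by it to bounded operators, the product by the
  convolution estimate \<open>bessel_product\<close>. So the equation becomes one in the Banach space
  \<open>L\<^sup>2 \<times> L\<^sup>2\<close>, and its paths become bounded continuous functions.

  The abstract equation. In a Banach space, \<open>z = free y + interaction z z\<close> has a solution
  in the ball of radius \<open>2 \<parallel>y\<parallel>\<close> for short times (\<open>mild_solution_exists\<close>), and it is unique among all
  continuous paths by a Gronwall argument (\<open>mild_solution_unique\<close>). Around a datum \<open>a\<close> with solution
  \<open>g a\<close>, the difference \<open>w = g (a + h) - g a\<close> satisfies \<open>w = R (L h) + R (Q w w)\<close> with \<open>L\<close> for
  \<open>free\<close>, \<open>Q\<close> for \<open>interaction\<close> and \<open>R\<close> the
  inverse of \<open>1 - 2 Q (g a)\<close>. The iterates of this equation are sums over all bracketings of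
  \<open>k\<close> copies of \<open>h\<close>, which form a convergent series of bounded \<open>k\<close>-linear maps
  (\<open>quadratic_solution_real_analytic\<close>).
\<close>

section \<open>Completeness of \<open>L\<^sup>2\<close>\<close>

lemma square_integrableD:
  assumes "square_integrable f"
  shows "f \<in> borel_measurable lborel" "f \<in> borel_measurable borel"
    "integrable lborel (\<lambda>x. (norm (f x))\<^sup>2)"
  using assms by (auto simp: square_integrable_def)

lemma square_integrable_diff:
  "square_integrable f \<Longrightarrow> square_integrable g \<Longrightarrow> square_integrable (\<lambda>x. f x - g x)"
  using square_integrable_add[of f "\<lambda>x. (-1) *\<^sub>R g x"] square_integrable_scaleR[of g "-1"] by simp

lemma square_integrable_bound:
  fixes f :: "real \<Rightarrow> 'a::euclidean_space" and g :: "real \<Rightarrow> 'b::euclidean_space"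
  assumes "square_integrable f" "g \<in> borel_measurable lborel"
    "AE x in lborel. norm (g x) \<le> norm (f x)"
  shows "square_integrable g"
proof -
  note [measurable] = square_integrableD(1)[OF assms(1)] assms(2)
  have "integrable lborel (\<lambda>x. (norm (g x))\<^sup>2)"
    by (rule Bochner_Integration.integrable_bound[OF square_integrableD(3)[OF assms(1)]])
      (use assms(3) in \<open>auto elim!: eventually_mono intro!: power_mono\<close>)
  then show ?thesis
    using assms(2) by (simp add: square_integrable_def)
qed

lemma square_integrable_cong_AE:
  assumes "square_integrable f" "g \<in> borel_measurable lborel" "AE x in lborel. f x = g x"
  shows "square_integrable g"
  by (rule square_integrable_bound[OF assms(1,2)]) (use assms(3) in \<open>auto elim!: eventually_mono\<close>)

lemma square_integrable_rep [simp, intro]: "square_integrable (rep_l2 f)"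
  using Quotient3_rep_reflp[OF Quotient3_l2, of f] by (simp add: l2_rel_def)

lemma measurable_rep_l2 [measurable, simp]:
  "rep_l2 f \<in> borel_measurable lborel" "rep_l2 f \<in> borel_measurable borel"
  using square_integrableD(1,2)[OF square_integrable_rep[of f]] by auto

lemma abs_rep_l2 [simp]: "abs_l2 (rep_l2 f) = f"
  by (rule Quotient3_abs_rep[OF Quotient3_l2])

lemma rep_abs_l2:
  assumes "square_integrable f" shows "AE x in lborel. rep_l2 (abs_l2 f) x = f x"
  using rep_abs_rsp_left[OF Quotient3_l2, of f f] assms by (simp add: l2_rel_def)

lemma abs_l2_eq_iff:
  assumes "square_integrable f" "square_integrable g"
  shows "abs_l2 f = abs_l2 g \<longleftrightarrow> (AE x in lborel. f x = g x)"
  using Quotient3_rel[OF Quotient3_l2, of f g] assms by (auto simp: l2_rel_def)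

lemma abs_l2_cong:
  assumes "square_integrable f" "g \<in> borel_measurable lborel" "AE x in lborel. f x = g x"
  shows "abs_l2 f = abs_l2 g"
  using abs_l2_eq_iff[OF assms(1) square_integrable_cong_AE[OF assms]] assms(3) by simp

lemma l2_eq_iff: "f = g \<longleftrightarrow> (AE x in lborel. rep_l2 f x = rep_l2 g x)"
  using abs_l2_eq_iff[of "rep_l2 f" "rep_l2 g"] by simp

lemma plus_abs_l2:
  assumes "square_integrable f" "square_integrable g"
  shows "abs_l2 f + abs_l2 g = abs_l2 (\<lambda>x. f x + g x)"
  using assms plus_l2.abs_eq[of f g] by (simp add: l2_rel_def)

lemma scaleR_abs_l2:
  assumes "square_integrable f" shows "c *\<^sub>R abs_l2 f = abs_l2 (\<lambda>x. c *\<^sub>R f x)"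
  using assms scaleR_l2.abs_eq[of f c] by (simp add: l2_rel_def)

lemma minus_abs_l2:
  assumes "square_integrable f" "square_integrable g"
  shows "abs_l2 f - abs_l2 g = abs_l2 (\<lambda>x. f x - g x)"
  using assms minus_l2.abs_eq[of f g] by (simp add: l2_rel_def)

lemma rep_plus_l2: "AE x in lborel. rep_l2 (f + g) x = rep_l2 f x + rep_l2 g x"
  using rep_abs_l2[OF square_integrable_add[of "rep_l2 f" "rep_l2 g"]]
    plus_abs_l2[of "rep_l2 f" "rep_l2 g"] by simp

lemma rep_scaleR_l2: "AE x in lborel. rep_l2 (c *\<^sub>R f) x = c *\<^sub>R rep_l2 f x"
  using rep_abs_l2[OF square_integrable_scaleR[of "rep_l2 f" c]]
    scaleR_abs_l2[of "rep_l2 f" c] by simp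

lemma inner_rep_l2: "f \<bullet> g = (LINT x|lborel. rep_l2 f x \<bullet> rep_l2 g x)"
  by (simp add: inner_l2_def)

lemma norm_rep_l2: "(norm f)\<^sup>2 = (LINT x|lborel. (norm (rep_l2 f x))\<^sup>2)"
  by (simp add: power2_norm_eq_inner inner_rep_l2)

lemma inner_abs_l2:
  assumes "square_integrable f" "square_integrable g"
  shows "abs_l2 f \<bullet> abs_l2 g = (LINT x|lborel. f x \<bullet> g x)"
  using assms inner_l2.abs_eq[of f g] by (simp add: l2_rel_def)

lemma norm_abs_l2:
  assumes "square_integrable f"
  shows "(norm (abs_l2 f))\<^sup>2 = (LINT x|lborel. (norm (f x))\<^sup>2)"
  using inner_abs_l2[OF assms assms] by (simp add: power2_norm_eq_inner)

lemma nn_norm_abs_l2: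
  assumes "square_integrable f"
  shows "(\<integral>\<^sup>+x. ennreal ((norm (f x))\<^sup>2) \<partial>lborel) = ennreal ((norm (abs_l2 f))\<^sup>2)"
  using nn_integral_eq_integral[OF square_integrableD(3)[OF assms]] norm_abs_l2[OF assms] by simp

lemma square_integrable_nn:
  assumes "f \<in> borel_measurable lborel" "(\<integral>\<^sup>+x. ennreal ((norm (f x))\<^sup>2) \<partial>lborel) < \<infinity>"
  shows "square_integrable f"
proof -
  note [measurable] = assms(1)
  show ?thesis using assms by (auto simp: square_integrable_def intro!: integrableI_bounded)
qed

text \<open>
  Fatou's lemma for a sequence in \<open>L\<^sup>2\<close> that converges pointwise. It puts the pointwise limit into
  \<open>L\<^sup>2\<close> and at the same time turns a Cauchy condition into convergence in norm.
\<close>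

lemma fatou_l2:
  fixes f :: "nat \<Rightarrow> 'a::euclidean_space l2"
  assumes "g \<in> borel_measurable lborel"
    "AE x in lborel. (\<lambda>n. rep_l2 (f n) x) \<longlonglongrightarrow> g x"
    "eventually (\<lambda>n. norm (f n - h) \<le> c) sequentially" "0 \<le> c"
  shows "square_integrable g" "norm (abs_l2 g - h) \<le> c"
proof -
  note [measurable] = assms(1)
  let ?d = "\<lambda>n x. ennreal ((norm (rep_l2 (f n) x - rep_l2 h x))\<^sup>2)"
  have sq: "square_integrable (\<lambda>x. rep_l2 (f n) x - rep_l2 h x)" for n
    by (intro square_integrable_diff) auto
  have "(\<integral>\<^sup>+x. ennreal ((norm (g x - rep_l2 h x))\<^sup>2) \<partial>lborel)
      \<le> (\<integral>\<^sup>+x. liminf (\<lambda>n. ?d n x) \<partial>lborel)"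
  proof (rule nn_integral_mono_AE)
    show "AE x in lborel. ennreal ((norm (g x - rep_l2 h x))\<^sup>2) \<le> liminf (\<lambda>n. ?d n x)"
      using assms(2)
    proof eventually_elim
      case (elim x)
      have "(\<lambda>n. ?d n x) \<longlonglongrightarrow> ennreal ((norm (g x - rep_l2 h x))\<^sup>2)"
        by (intro tendsto_intros elim)
      from lim_imp_Liminf[OF _ this] show ?case by simp
    qed
  qed
  also have "\<dots> \<le> liminf (\<lambda>n. \<integral>\<^sup>+x. ?d n x \<partial>lborel)"
    by (rule nn_integral_liminf) auto
  also have "\<dots> = liminf (\<lambda>n. ennreal ((norm (f n - h))\<^sup>2))"
    by (subst nn_norm_abs_l2[OF sq], subst minus_abs_l2[symmetric]) auto
  also have "\<dots> \<le> ennreal (c\<^sup>2)"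
    by (rule Liminf_le)
      (use assms(3) in \<open>auto elim!: eventually_mono intro!: ennreal_leI power_mono\<close>)
  finally have le: "(\<integral>\<^sup>+x. ennreal ((norm (g x - rep_l2 h x))\<^sup>2) \<partial>lborel) \<le> ennreal (c\<^sup>2)" .
  have sqd: "square_integrable (\<lambda>x. g x - rep_l2 h x)"
    by (rule square_integrable_nn) (use le in \<open>auto intro: le_less_trans\<close>)
  from square_integrable_add[OF sqd square_integrable_rep[of h]]
  show g: "square_integrable g" by simp
  have "(norm (abs_l2 g - h))\<^sup>2 \<le> c\<^sup>2"
    using le nn_norm_abs_l2[OF sqd] minus_abs_l2[OF g square_integrable_rep[of h]]
    by simp
  then show "norm (abs_l2 g - h) \<le> c"
    using assms(4) by (simp add: power2_le_iff_abs_le)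
qed

lemma Cauchy_geometric_subsequence:
  fixes X :: "nat \<Rightarrow> 'a::metric_space" and e :: "nat \<Rightarrow> real"
  assumes "Cauchy X" "\<And>n. 0 < e n"
  obtains r :: "nat \<Rightarrow> nat" where "strict_mono r" "\<And>n. dist (X (r (Suc n))) (X (r n)) < e n"
proof -
  have "\<forall>k. \<exists>N. \<forall>m\<ge>N. \<forall>n\<ge>N. dist (X m) (X n) < e k"
    using assms unfolding Cauchy_def by blast
  then obtain N where N: "\<And>k m n. m \<ge> N k \<Longrightarrow> n \<ge> N k \<Longrightarrow> dist (X m) (X n) < e k"
    by metis
  define r where "r k = (\<Sum>i\<le>k. N i) + k" for k
  have r: "strict_mono r" by (rule strict_monoI_Suc) (simp add: r_def)
  have ge: "N k \<le> r k" for k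
    unfolding r_def using member_le_sum[of k "{..k}" N] by simp
  have "dist (X (r (Suc n))) (X (r n)) < e n" for n
    by (rule N) (use ge[of n] strict_monoD[OF r, of n "Suc n"] in linarith)+
  with r show ?thesis by (rule that)
qed

text \<open>
  The weights \<open>4\<^sup>n\<close> leave the series of the squared increments integrable. It is therefore finite almost
  everywhere, which bounds the \<open>n\<close>-th increment at almost every \<open>x\<close> by a multiple of \<open>2\<^sup>-\<^sup>n\<close>.
\<close>

lemma l2_geometric_imp_AE_convergent:
  fixes f :: "nat \<Rightarrow> 'a::euclidean_space l2"
  assumes "\<And>n. norm (f (Suc n) - f n) < (1/4) ^ n"
  shows "AE x in lborel. convergent (\<lambda>n. rep_l2 (f n) x)"
proof -
  let ?d = "\<lambda>n x. rep_l2 (f (Suc n)) x - rep_l2 (f n) x"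
  have sq: "square_integrable (?d n)" for n
    by (intro square_integrable_diff) auto
  have "(\<integral>\<^sup>+x. (\<Sum>n. ennreal (4 ^ n * (norm (?d n x))\<^sup>2)) \<partial>lborel)
      = (\<Sum>n. \<integral>\<^sup>+x. ennreal (4 ^ n * (norm (?d n x))\<^sup>2) \<partial>lborel)"
    by (rule nn_integral_suminf) auto
  also have "\<dots> = (\<Sum>n. ennreal (4 ^ n * (norm (f (Suc n) - f n))\<^sup>2))"
    by (simp add: ennreal_mult nn_integral_cmult nn_norm_abs_l2[OF sq] minus_abs_l2[symmetric])
  also have "\<dots> \<le> (\<Sum>n. ennreal ((1/4) ^ n))"
  proof (intro suminf_le ennreal_leI)
    fix n
    have "(norm (f (Suc n) - f n))\<^sup>2 \<le> ((1/4) ^ n)\<^sup>2"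
      by (rule power_mono) (use less_imp_le[OF assms[of n]] in auto)
    then have "4 ^ n * (norm (f (Suc n) - f n))\<^sup>2 \<le> 4 ^ n * ((1/4) ^ n)\<^sup>2"
      by (intro mult_left_mono) auto
    also have "\<dots> = (1/4) ^ n" by (simp add: power2_eq_square field_simps)
    finally show "4 ^ n * (norm (f (Suc n) - f n))\<^sup>2 \<le> (1/4) ^ n" .
  qed (rule summableI)+
  also have "\<dots> < \<infinity>"
    by (subst suminf_ennreal2) (auto intro: summable_geometric)
  finally have "AE x in lborel. (\<Sum>n. ennreal (4 ^ n * (norm (?d n x))\<^sup>2)) \<noteq> \<infinity>"
    by (intro nn_integral_noteq_infinite) auto
  then show ?thesis
  proof eventually_elim
    case (elim x)
    then have "summable (\<lambda>n. 4 ^ n * (norm (?d n x))\<^sup>2)"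
      by (intro summable_suminf_not_top) auto
    then have "Bseq (\<lambda>n. 4 ^ n * (norm (?d n x))\<^sup>2)"
      by (rule convergent_imp_Bseq[OF convergentI[OF summable_LIMSEQ_zero]])
    then obtain K where K: "K > 0" "\<And>n. 4 ^ n * (norm (?d n x))\<^sup>2 \<le> K"
      unfolding Bseq_def by auto
    have le: "norm (?d n x) \<le> sqrt K * (1/2) ^ n" for n
    proof (rule power2_le_imp_le)
      have "(4::real) ^ n = (2 ^ n)\<^sup>2" by (simp add: power2_eq_square flip: power_mult_distrib)
      with K(2)[of n] have "(2 ^ n)\<^sup>2 * (norm (?d n x))\<^sup>2 \<le> K" by simp
      then show "(norm (?d n x))\<^sup>2 \<le> (sqrt K * (1/2) ^ n)\<^sup>2"
        using K(1) by (simp add: power_mult_distrib power_divide field_simps)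
    qed (use K(1) in simp)
    have "summable (\<lambda>n. sqrt K * (1/2) ^ n)"
      by (intro summable_mult summable_geometric) simp
    then have "summable (\<lambda>n. ?d n x)"
      by (rule summable_comparison_test'[where N = 0]) (rule le)
    then have "convergent (\<lambda>n. \<Sum>i<n. ?d i x)" by (simp add: summable_iff_convergent)
    moreover have "(\<Sum>i<n. ?d i x) = rep_l2 (f n) x - rep_l2 (f 0) x" for n
      by (rule sum_lessThan_telescope)
    ultimately have "convergent (\<lambda>n. rep_l2 (f n) x - rep_l2 (f 0) x)" by simp
    from convergent_add[OF this convergent_const[of "rep_l2 (f 0) x"]] show ?case by simp
  qed
qed

text \<open>
  The Riesz--Fischer theorem: a subsequence with rapidly decreasing increments converges almost
  everywhere, and its pointwise limit is the limit in norm.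
\<close>

instance l2 :: (euclidean_space) banach
proof
  fix X :: "nat \<Rightarrow> 'a l2"
  assume X: "Cauchy X"
  then obtain r where r: "strict_mono r" "\<And>n. dist (X (r (Suc n))) (X (r n)) < (1/4) ^ n"
    by (rule Cauchy_geometric_subsequence[of X "\<lambda>n. (1/4) ^ n"]) auto
  let ?f = "\<lambda>n. X (r n)"
  have conv: "AE x in lborel. convergent (\<lambda>n. rep_l2 (?f n) x)"
    by (rule l2_geometric_imp_AE_convergent) (use r in \<open>simp add: dist_norm\<close>)
  define g where "g x = lim (\<lambda>n. rep_l2 (?f n) x)" for x
  have [measurable]: "g \<in> borel_measurable lborel"
    unfolding g_def by measurable
  have g: "AE x in lborel. (\<lambda>n. rep_l2 (?f n) x) \<longlonglongrightarrow> g x"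
    using conv by eventually_elim (simp add: g_def convergent_LIMSEQ_iff)
  have "?f \<longlonglongrightarrow> abs_l2 g"
  proof (rule metric_LIMSEQ_I)
    fix e :: real assume e: "e > 0"
    then obtain N where N: "\<And>m n. m \<ge> N \<Longrightarrow> n \<ge> N \<Longrightarrow> dist (X m) (X n) < e / 2"
      using metric_CauchyD[OF X, of "e / 2"] by (metis half_gt_zero)
    have "dist (?f n) (abs_l2 g) < e" if "n \<ge> N" for n
    proof -
      have "eventually (\<lambda>m. norm (?f m - ?f n) \<le> e / 2) sequentially"
        using eventually_ge_at_top[of N]
      proof eventually_elim
        case (elim m)
        then show ?case
          using N[of "r m" "r n"] seq_suble[OF r(1), of m] seq_suble[OF r(1), of n] that
          by (simp add: dist_norm)
      qed
      from fatou_l2(2)[OF _ g this] e show ?thesis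
        by (simp add: dist_norm norm_minus_commute)
    qed
    then show "\<exists>N. \<forall>n\<ge>N. dist (?f n) (abs_l2 g) < e" by blast
  qed
  then have "X \<longlonglongrightarrow> abs_l2 g"
    using Cauchy_converges_subseq[OF X r(1)] by (simp add: o_def)
  then show "convergent X" by (rule convergentI)
qed

lemma measurable_cis [measurable]: "cis \<in> borel_measurable borel"
  by (intro borel_measurable_continuous_onI continuous_intros)

lemma measurable_cnj [measurable]: "cnj \<in> borel_measurable borel"
  by (intro borel_measurable_continuous_onI continuous_intros)

lemma dominated_convergence_l2:
  fixes g :: "nat \<Rightarrow> real \<Rightarrow> 'a::euclidean_space" and h :: "real \<Rightarrow> real"
  assumes [measurable]: "\<And>k. g k \<in> borel_measurable lborel" "f \<in> borel_measurable lborel"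
    and h: "square_integrable h"
    and lim: "AE x in lborel. (\<lambda>k. g k x) \<longlonglongrightarrow> f x"
    and bound: "\<And>k. AE x in lborel. norm (g k x) \<le> h x"
  shows "square_integrable f" "\<And>k. square_integrable (g k)"
    "(\<lambda>k. abs_l2 (g k)) \<longlonglongrightarrow> abs_l2 f"
proof -
  note [measurable] = square_integrableD(1)[OF h]
  have bound': "AE x in lborel. \<forall>k. norm (g k x) \<le> h x"
    using bound by (simp add: AE_all_countable)
  have fh: "AE x in lborel. norm (f x) \<le> h x"
    using lim bound'
  proof eventually_elim
    case (elim x)
    show ?case by (rule LIMSEQ_le_const2[OF tendsto_norm[OF elim(1)]]) (use elim(2) in auto)
  qed
  show sf: "square_integrable f"
    by (rule square_integrable_bound[OF h]) (use fh in \<open>auto elim!: eventually_mono\<close>)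
  show sg: "square_integrable (g k)" for k
    by (rule square_integrable_bound[OF h]) (use bound[of k] in \<open>auto elim!: eventually_mono\<close>)
  have "(\<lambda>k. LINT x|lborel. (norm (g k x - f x))\<^sup>2) \<longlonglongrightarrow> (LINT x::real|lborel. 0::real)"
  proof (rule integral_dominated_convergence[where w = "\<lambda>x. 4 * (norm (h x))\<^sup>2"])
    show "integrable lborel (\<lambda>x. 4 * (norm (h x))\<^sup>2)"
      using square_integrableD(3)[OF h] by simp
    show "AE x in lborel. (\<lambda>k. (norm (g k x - f x))\<^sup>2) \<longlonglongrightarrow> 0"
      using lim
    proof eventually_elim
      case (elim x)
      from tendsto_power[OF tendsto_norm[OF tendsto_diff[OF elim tendsto_const[of "f x"]]], of 2]
      show ?case by simp
    qed
    show "AE x in lborel. norm ((norm (g k x - f x))\<^sup>2) \<le> 4 * (norm (h x))\<^sup>2" for k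
      using bound[of k] fh
    proof eventually_elim
      case (elim x)
      have "norm (g k x - f x) \<le> 2 * norm (h x)"
        using norm_triangle_ineq4[of "g k x" "f x"] elim by simp
      from power_mono[OF this, of 2] show ?case by (simp add: power_mult_distrib)
    qed
  qed auto
  then have "(\<lambda>k. (norm (abs_l2 (g k) - abs_l2 f))\<^sup>2) \<longlonglongrightarrow> 0"
    by (simp add: minus_abs_l2[OF sg sf] norm_abs_l2[OF square_integrable_diff[OF sg sf]])
  from tendsto_real_sqrt[OF this]
  have "(\<lambda>k. norm (abs_l2 (g k) - abs_l2 f)) \<longlonglongrightarrow> 0" by simp
  then show "(\<lambda>k. abs_l2 (g k)) \<longlonglongrightarrow> abs_l2 f"
    by (simp add: LIM_zero_iff tendsto_norm_zero_iff)
qed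

section \<open>Convolution and the Fourier integral\<close>

text \<open>
  The Fourier integral with the normalization of \<open>fourier\<close>. It is meant for integrable functions;
  on others it takes the default value of the integral, zero, wherever the integrand is not integrable.
\<close>

definition FT :: "(real \<Rightarrow> complex) \<Rightarrow> real \<Rightarrow> complex" where
  "FT f \<xi> = (LINT x|lborel. cis (- (x * \<xi>)) * f x)"

lemma integrable_cis_mult:
  assumes "integrable lborel f" "g \<in> borel_measurable borel"
  shows "integrable lborel (\<lambda>x. cis (g x) * f x)"
proof -
  note [measurable] = assms(2) borel_measurable_integrable[OF assms(1)]
  show ?thesis
    by (rule Bochner_Integration.integrable_bound[OF assms(1)]) (auto simp: norm_mult)
qed

lemma measurable_FT [measurable]:
  assumes [measurable]: "f \<in> borel_measurable borel"
  shows "FT f \<in> borel_measurable borel"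
proof -
  have "(\<lambda>\<xi>. FT f \<xi>) \<in> borel_measurable lborel"
    unfolding FT_def by (rule lborel.borel_measurable_lebesgue_integral) measurable
  then show ?thesis by simp
qed

lemma norm_FT_le: "norm (FT f \<xi>) \<le> (LINT x|lborel. norm (f x))"
  unfolding FT_def using integral_norm_bound[of lborel "\<lambda>x. cis (- (x * \<xi>)) * f x"]
  by (simp add: norm_mult)

lemma FT_diff:
  assumes "integrable lborel f" "integrable lborel g"
  shows "FT (\<lambda>x. f x - g x) \<xi> = FT f \<xi> - FT g \<xi>"
  using integrable_cis_mult[OF assms(1), of "\<lambda>x. - (x * \<xi>)"]
    integrable_cis_mult[OF assms(2), of "\<lambda>x. - (x * \<xi>)"]
  by (simp add: FT_def ring_distribs Bochner_Integration.integral_diff)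

text \<open>
  The kernel \<open>e\<^sup>-\<^sup>i\<^sup>x\<^sup>\<xi>\<close> is symmetric, so Fubini's theorem moves the transform from one factor to
  the other.
\<close>

lemma FT_multiplication:
  assumes f: "integrable lborel f" and g: "integrable lborel g"
  shows "(LINT \<xi>|lborel. FT f \<xi> * g \<xi>) = (LINT x|lborel. f x * FT g x)"
proof -
  note [measurable] = borel_measurable_integrable[OF f] borel_measurable_integrable[OF g]
  have "integrable (lborel \<Otimes>\<^sub>M lborel) (\<lambda>(x, \<xi>). cis (- (x * \<xi>)) * f x * g \<xi>)"
  proof (rule lborel_pair.Fubini_integrable)
    show "integrable lborel
      (\<lambda>x. LINT \<xi>|lborel. norm (case (x, \<xi>) of (x, \<xi>) \<Rightarrow> cis (- (x * \<xi>)) * f x * g \<xi>))"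
      using f by (simp add: norm_mult)
    show "AE x in lborel. integrable lborel
      (\<lambda>\<xi>. case (x, \<xi>) of (x, \<xi>) \<Rightarrow> cis (- (x * \<xi>)) * f x * g \<xi>)"
    proof (rule AE_I2)
      fix x
      from integrable_mult_right[OF integrable_cis_mult[OF g, of "\<lambda>\<xi>. - (x * \<xi>)"], of "f x"]
      show "integrable lborel (\<lambda>\<xi>. case (x, \<xi>) of (x, \<xi>) \<Rightarrow> cis (- (x * \<xi>)) * f x * g \<xi>)"
        by (simp add: ac_simps)
    qed
  qed measurable
  from lborel_pair.Fubini_integral[OF this]
  have F: "(LINT \<xi>|lborel. LINT x|lborel. cis (- (x * \<xi>)) * f x * g \<xi>)
      = (LINT x|lborel. LINT \<xi>|lborel. cis (- (x * \<xi>)) * f x * g \<xi>)" .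
  have 1: "(LINT x|lborel. cis (- (x * \<xi>)) * f x * g \<xi>) = FT f \<xi> * g \<xi>" for \<xi>
    by (simp add: FT_def)
  have 2: "(LINT \<xi>|lborel. cis (- (x * \<xi>)) * f x * g \<xi>) = f x * FT g x" for x
  proof -
    have "(LINT \<xi>|lborel. cis (- (x * \<xi>)) * f x * g \<xi>)
        = (LINT \<xi>|lborel. f x * (cis (- (\<xi> * x)) * g \<xi>))"
      by (simp add: ac_simps)
    then show ?thesis by (simp add: FT_def)
  qed
  from F show ?thesis unfolding 1 2 .
qed

definition conv :: "(real \<Rightarrow> complex) \<Rightarrow> (real \<Rightarrow> complex) \<Rightarrow> real \<Rightarrow> complex" where
  "conv f g z = (LINT y|lborel. f (z - y) * g y)"

text \<open>
  Tonelli's theorem and translation invariance. With values in \<open>[0, \<infinity>]\<close> the identity serves for the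
  integrability of convolutions and for Young's inequality alike.
\<close>

lemma nn_integral_conv:
  fixes a b :: "real \<Rightarrow> ennreal"
  assumes [measurable]: "a \<in> borel_measurable borel" "b \<in> borel_measurable borel"
  shows "(\<integral>\<^sup>+z. \<integral>\<^sup>+y. a (z - y) * b y \<partial>lborel \<partial>lborel)
    = (\<integral>\<^sup>+x. a x \<partial>lborel) * (\<integral>\<^sup>+x. b x \<partial>lborel)"
proof -
  have "(\<integral>\<^sup>+z. \<integral>\<^sup>+y. a (z - y) * b y \<partial>lborel \<partial>lborel)
      = (\<integral>\<^sup>+y. \<integral>\<^sup>+z. a (z - y) * b y \<partial>lborel \<partial>lborel)"
    by (rule lborel_pair.Fubini'[symmetric]) measurable
  also have "\<dots> = (\<integral>\<^sup>+y. (\<integral>\<^sup>+x. a x \<partial>lborel) * b y \<partial>lborel)"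
  proof (rule nn_integral_cong)
    fix y
    have "(\<integral>\<^sup>+z. a (z - y) * b y \<partial>lborel) = (\<integral>\<^sup>+z. a (z - y) \<partial>lborel) * b y"
      by (rule nn_integral_multc) measurable
    also have "(\<integral>\<^sup>+z. a (z - y) \<partial>lborel) = (\<integral>\<^sup>+x. a x \<partial>lborel)"
      by (subst nn_integral_real_affine[of a 1 "- y"]) auto
    finally show "(\<integral>\<^sup>+z. a (z - y) * b y \<partial>lborel) = (\<integral>\<^sup>+x. a x \<partial>lborel) * b y" .
  qed
  also have "\<dots> = (\<integral>\<^sup>+x. a x \<partial>lborel) * (\<integral>\<^sup>+x. b x \<partial>lborel)"
    by (rule nn_integral_cmult) measurable
  finally show ?thesis .
qed

lemma integrable_conv_pair:
  fixes f g :: "real \<Rightarrow> complex"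
  assumes f: "integrable lborel f" and g: "integrable lborel g"
  shows "integrable (lborel \<Otimes>\<^sub>M lborel) (\<lambda>(z, y). f (z - y) * g y)"
proof (rule integrableI_bounded)
  note [measurable] = borel_measurable_integrable[OF f] borel_measurable_integrable[OF g]
  show "(\<lambda>(z, y). f (z - y) * g y) \<in> borel_measurable (lborel \<Otimes>\<^sub>M lborel)"
    by measurable
  have "(\<integral>\<^sup>+p. ennreal (norm (case p of (z, y) \<Rightarrow> f (z - y) * g y)) \<partial>(lborel \<Otimes>\<^sub>M lborel))
      = (\<integral>\<^sup>+z. \<integral>\<^sup>+y. ennreal (norm (f (z - y))) * ennreal (norm (g y)) \<partial>lborel \<partial>lborel)"
    by (subst lborel.nn_integral_fst[symmetric]) (auto simp: norm_mult ennreal_mult)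
  also have "\<dots> = (\<integral>\<^sup>+x. ennreal (norm (f x)) \<partial>lborel) * (\<integral>\<^sup>+x. ennreal (norm (g x)) \<partial>lborel)"
    by (rule nn_integral_conv[of "\<lambda>x. ennreal (norm (f x))" "\<lambda>x. ennreal (norm (g x))"]) auto
  also have "\<dots> < \<infinity>"
    using f g by (auto simp: integrable_iff_bounded ennreal_mult_less_top)
  finally show "(\<integral>\<^sup>+p. ennreal (norm (case p of (z, y) \<Rightarrow> f (z - y) * g y))
      \<partial>(lborel \<Otimes>\<^sub>M lborel)) < \<infinity>" .
qed

lemma integrable_conv:
  "integrable lborel f \<Longrightarrow> integrable lborel g \<Longrightarrow> integrable lborel (conv f g)"
  using lborel_pair.integrable_fst[OF integrable_conv_pair[of f g]]
  by (simp add: conv_def[abs_def])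

lemma integral_conv:
  assumes f: "integrable lborel f" and g: "integrable lborel g"
  shows "(LINT z|lborel. conv f g z) = (LINT x|lborel. f x) * (LINT x|lborel. g x)"
proof -
  have "(LINT z|lborel. conv f g z) = (LINT y|lborel. LINT z|lborel. f (z - y) * g y)"
    unfolding conv_def using lborel_pair.Fubini_integral[OF integrable_conv_pair[OF f g]] by simp
  also have "\<dots> = (LINT y|lborel. (LINT x|lborel. f x) * g y)"
  proof (rule Bochner_Integration.integral_cong[OF refl])
    fix y
    have "(LINT z|lborel. f (z - y)) = (LINT x|lborel. f x)"
      using lborel_integral_real_affine[of 1 f "- y"] by simp
    then show "(LINT z|lborel. f (z - y) * g y) = (LINT x|lborel. f x) * g y" by simp
  qed
  finally show ?thesis by simp
qed

text \<open>
  The character splits as \<open>e\<^sup>-\<^sup>i\<^sup>z\<^sup>\<xi> = e\<^sup>-\<^sup>i\<^sup>(\<^sup>z\<^sup>-\<^sup>y\<^sup>)\<^sup>\<xi> e\<^sup>-\<^sup>i\<^sup>y\<^sup>\<xi>\<close>, so this is \<open>integral_conv\<close> for the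
  modulated functions.
\<close>

lemma FT_conv:
  assumes f: "integrable lborel f" and g: "integrable lborel g"
  shows "FT (conv f g) \<xi> = FT f \<xi> * FT g \<xi>"
proof -
  let ?e = "\<lambda>x. cis (- (x * \<xi>))"
  have "conv (\<lambda>x. ?e x * f x) (\<lambda>x. ?e x * g x) z = ?e z * conv f g z" for z
  proof -
    have "?e (z - y) * f (z - y) * (?e y * g y) = ?e z * (f (z - y) * g y)" for y
    proof -
      have "?e (z - y) * ?e y = ?e z" by (simp add: cis_mult algebra_simps)
      then show ?thesis by (metis mult.assoc mult.left_commute)
    qed
    then have "conv (\<lambda>x. ?e x * f x) (\<lambda>x. ?e x * g x) z = (LINT y|lborel. ?e z * (f (z - y) * g y))"
      unfolding conv_def by (rule Bochner_Integration.integral_cong[OF refl])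
    then show ?thesis unfolding conv_def by (simp only: integral_mult_right_zero)
  qed
  then have "FT (conv f g) \<xi> = (LINT z|lborel. conv (\<lambda>x. ?e x * f x) (\<lambda>x. ?e x * g x) z)"
    by (simp add: FT_def)
  also have "\<dots> = FT f \<xi> * FT g \<xi>"
    unfolding FT_def by (intro integral_conv integrable_cis_mult f g) auto
  finally show ?thesis .
qed

section \<open>Gaussians\<close>

text \<open>
  After rescaling this is the characteristic function of the standard normal distribution. The result
  is \<open>2 \<pi>\<close> times a probability density that concentrates at the origin as \<open>\<epsilon>\<close> tends to zero.
\<close>

lemma FT_gaussian:
  assumes "\<epsilon> > 0"
  shows "FT (\<lambda>\<xi>. complex_of_real (exp (- (\<epsilon> * \<xi>)\<^sup>2 / 2))) z
    = complex_of_real (2 * pi / \<epsilon> * std_normal_density (z / \<epsilon>))"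
proof -
  have "FT (\<lambda>\<xi>. complex_of_real (exp (- (\<epsilon> * \<xi>)\<^sup>2 / 2))) z
      = (1 / \<epsilon>) *\<^sub>R (LINT x|lborel. cis (- (x / \<epsilon> * z)) * complex_of_real (exp (- x\<^sup>2 / 2)))"
    unfolding FT_def using assms
    by (subst lborel_integral_real_affine[of "1 / \<epsilon>" _ 0]) auto
  also have "(LINT x|lborel. cis (- (x / \<epsilon> * z)) * complex_of_real (exp (- x\<^sup>2 / 2)))
      = (LINT x|lborel. sqrt (2 * pi) *\<^sub>R (std_normal_density x *\<^sub>R iexp (- (z / \<epsilon>) * x)))"
    by (rule Bochner_Integration.integral_cong)
      (auto simp: std_normal_density_def cis_conv_exp scaleR_conv_of_real algebra_simps)
  also have "\<dots> = sqrt (2 * pi) *\<^sub>R char std_normal_distribution (- (z / \<epsilon>))"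
    unfolding char_def integral_scaleR_right
    by (subst integral_density) (auto simp: normal_density_nonneg)
  also have "\<dots> = complex_of_real (sqrt (2 * pi) * exp (- (z / \<epsilon>)\<^sup>2 / 2))"
    unfolding char_std_normal_distribution by (simp add: scaleR_conv_of_real)
  also have "sqrt (2 * pi) * exp (- (z / \<epsilon>)\<^sup>2 / 2) = 2 * pi * std_normal_density (z / \<epsilon>)"
    using real_div_sqrt[of "2 * pi"] by (simp add: std_normal_density_def field_simps)
  finally show ?thesis using assms by (simp add: scaleR_conv_of_real)
qed

lemma integrable_std_normal_density: "integrable lborel std_normal_density"
  using integrable_std_normal_moment[of 0] by simp

lemma integral_std_normal_density: "(LINT x|lborel. std_normal_density x) = 1"
  using integral_std_normal_moment_even[of 0] by simp

lemma integrable_gaussian: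
  assumes "\<epsilon> > 0" shows "integrable lborel (\<lambda>\<xi>. exp (- (\<epsilon> * \<xi>)\<^sup>2 / 2) :: real)"
proof -
  have "integrable lborel (\<lambda>x. sqrt (2 * pi) * std_normal_density (0 + \<epsilon> * x))"
    using assms
    by (intro integrable_mult_right lborel_integrable_real_affine integrable_std_normal_density) auto
  then show ?thesis by (simp add: std_normal_density_def)
qed

section \<open>Continuity of translations in \<open>L\<^sup>2\<close>\<close>

lemma translate_l2:
  assumes f: "square_integrable f"
  shows "square_integrable (\<lambda>x. f (z + x))" "norm (abs_l2 (\<lambda>x. f (z + x))) = norm (abs_l2 f)"
proof -
  note [measurable] = square_integrableD(2)[OF f]
  have "integrable lborel (\<lambda>x. (norm (f (z + 1 * x)))\<^sup>2)"
    using lborel_integrable_real_affine[OF square_integrableD(3)[OF f], of 1 z] by simp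
  then show *: "square_integrable (\<lambda>x. f (z + x))"
    by (simp add: square_integrable_def)
  have "(norm (abs_l2 (\<lambda>x. f (z + x))))\<^sup>2 = (norm (abs_l2 f))\<^sup>2"
    unfolding norm_abs_l2[OF f] norm_abs_l2[OF *]
    by (subst lborel_integral_real_affine[of 1 "\<lambda>x. (norm (f x))\<^sup>2" z]) auto
  then show "norm (abs_l2 (\<lambda>x. f (z + x))) = norm (abs_l2 f)" by simp
qed

text \<open>
  Translations are isometries, hence the functions on which they act continuously form a closed
  set.
\<close>

lemma translate_continuous_closed:
  fixes f :: "real \<Rightarrow> 'a::euclidean_space"
  assumes f: "square_integrable f" and g: "\<And>k. square_integrable (g k)"
    and lim: "(\<lambda>k. abs_l2 (g k)) \<longlonglongrightarrow> abs_l2 f"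
    and cont: "\<And>k. (\<lambda>n::nat. abs_l2 (\<lambda>x. g k (z n + x))) \<longlonglongrightarrow> abs_l2 (g k)"
  shows "(\<lambda>n. abs_l2 (\<lambda>x. f (z n + x))) \<longlonglongrightarrow> abs_l2 f"
proof (rule metric_LIMSEQ_I)
  fix e :: real assume e: "e > 0"
  then obtain k where k: "norm (abs_l2 (g k) - abs_l2 f) < e / 3"
    using metric_LIMSEQ_D[OF lim, of "e / 3"] by (force simp: dist_norm)
  obtain N where N: "\<And>n. n \<ge> N \<Longrightarrow> norm (abs_l2 (\<lambda>x. g k (z n + x)) - abs_l2 (g k)) < e / 3"
    using metric_LIMSEQ_D[OF cont[of k], of "e / 3"] e by (force simp: dist_norm)
  have "dist (abs_l2 (\<lambda>x. f (z n + x))) (abs_l2 f) < e" if "n \<ge> N" for n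
  proof -
    have "norm (abs_l2 (\<lambda>x. f (z n + x)) - abs_l2 (\<lambda>x. g k (z n + x)))
        = norm (abs_l2 f - abs_l2 (g k))"
      using translate_l2(2)[OF square_integrable_diff[OF f g[of k]], of "z n"]
      by (simp add: minus_abs_l2 f g translate_l2(1))
    with k N[OF that] show ?thesis
      unfolding dist_norm
      using norm_triangle_ineq[of "abs_l2 (\<lambda>x. f (z n + x)) - abs_l2 (\<lambda>x. g k (z n + x))"
        "abs_l2 (\<lambda>x. g k (z n + x)) - abs_l2 (g k)"]
        norm_triangle_ineq[of "abs_l2 (\<lambda>x. f (z n + x)) - abs_l2 (g k)" "abs_l2 (g k) - abs_l2 f"]
      by (simp add: norm_minus_commute[of "abs_l2 f"])
  qed
  then show "\<exists>N. \<forall>n\<ge>N. dist (abs_l2 (\<lambda>x. f (z n + x))) (abs_l2 f) < e" by blast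
qed

lemma square_integrable_indicator_interval: "square_integrable (\<lambda>x. c * indicator {a..b} x :: real)"
proof -
  have "integrable lborel (\<lambda>x. c\<^sup>2 * indicator {a..b} x :: real)"
    by (intro integrable_mult_right integrable_real_indicator) (auto simp: emeasure_lborel_Icc_eq)
  moreover have "(c * indicator {a..b} x)\<^sup>2 = c\<^sup>2 * indicator {a..b} x" for x
    by (auto simp: indicator_def)
  ultimately show ?thesis by (simp add: square_integrable_def)
qed

lemma translate_continuous_compact_support:
  fixes f :: "real \<Rightarrow> 'a::euclidean_space"
  assumes f: "continuous_on UNIV f" and bound: "\<And>x. norm (f x) \<le> m"
    and supp: "\<And>x. m + 1 \<le> \<bar>x\<bar> \<Longrightarrow> f x = 0" and m: "0 < m" and z: "z \<longlonglongrightarrow> 0"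
  shows "(\<lambda>n::nat. abs_l2 (\<lambda>x. f (z n + x))) \<longlonglongrightarrow> abs_l2 f"
proof -
  have [measurable]: "f \<in> borel_measurable borel"
    by (rule borel_measurable_continuous_onI[OF f])
  obtain N where N: "\<And>n. n \<ge> N \<Longrightarrow> \<bar>z n\<bar> < 1"
    using metric_LIMSEQ_D[OF z, of 1] by (auto simp: dist_norm)
  have "(\<lambda>n. abs_l2 (\<lambda>x. f (z (n + N) + x))) \<longlonglongrightarrow> abs_l2 f"
  proof (rule dominated_convergence_l2(3)[where h = "\<lambda>x. m * indicator {-(m+2)..m+2} x"])
    show "AE x in lborel. (\<lambda>n. f (z (n + N) + x)) \<longlonglongrightarrow> f x"
    proof (rule AE_I2)
      fix x
      have "(\<lambda>n. z (n + N) + x) \<longlonglongrightarrow> 0 + x"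
        by (intro tendsto_intros LIMSEQ_ignore_initial_segment z)
      then show "(\<lambda>n. f (z (n + N) + x)) \<longlonglongrightarrow> f x"
        by (intro continuous_on_tendsto_compose[OF f]) auto
    qed
    show "AE x in lborel. norm (f (z (n + N) + x)) \<le> m * indicator {- (m + 2)..m + 2} x" for n
    proof (rule AE_I2)
      fix x
      show "norm (f (z (n + N) + x)) \<le> m * indicator {- (m + 2)..m + 2} x"
        using bound[of "z (n + N) + x"] supp[of "z (n + N) + x"] N[of "n + N"]
        by (cases "x \<in> {- (m + 2)..m + 2}") auto
    qed
  qed (auto intro: square_integrable_indicator_interval)
  then show ?thesis by (rule LIMSEQ_offset)
qed

text \<open>
  Lebesgue measurable functions are almost everywhere limits of continuous ones; cutting these off
  in range and domain turns that into approximation in \<open>L\<^sup>2\<close>.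
\<close>

lemma translate_continuous_bounded:
  fixes f :: "real \<Rightarrow> 'a::euclidean_space"
  assumes [measurable]: "f \<in> borel_measurable borel" and bound: "\<And>x. norm (f x) \<le> m"
    and supp: "\<And>x. m < \<bar>x\<bar> \<Longrightarrow> f x = 0" and m: "0 < m" and z: "z \<longlonglongrightarrow> 0"
  shows "(\<lambda>n::nat. abs_l2 (\<lambda>x. f (z n + x))) \<longlonglongrightarrow> abs_l2 f"
proof -
  have "f \<in> borel_measurable lebesgue"
    by (rule measurable_completion) simp
  from lebesgue_measurable_imp_measurable_on[OF this, of UNIV]
  obtain N g where N: "negligible N" and g: "\<And>n. continuous_on UNIV (g n)"
    and lim: "\<And>x. x \<notin> N \<Longrightarrow> (\<lambda>n::nat. g n x) \<longlonglongrightarrow> f x"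
    unfolding measurable_on_def by auto
  \<comment> \<open>The projection onto the ball of radius \<open>m\<close> fixes the values of \<open>f\<close> and bounds those of \<open>g\<close>.\<close>
  define P :: "'a \<Rightarrow> 'a" where "P = closest_point (cball 0 m)"
  define h where "h n x = max 0 (min 1 (m + 1 - \<bar>x\<bar>)) *\<^sub>R P (g n x)" for n x
  have P: "continuous_on UNIV P"
    unfolding P_def by (rule continuous_on_closest_point) (use m in auto)
  have P_le: "norm (P y) \<le> m" for y
    using closest_point_in_set[of "cball 0 m" y] m by (auto simp: P_def)
  have P_f: "P (f x) = f x" for x
    unfolding P_def by (rule closest_point_self) (use bound in auto)
  have h_cont: "continuous_on UNIV (h n)" for n
    unfolding h_def by (intro continuous_intros continuous_on_compose2[OF P g]) auto
  have h_le: "norm (h n x) \<le> m" for n x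
    using mult_mono[of "\<bar>max 0 (min 1 (m + 1 - \<bar>x\<bar>))\<bar>" 1 "norm (P (g n x))" m] P_le m
    by (auto simp: h_def)
  have h_supp: "h n x = 0" if "m + 1 \<le> \<bar>x\<bar>" for n x
    using that by (simp add: h_def)
  have "AE x in lborel. x \<notin> N"
    using AE_not_in[of N lebesgue] N by (simp add: negligible_iff_null_sets AE_completion_iff)
  then have hlim: "AE x in lborel. (\<lambda>n. h n x) \<longlonglongrightarrow> f x"
  proof eventually_elim
    case (elim x)
    have "(\<lambda>n. P (g n x)) \<longlonglongrightarrow> P (f x)"
      by (rule continuous_on_tendsto_compose[OF P lim[OF elim]]) auto
    then have "(\<lambda>n. h n x) \<longlonglongrightarrow> max 0 (min 1 (m + 1 - \<bar>x\<bar>)) *\<^sub>R P (f x)"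
      unfolding h_def by (intro tendsto_intros)
    moreover have "max 0 (min 1 (m + 1 - \<bar>x\<bar>)) *\<^sub>R P (f x) = f x"
      using supp[of x] P_f[of x] by (cases "m < \<bar>x\<bar>") auto
    ultimately show ?case by simp
  qed
  have h_meas: "h n \<in> borel_measurable lborel" for n
    using borel_measurable_continuous_onI[OF h_cont[of n]] by simp
  have h_dom: "AE x in lborel. norm (h n x) \<le> m * indicator {-(m+1)..m+1} x" for n
  proof (rule AE_I2)
    fix x show "norm (h n x) \<le> m * indicator {-(m+1)..m+1} x"
      using h_le[of n x] h_supp[of x n] by (cases "x \<in> {-(m+1)..m+1}") auto
  qed
  note dct = dominated_convergence_l2[OF h_meas _ square_integrable_indicator_interval hlim h_dom]
  show ?thesis
  proof (rule translate_continuous_closed)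
    show "square_integrable f" by (rule dct(1)) simp
    show "square_integrable (h k)" for k by (rule dct(2)) simp
    show "(\<lambda>k. abs_l2 (h k)) \<longlonglongrightarrow> abs_l2 f" by (rule dct(3)) simp
    show "(\<lambda>n. abs_l2 (\<lambda>x. h k (z n + x))) \<longlonglongrightarrow> abs_l2 (h k)" for k
      by (rule translate_continuous_compact_support[OF h_cont h_le h_supp m z])
  qed
qed

lemma truncation_tendsto_l2:
  fixes f :: "real \<Rightarrow> 'a::euclidean_space"
  assumes f: "square_integrable f" and S: "\<And>x. eventually (\<lambda>k. x \<in> S k) sequentially"
    and [measurable]: "\<And>k. S k \<in> sets borel"
  shows "\<And>k. square_integrable (\<lambda>x. indicator (S k) x *\<^sub>R f x)"
    "(\<lambda>k. abs_l2 (\<lambda>x. indicator (S k) x *\<^sub>R f x)) \<longlonglongrightarrow> abs_l2 f"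
proof -
  note [measurable] = square_integrableD(2)[OF f]
  have m: "(\<lambda>x. indicator (S k) x *\<^sub>R f x) \<in> borel_measurable lborel" for k
    by measurable
  have h: "square_integrable (\<lambda>x. norm (f x))"
    using f by (simp add: square_integrable_def)
  have lim: "AE x in lborel. (\<lambda>k. indicator (S k) x *\<^sub>R f x) \<longlonglongrightarrow> f x"
  proof (rule AE_I2)
    fix x
    have "eventually (\<lambda>k. indicator (S k) x *\<^sub>R f x = f x) sequentially"
      using S[of x] by eventually_elim simp
    then show "(\<lambda>k. indicator (S k) x *\<^sub>R f x) \<longlonglongrightarrow> f x" by (rule tendsto_eventually)
  qed
  have b: "AE x in lborel. norm (indicator (S k) x *\<^sub>R f x) \<le> norm (f x)" for k
    by (rule AE_I2) (auto simp: indicator_def)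
  note dct = dominated_convergence_l2[OF m _ h lim b]
  show "square_integrable (\<lambda>x. indicator (S k) x *\<^sub>R f x)" for k by (rule dct(2)) simp
  show "(\<lambda>k. abs_l2 (\<lambda>x. indicator (S k) x *\<^sub>R f x)) \<longlonglongrightarrow> abs_l2 f" by (rule dct(3)) simp
qed

lemma translate_continuous:
  fixes f :: "real \<Rightarrow> 'a::euclidean_space"
  assumes f: "square_integrable f" and z: "z \<longlonglongrightarrow> 0"
  shows "(\<lambda>n::nat. abs_l2 (\<lambda>x. f (z n + x))) \<longlonglongrightarrow> abs_l2 f"
proof -
  note [measurable] = square_integrableD(2)[OF f]
  define S where "S k = {x. norm (f x) \<le> real (Suc k) \<and> \<bar>x\<bar> \<le> real (Suc k)}" for k
  have [measurable]: "S k \<in> sets borel" for k unfolding S_def by measurable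
  have ev: "eventually (\<lambda>k. x \<in> S k) sequentially" for x
  proof -
    obtain n where n: "max (norm (f x)) \<bar>x\<bar> \<le> real n" using real_arch_simple by blast
    show ?thesis
      using eventually_ge_at_top[of n] by eventually_elim (use n in \<open>auto simp: S_def\<close>)
  qed
  show ?thesis
  proof (rule translate_continuous_closed[OF f])
    show "square_integrable (\<lambda>x. indicator (S k) x *\<^sub>R f x)" for k
      by (rule truncation_tendsto_l2(1)[OF f ev]) simp
    show "(\<lambda>k. abs_l2 (\<lambda>x. indicator (S k) x *\<^sub>R f x)) \<longlonglongrightarrow> abs_l2 f"
      by (rule truncation_tendsto_l2(2)[OF f ev]) simp
    show "(\<lambda>n. abs_l2 (\<lambda>x. indicator (S k) (z n + x) *\<^sub>R f (z n + x)))
        \<longlonglongrightarrow> abs_l2 (\<lambda>x. indicator (S k) x *\<^sub>R f x)" for k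
      by (rule translate_continuous_bounded[of "\<lambda>x. indicator (S k) x *\<^sub>R f x" "real (Suc k)"])
        (use z in \<open>auto simp: indicator_def S_def\<close>)
  qed
qed

section \<open>Plancherel's identity\<close>

text \<open>
  The convolution of \<open>f\<close> with its conjugated reflection is the autocorrelation of \<open>f\<close>. Seeing its
  real part as an inner product of a translate of \<open>f\<close> with \<open>f\<close> makes it bounded and continuous at the origin.
\<close>

lemma conv_reflect_eq_inner:
  assumes f: "square_integrable f"
  shows "Re (conv f (\<lambda>y. cnj (f (- y))) z) = abs_l2 (\<lambda>x. f (z + x)) \<bullet> abs_l2 f"
proof -
  note t = translate_l2(1)[OF f, of z]
  note [measurable] = square_integrableD(2)[OF f] square_integrableD(2)[OF t]
  have "integrable lborel (\<lambda>x. norm (f (z + x)) \<bullet> norm (f x))"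
    by (rule square_integrable_inner) (use f t in \<open>simp_all add: square_integrable_def\<close>)
  then have int: "integrable lborel (\<lambda>x. f (z + x) * cnj (f x))"
    by (rule Bochner_Integration.integrable_bound) (auto simp: norm_mult)
  have "conv f (\<lambda>y. cnj (f (- y))) z = (LINT x|lborel. f (z + x) * cnj (f x))"
    unfolding conv_def by (subst lborel_integral_real_affine[of "-1" _ 0]) auto
  also have "Re \<dots> = (LINT x|lborel. Re (f (z + x) * cnj (f x)))"
    by (rule integral_Re[OF int, symmetric])
  finally show ?thesis by (simp add: inner_abs_l2[OF t f] inner_complex_def)
qed

lemma FT_cnj: "FT (\<lambda>x. cnj (f x)) \<xi> = cnj (FT f (- \<xi>))"
proof -
  have "(LINT x|lborel. cis (- (x * \<xi>)) * cnj (f x)) = (LINT x|lborel. cnj (cis (- (x * - \<xi>)) * f x))"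
    by (simp add: cis_cnj)
  then show ?thesis unfolding FT_def by (simp only: Bochner_Integration.integral_cnj)
qed

lemma FT_reflect: "FT (\<lambda>x. f (- x)) \<xi> = FT f (- \<xi>)"
  unfolding FT_def by (subst lborel_integral_real_affine[of "-1" _ 0]) auto

text \<open>
  The function \<open>\<bar>FT f\<bar>\<^sup>2\<close> is the transform of the autocorrelation, so \<open>FT_multiplication\<close> trades the
  Gaussian weight on the left for an average of the autocorrelation near the origin.
\<close>

lemma plancherel_gaussian_weight:
  assumes i: "integrable lborel f" and f: "square_integrable f" and e: "\<epsilon> > 0"
  shows "integrable lborel (\<lambda>\<xi>. (norm (FT f \<xi>))\<^sup>2 * exp (- (\<epsilon> * \<xi>)\<^sup>2 / 2))"
    "(LINT \<xi>|lborel. (norm (FT f \<xi>))\<^sup>2 * exp (- (\<epsilon> * \<xi>)\<^sup>2 / 2))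
      = 2 * pi * (LINT w|lborel. std_normal_density w * (abs_l2 (\<lambda>x. f (\<epsilon> * w + x)) \<bullet> abs_l2 f))"
proof -
  let ?A = "conv f (\<lambda>y. cnj (f (- y)))" and ?G = "\<lambda>\<xi>. exp (- (\<epsilon> * \<xi>)\<^sup>2 / 2) :: real"
  note [measurable] = square_integrableD(2)[OF f]
  have i': "integrable lborel (\<lambda>y. cnj (f (- y)))"
    using lborel_integrable_real_affine[OF i, of "-1" 0] by simp
  have A: "integrable lborel ?A" by (rule integrable_conv[OF i i'])
  have FA: "FT ?A \<xi> = complex_of_real ((norm (FT f \<xi>))\<^sup>2)" for \<xi>
    unfolding FT_conv[OF i i'] FT_cnj[of "\<lambda>y. f (- y)"] FT_reflect
    by (simp only: complex_norm_square minus_minus)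
  have G: "integrable lborel (\<lambda>\<xi>. complex_of_real (?G \<xi>))"
    using integrable_gaussian[OF e] by simp
  show int: "integrable lborel (\<lambda>\<xi>. (norm (FT f \<xi>))\<^sup>2 * ?G \<xi>)"
  proof (rule Bochner_Integration.integrable_bound)
    show "integrable lborel (\<lambda>\<xi>. (LINT x|lborel. norm (f x))\<^sup>2 * ?G \<xi>)"
      by (intro integrable_mult_right integrable_gaussian e)
    show "AE \<xi> in lborel. norm ((norm (FT f \<xi>))\<^sup>2 * ?G \<xi>)
        \<le> norm ((LINT x|lborel. norm (f x))\<^sup>2 * ?G \<xi>)"
      by (auto intro!: power_mono norm_FT_le)
  qed measurable
  have "complex_of_real (LINT \<xi>|lborel. (norm (FT f \<xi>))\<^sup>2 * ?G \<xi>)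
      = (LINT \<xi>|lborel. FT ?A \<xi> * complex_of_real (?G \<xi>))"
    unfolding FA using integral_complex_of_real[of lborel "\<lambda>\<xi>. (norm (FT f \<xi>))\<^sup>2 * ?G \<xi>"] by simp
  also have "\<dots> = (LINT z|lborel. ?A z * complex_of_real (2 * pi / \<epsilon> * std_normal_density (z / \<epsilon>)))"
    unfolding FT_multiplication[OF A G] FT_gaussian[OF e] ..
  finally have eq: "complex_of_real (LINT \<xi>|lborel. (norm (FT f \<xi>))\<^sup>2 * ?G \<xi>)
      = (LINT z|lborel. ?A z * complex_of_real (2 * pi / \<epsilon> * std_normal_density (z / \<epsilon>)))" .
  have bnd: "std_normal_density x \<le> 1" for x
  proof -
    have "1 / sqrt (2 * pi) * exp (- x\<^sup>2 / 2) \<le> 1 * 1"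
      by (rule mult_mono) (use pi_ge_two in auto)
    then show ?thesis by (simp add: std_normal_density_def)
  qed
  have int2: "integrable lborel (\<lambda>z. ?A z * complex_of_real (2 * pi / \<epsilon> * std_normal_density (z / \<epsilon>)))"
  proof (rule Bochner_Integration.integrable_bound)
    show "integrable lborel (\<lambda>z. (2 * pi / \<epsilon>) *\<^sub>R ?A z)" using A by simp
    show "(\<lambda>z. ?A z * complex_of_real (2 * pi / \<epsilon> * std_normal_density (z / \<epsilon>)))
        \<in> borel_measurable lborel"
      using borel_measurable_integrable[OF A] by measurable
    show "AE z in lborel. norm (?A z * complex_of_real (2 * pi / \<epsilon> * std_normal_density (z / \<epsilon>)))
        \<le> norm ((2 * pi / \<epsilon>) *\<^sub>R ?A z)"
    proof (rule AE_I2)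
      fix z
      have "2 * pi / \<epsilon> * std_normal_density (z / \<epsilon>) \<le> 2 * pi / \<epsilon> * 1"
        by (rule mult_left_mono[OF bnd]) (use e in auto)
      moreover have "0 \<le> 2 * pi / \<epsilon> * std_normal_density (z / \<epsilon>)"
        using e by (simp add: normal_density_nonneg)
      ultimately have "\<bar>2 * pi / \<epsilon> * std_normal_density (z / \<epsilon>)\<bar> \<le> 2 * pi / \<epsilon>" by linarith
      from mult_right_mono[OF this norm_ge_zero[of "?A z"]]
      show "norm (?A z * complex_of_real (2 * pi / \<epsilon> * std_normal_density (z / \<epsilon>)))
        \<le> norm ((2 * pi / \<epsilon>) *\<^sub>R ?A z)"
        using e unfolding norm_mult norm_of_real norm_scaleR by (simp add: mult.commute)
    qed
  qed
  have "(LINT \<xi>|lborel. (norm (FT f \<xi>))\<^sup>2 * ?G \<xi>)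
      = Re (LINT z|lborel. ?A z * complex_of_real (2 * pi / \<epsilon> * std_normal_density (z / \<epsilon>)))"
    unfolding eq[symmetric] by simp
  also have "\<dots> = (LINT z|lborel. Re (?A z) * (2 * pi / \<epsilon> * std_normal_density (z / \<epsilon>)))"
    using int2 by (subst integral_Re[symmetric]) simp_all
  also have "\<dots> = (LINT w|lborel. 2 * pi * (std_normal_density w * Re (?A (\<epsilon> * w))))"
    using e
    by (subst lborel_integral_real_affine[of \<epsilon> _ 0], simp, unfold integral_scaleR_right[symmetric],
        intro Bochner_Integration.integral_cong) (simp_all add: field_simps)
  finally show "(LINT \<xi>|lborel. (norm (FT f \<xi>))\<^sup>2 * ?G \<xi>)
      = 2 * pi * (LINT w|lborel. std_normal_density w * (abs_l2 (\<lambda>x. f (\<epsilon> * w + x)) \<bullet> abs_l2 f))"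
    unfolding conv_reflect_eq_inner[OF f] by simp
qed

text \<open>
  Letting the Gaussian weight increase to one, the left side of \<open>plancherel_gaussian_weight\<close> converges
  by monotone convergence, which also proves that \<open>FT f\<close> is square integrable. The right side
  converges by dominated convergence to the autocorrelation at the origin.
\<close>

theorem plancherel:
  assumes i: "integrable lborel f" and f: "square_integrable f"
  shows "square_integrable (FT f)" "norm (abs_l2 (FT f)) = sqrt (2 * pi) * norm (abs_l2 f)"
proof -
  note [measurable] = square_integrableD(2)[OF f]
  let ?\<epsilon> = "\<lambda>n. 1 / real (Suc n)"
  let ?u = "\<lambda>n \<xi>. (norm (FT f \<xi>))\<^sup>2 * exp (- (?\<epsilon> n * \<xi>)\<^sup>2 / 2)"
  let ?I = "\<lambda>n w. std_normal_density w * (abs_l2 (\<lambda>x. f (?\<epsilon> n * w + x)) \<bullet> abs_l2 f)"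
  have e0: "?\<epsilon> \<longlonglongrightarrow> 0"
    using LIMSEQ_inverse_real_of_nat by (simp add: inverse_eq_divide)
  have A_meas: "(\<lambda>w. abs_l2 (\<lambda>x. f (?\<epsilon> n * w + x)) \<bullet> abs_l2 f) \<in> borel_measurable borel" for n
    unfolding inner_abs_l2[OF translate_l2(1)[OF f] f] by measurable
  have "(\<lambda>n. LINT w|lborel. ?I n w)
      \<longlonglongrightarrow> (LINT w|lborel. std_normal_density w * (abs_l2 f \<bullet> abs_l2 f))"
  proof (rule integral_dominated_convergence[where w = "\<lambda>w. std_normal_density w * (norm (abs_l2 f))\<^sup>2"])
    show "AE w in lborel. (\<lambda>n. ?I n w) \<longlonglongrightarrow> std_normal_density w * (abs_l2 f \<bullet> abs_l2 f)"
    proof (rule AE_I2)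
      fix w
      have "(\<lambda>n. ?\<epsilon> n * w) \<longlonglongrightarrow> 0"
        using tendsto_mult_left_zero[OF e0, of w] by simp
      then show "(\<lambda>n. ?I n w) \<longlonglongrightarrow> std_normal_density w * (abs_l2 f \<bullet> abs_l2 f)"
        by (intro tendsto_intros translate_continuous f)
    qed
    show "AE w in lborel. norm (?I n w) \<le> std_normal_density w * (norm (abs_l2 f))\<^sup>2" for n
    proof (rule AE_I2)
      fix w
      have "\<bar>abs_l2 (\<lambda>x. f (?\<epsilon> n * w + x)) \<bullet> abs_l2 f\<bar> \<le> (norm (abs_l2 f))\<^sup>2"
        using Cauchy_Schwarz_ineq2[of "abs_l2 (\<lambda>x. f (?\<epsilon> n * w + x))" "abs_l2 f"]
        unfolding translate_l2(2)[OF f] by (simp add: power2_eq_square)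
      from mult_left_mono[OF this normal_density_nonneg[of 0 1 w]]
      show "norm (?I n w) \<le> std_normal_density w * (norm (abs_l2 f))\<^sup>2"
        by (simp add: abs_mult normal_density_nonneg)
    qed
    show "integrable lborel (\<lambda>w. std_normal_density w * (norm (abs_l2 f))\<^sup>2)"
      by (intro integrable_mult_left integrable_std_normal_density)
  qed (use A_meas in measurable)
  also have "(LINT w|lborel. std_normal_density w * (abs_l2 f \<bullet> abs_l2 f)) = (norm (abs_l2 f))\<^sup>2"
    by (simp add: integral_std_normal_density power2_norm_eq_inner)
  finally have "(\<lambda>n. 2 * pi * (LINT w|lborel. ?I n w)) \<longlonglongrightarrow> 2 * pi * (norm (abs_l2 f))\<^sup>2"
    by (intro tendsto_intros)
  then have lim: "(\<lambda>n. LINT \<xi>|lborel. ?u n \<xi>) \<longlonglongrightarrow> 2 * pi * (norm (abs_l2 f))\<^sup>2"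
    by (subst plancherel_gaussian_weight(2)[OF i f]) auto
  have mono: "AE \<xi> in lborel. mono (\<lambda>n. ?u n \<xi>)"
  proof (intro AE_I2 monoI mult_left_mono)
    fix \<xi> and m n :: nat assume "m \<le> n"
    then have "\<bar>?\<epsilon> n * \<xi>\<bar> \<le> \<bar>?\<epsilon> m * \<xi>\<bar>"
      unfolding abs_mult by (intro mult_right_mono) (auto simp: divide_simps)
    then have "(?\<epsilon> n * \<xi>)\<^sup>2 \<le> (?\<epsilon> m * \<xi>)\<^sup>2" by (simp only: abs_le_square_iff)
    then show "exp (- (?\<epsilon> m * \<xi>)\<^sup>2 / 2) \<le> exp (- (?\<epsilon> n * \<xi>)\<^sup>2 / 2)" by simp
  qed simp
  have ulim: "AE \<xi> in lborel. (\<lambda>n. ?u n \<xi>) \<longlonglongrightarrow> (norm (FT f \<xi>))\<^sup>2"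
  proof (rule AE_I2)
    fix \<xi>
    have "(\<lambda>n. ?u n \<xi>) \<longlonglongrightarrow> (norm (FT f \<xi>))\<^sup>2 * exp (- (0 * \<xi>)\<^sup>2 / 2)"
      by (intro tendsto_intros e0) auto
    then show "(\<lambda>n. ?u n \<xi>) \<longlonglongrightarrow> (norm (FT f \<xi>))\<^sup>2" by simp
  qed
  have ui: "integrable lborel (?u n)" for n
    by (rule plancherel_gaussian_weight(1)[OF i f]) simp
  note mc = integral_monotone_convergence_nonneg[OF ui mono _ ulim lim]
  have 1: "integrable lborel (\<lambda>\<xi>. (norm (FT f \<xi>))\<^sup>2)"
    by (rule mc(1)) auto
  have 2: "(LINT \<xi>|lborel. (norm (FT f \<xi>))\<^sup>2) = 2 * pi * (norm (abs_l2 f))\<^sup>2"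
    by (rule mc(2)) auto
  show sq: "square_integrable (FT f)" using 1 by (simp add: square_integrable_def)
  have "(norm (abs_l2 (FT f)))\<^sup>2 = (sqrt (2 * pi) * norm (abs_l2 f))\<^sup>2"
    unfolding norm_abs_l2[OF sq] 2 by (simp add: power_mult_distrib)
  then show "norm (abs_l2 (FT f)) = sqrt (2 * pi) * norm (abs_l2 f)"
    by (rule power2_eq_imp_eq) auto
qed

section \<open>The Fourier transform on \<open>L\<^sup>2\<close>\<close>

lemma AE_lborel_reflect:
  fixes P :: "real \<Rightarrow> bool"
  assumes "AE x in lborel. P x" shows "AE x in lborel. P (- x)"
proof -
  have "AE x in distr lborel borel uminus. P x"
    unfolding lborel_distr_uminus by (rule assms)
  then show ?thesis
    by (rule AE_distrD[rotated]) simp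
qed

lemma square_integrable_norm:
  "square_integrable f \<Longrightarrow> square_integrable (\<lambda>x. norm (f x))"
  by (rule square_integrable_bound[of f]) (auto dest: square_integrableD)

lemma integrable_mult_square_integrable:
  fixes u v :: "real \<Rightarrow> complex"
  assumes u: "square_integrable u" and v: "square_integrable v"
  shows "integrable lborel (\<lambda>x. u x * v x)"
proof -
  note [measurable] = square_integrableD(2)[OF u] square_integrableD(2)[OF v]
  have "integrable lborel (\<lambda>x. norm (u x) \<bullet> norm (v x))"
    by (intro square_integrable_inner square_integrable_norm u v)
  then show ?thesis
    by (rule Bochner_Integration.integrable_bound) (auto simp: norm_mult)
qed

lemma Re_mult_cnj: "Re (a * cnj b) = a \<bullet> b"
  by (simp add: inner_complex_def)

lemma FT_cong_AE:
  assumes "f \<in> borel_measurable lborel" "g \<in> borel_measurable lborel" "AE x in lborel. f x = g x"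
  shows "FT f = FT g"
proof
  fix \<xi>
  have [measurable]: "f \<in> borel_measurable borel" "g \<in> borel_measurable borel"
    using assms by auto
  show "FT f \<xi> = FT g \<xi>"
    unfolding FT_def by (rule integral_cong_AE) (use assms(3) in auto)
qed

lemma FT_add:
  assumes "integrable lborel f" "integrable lborel g"
  shows "FT (\<lambda>x. f x + g x) \<xi> = FT f \<xi> + FT g \<xi>"
  using integrable_cis_mult[OF assms(1), of "\<lambda>x. - (x * \<xi>)"]
    integrable_cis_mult[OF assms(2), of "\<lambda>x. - (x * \<xi>)"]
  by (simp add: FT_def ring_distribs Bochner_Integration.integral_add)

lemma FT_scaleR: "FT (\<lambda>x. c *\<^sub>R f x) \<xi> = c *\<^sub>R FT f \<xi>"
  by (simp add: FT_def)

abbreviation truncate :: "nat \<Rightarrow> (real \<Rightarrow> 'a::real_vector) \<Rightarrow> real \<Rightarrow> 'a" where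
  "truncate n f x \<equiv> indicator {- real n..real n} x *\<^sub>R f x"

lemma truncate_l2:
  fixes f :: "real \<Rightarrow> 'a::euclidean_space"
  assumes f: "square_integrable f"
  shows "integrable lborel (truncate n f)" "square_integrable (truncate n f)"
    "(\<lambda>n. abs_l2 (truncate n f)) \<longlonglongrightarrow> abs_l2 f"
proof -
  note [measurable] = square_integrableD(2)[OF f]
  show "integrable lborel (truncate n f)"
  proof (rule Bochner_Integration.integrable_bound)
    show "integrable lborel (\<lambda>x. indicator {- real n..real n} x + (norm (f x))\<^sup>2)"
      by (intro Bochner_Integration.integrable_add integrable_real_indicator square_integrableD[OF f])
        (auto simp: emeasure_lborel_Icc_eq)
    show "AE x in lborel. norm (truncate n f x)
        \<le> norm (indicator {- real n..real n} x + (norm (f x))\<^sup>2)"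
    proof (rule AE_I2)
      fix x
      have "2 * norm (f x) \<le> 1 + (norm (f x))\<^sup>2"
        using zero_le_power2[of "norm (f x) - 1"] by (simp add: power2_diff)
      then have "norm (f x) \<le> 1 + (norm (f x))\<^sup>2"
        using norm_ge_zero[of "f x"] by linarith
      then show "norm (truncate n f x) \<le> norm (indicator {- real n..real n} x + (norm (f x))\<^sup>2)"
        by (auto simp: indicator_def)
    qed
  qed measurable
  have ev: "eventually (\<lambda>n. x \<in> {- real n..real n}) sequentially" for x
  proof -
    obtain N where "\<bar>x\<bar> \<le> real N" using real_arch_simple by blast
    then show ?thesis
      by (intro eventually_mono[OF eventually_ge_at_top[of N]]) auto
  qed
  show "square_integrable (truncate n f)" by (rule truncation_tendsto_l2(1)[OF f ev]) simp
  show "(\<lambda>n. abs_l2 (truncate n f)) \<longlonglongrightarrow> abs_l2 f" by (rule truncation_tendsto_l2(2)[OF f ev]) simp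
qed

lemma norm_FT_diff_l2:
  assumes "integrable lborel f" "square_integrable f" "integrable lborel g" "square_integrable g"
  shows "norm (abs_l2 (FT f) - abs_l2 (FT g)) = sqrt (2 * pi) * norm (abs_l2 f - abs_l2 g)"
proof -
  have "FT (\<lambda>x. f x - g x) = (\<lambda>\<xi>. FT f \<xi> - FT g \<xi>)"
    by (rule ext) (rule FT_diff[OF assms(1,3)])
  then have "abs_l2 (FT f) - abs_l2 (FT g) = abs_l2 (FT (\<lambda>x. f x - g x))"
    using assms by (simp add: minus_abs_l2 plancherel(1))
  then show ?thesis
    using plancherel(2)[of "\<lambda>x. f x - g x"] assms
    by (simp add: minus_abs_l2 square_integrable_diff)
qed

lemma FT_tendsto_l2:
  assumes f: "\<And>n::nat. integrable lborel (f n)" "\<And>n. square_integrable (f n)"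
    and g: "integrable lborel g" "square_integrable g"
    and lim: "(\<lambda>n. abs_l2 (f n)) \<longlonglongrightarrow> abs_l2 g"
  shows "(\<lambda>n. abs_l2 (FT (f n))) \<longlonglongrightarrow> abs_l2 (FT g)"
proof -
  have "(\<lambda>n. sqrt (2 * pi) * norm (abs_l2 (f n) - abs_l2 g)) \<longlonglongrightarrow> sqrt (2 * pi) * 0"
    by (intro tendsto_mult tendsto_const tendsto_norm_zero) (use lim in \<open>simp add: LIM_zero_iff\<close>)
  then have "(\<lambda>n. norm (abs_l2 (FT (f n)) - abs_l2 (FT g))) \<longlonglongrightarrow> 0"
    by (simp add: norm_FT_diff_l2 f g)
  then show ?thesis by (simp add: tendsto_norm_zero_iff LIM_zero_iff)
qed

text \<open>
  The limit in the definition of \<open>fourier\<close>, on complex valued functions: this transform has an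
  adjoint on the same space and can be composed with it.
\<close>

definition plancherel_transform :: "complex l2 \<Rightarrow> complex l2" where
  "plancherel_transform F = lim (\<lambda>n. abs_l2 (FT (truncate n (rep_l2 F))))"

lemma plancherel_transform_LIMSEQ:
  "(\<lambda>n. abs_l2 (FT (truncate n (rep_l2 F)))) \<longlonglongrightarrow> plancherel_transform F"
proof -
  let ?f = "\<lambda>n. truncate n (rep_l2 F)"
  note t = truncate_l2[OF square_integrable_rep[of F]]
  have "Cauchy (\<lambda>n. abs_l2 (?f n))" by (rule LIMSEQ_imp_Cauchy[OF t(3)])
  have "Cauchy (\<lambda>n. abs_l2 (FT (?f n)))"
  proof (rule metric_CauchyI)
    fix e :: real assume "e > 0"
    then have "e / sqrt (2 * pi) > 0" by simp
    from metric_CauchyD[OF \<open>Cauchy (\<lambda>n. abs_l2 (?f n))\<close> this]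
    obtain M where "\<And>m n. m \<ge> M \<Longrightarrow> n \<ge> M \<Longrightarrow> dist (abs_l2 (?f m)) (abs_l2 (?f n)) < e / sqrt (2 * pi)"
      by blast
    then have "dist (abs_l2 (FT (?f m))) (abs_l2 (FT (?f n))) < e" if "m \<ge> M" "n \<ge> M" for m n
      using that by (simp add: dist_norm norm_FT_diff_l2 t field_simps)
    then show "\<exists>M. \<forall>m\<ge>M. \<forall>n\<ge>M. dist (abs_l2 (FT (?f m))) (abs_l2 (FT (?f n))) < e" by blast
  qed
  then show ?thesis
    unfolding plancherel_transform_def by (intro convergent_LIMSEQ_iff[THEN iffD1] Cauchy_convergent)
qed

lemma norm_plancherel_transform: "norm (plancherel_transform F) = sqrt (2 * pi) * norm F"
proof (rule LIMSEQ_unique)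
  note t = truncate_l2[OF square_integrable_rep[of F]]
  show "(\<lambda>n. norm (abs_l2 (FT (truncate n (rep_l2 F))))) \<longlonglongrightarrow> norm (plancherel_transform F)"
    by (intro tendsto_norm plancherel_transform_LIMSEQ)
  have "(\<lambda>n. sqrt (2 * pi) * norm (abs_l2 (truncate n (rep_l2 F)))) \<longlonglongrightarrow> sqrt (2 * pi) * norm F"
    by (intro tendsto_intros) (use t(3) in simp)
  then show "(\<lambda>n. norm (abs_l2 (FT (truncate n (rep_l2 F))))) \<longlonglongrightarrow> sqrt (2 * pi) * norm F"
    by (simp add: plancherel(2) t)
qed

lemma plancherel_transform_add:
  "plancherel_transform (F + G) = plancherel_transform F + plancherel_transform G"
proof (rule LIMSEQ_unique[OF plancherel_transform_LIMSEQ])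
  note t = truncate_l2[OF square_integrable_rep]
  have "FT (truncate n (rep_l2 (F + G)))
      = (\<lambda>\<xi>. FT (truncate n (rep_l2 F)) \<xi> + FT (truncate n (rep_l2 G)) \<xi>)" for n
  proof -
    have "FT (truncate n (rep_l2 (F + G)))
        = FT (\<lambda>x. truncate n (rep_l2 F) x + truncate n (rep_l2 G) x)"
      by (rule FT_cong_AE) (use rep_plus_l2[of F G] in \<open>auto elim!: eventually_mono simp: indicator_def\<close>)
    then show ?thesis by (simp add: FT_add t fun_eq_iff)
  qed
  then have "abs_l2 (FT (truncate n (rep_l2 (F + G))))
      = abs_l2 (FT (truncate n (rep_l2 F))) + abs_l2 (FT (truncate n (rep_l2 G)))" for n
    by (simp add: plus_abs_l2 plancherel(1) t)
  then show "(\<lambda>n. abs_l2 (FT (truncate n (rep_l2 (F + G)))))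
      \<longlonglongrightarrow> plancherel_transform F + plancherel_transform G"
    using tendsto_add[OF plancherel_transform_LIMSEQ[of F] plancherel_transform_LIMSEQ[of G]] by simp
qed

lemma plancherel_transform_scaleR:
  "plancherel_transform (c *\<^sub>R F) = c *\<^sub>R plancherel_transform F"
proof (rule LIMSEQ_unique[OF plancherel_transform_LIMSEQ])
  note t = truncate_l2[OF square_integrable_rep]
  have "FT (truncate n (rep_l2 (c *\<^sub>R F))) = (\<lambda>\<xi>. c *\<^sub>R FT (truncate n (rep_l2 F)) \<xi>)" for n
  proof -
    have "FT (truncate n (rep_l2 (c *\<^sub>R F))) = FT (\<lambda>x. c *\<^sub>R truncate n (rep_l2 F) x)"
      by (rule FT_cong_AE) (use rep_scaleR_l2[of c F] in \<open>auto elim!: eventually_mono simp: indicator_def\<close>)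
    then show ?thesis by (simp only: FT_scaleR fun_eq_iff) simp
  qed
  then have "abs_l2 (FT (truncate n (rep_l2 (c *\<^sub>R F))))
      = c *\<^sub>R abs_l2 (FT (truncate n (rep_l2 F)))" for n
    by (simp add: scaleR_abs_l2 plancherel(1) t)
  then show "(\<lambda>n. abs_l2 (FT (truncate n (rep_l2 (c *\<^sub>R F))))) \<longlonglongrightarrow> c *\<^sub>R plancherel_transform F"
    using tendsto_scaleR[OF tendsto_const[of c] plancherel_transform_LIMSEQ[of F]] by simp
qed

lemma bounded_linear_plancherel_transform: "bounded_linear plancherel_transform"
  by (rule bounded_linear_intro[of _ "sqrt (2 * pi)"])
    (simp_all add: plancherel_transform_add plancherel_transform_scaleR norm_plancherel_transform mult.commute)

lemma inj_plancherel_transform: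
  assumes "plancherel_transform F = plancherel_transform G" shows "F = G"
proof -
  have "plancherel_transform (F - G) = 0"
    using assms by (simp add: linear_diff[OF bounded_linear.linear[OF bounded_linear_plancherel_transform]])
  then show ?thesis using norm_plancherel_transform[of "F - G"] by simp
qed

lemma plancherel_transform_abs_l2:
  assumes i: "integrable lborel f" and f: "square_integrable f"
  shows "plancherel_transform (abs_l2 f) = abs_l2 (FT f)"
proof (rule LIMSEQ_unique[OF plancherel_transform_LIMSEQ])
  note t = truncate_l2[OF f]
  have "FT (truncate n (rep_l2 (abs_l2 f))) = FT (truncate n f)" for n
    by (rule FT_cong_AE)
      (use rep_abs_l2[OF f] square_integrableD[OF f] in \<open>auto elim!: eventually_mono simp: indicator_def\<close>)
  moreover have "(\<lambda>n. abs_l2 (FT (truncate n f))) \<longlonglongrightarrow> abs_l2 (FT f)"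
    by (rule FT_tendsto_l2) (rule t i f)+
  ultimately show "(\<lambda>n. abs_l2 (FT (truncate n (rep_l2 (abs_l2 f))))) \<longlonglongrightarrow> abs_l2 (FT f)"
    by simp
qed

definition cnj_l2 :: "complex l2 \<Rightarrow> complex l2" where
  "cnj_l2 F = abs_l2 (\<lambda>x. cnj (rep_l2 F x))"

lemma square_integrable_cnj: "square_integrable f \<Longrightarrow> square_integrable (\<lambda>x. cnj (f x))"
  by (rule square_integrable_bound[of f]) (auto dest: square_integrableD)

lemma square_integrable_reflect:
  assumes "square_integrable f" shows "square_integrable (\<lambda>x. f (- x))"
  using lborel_integrable_real_affine[OF square_integrableD(3)[OF assms], of "-1" 0]
    square_integrableD(2)[OF assms]
  by (simp add: square_integrable_def)

lemma cnj_abs_l2: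
  assumes "square_integrable f" shows "cnj_l2 (abs_l2 f) = abs_l2 (\<lambda>x. cnj (f x))"
  unfolding cnj_l2_def
  by (rule abs_l2_cong)
    (use rep_abs_l2[OF assms] square_integrableD[OF assms] in
      \<open>auto elim!: eventually_mono intro!: square_integrable_cnj\<close>)

lemma norm_cnj_l2: "norm (cnj_l2 F) = norm F"
proof -
  have "(norm (cnj_l2 F))\<^sup>2 = (norm F)\<^sup>2"
    unfolding cnj_l2_def by (subst norm_abs_l2) (auto intro: square_integrable_cnj simp: norm_rep_l2)
  then show ?thesis by simp
qed

lemma cnj_l2_diff: "cnj_l2 (F - G) = cnj_l2 F - cnj_l2 G"
  using cnj_abs_l2[of "\<lambda>x. rep_l2 F x - rep_l2 G x"]
    minus_abs_l2[of "\<lambda>x. cnj (rep_l2 F x)" "\<lambda>x. cnj (rep_l2 G x)"]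
    minus_abs_l2[of "rep_l2 F" "rep_l2 G"]
  by (simp add: cnj_l2_def square_integrable_cnj square_integrable_diff)

lemma tendsto_cnj_l2:
  assumes "(f \<longlongrightarrow> F) A" shows "((\<lambda>n. cnj_l2 (f n)) \<longlongrightarrow> cnj_l2 F) A"
proof -
  have "((\<lambda>n. norm (f n - F)) \<longlongrightarrow> 0) A"
    using assms by (simp add: tendsto_norm_zero_iff LIM_zero_iff)
  then have "((\<lambda>n. norm (cnj_l2 (f n) - cnj_l2 F)) \<longlongrightarrow> 0) A"
    by (simp add: norm_cnj_l2 flip: cnj_l2_diff)
  then show ?thesis by (simp add: tendsto_norm_zero_iff LIM_zero_iff)
qed

text \<open>
  The conjugation on the Fourier side. Its fixed points are the Hermitian functions, that is, the
  transforms of real functions.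
\<close>

definition reflect_cnj_l2 :: "complex l2 \<Rightarrow> complex l2" where
  "reflect_cnj_l2 F = abs_l2 (\<lambda>x. cnj (rep_l2 F (- x)))"

lemma square_integrable_reflect_cnj:
  "square_integrable f \<Longrightarrow> square_integrable (\<lambda>x. cnj (f (- x)))"
  by (intro square_integrable_cnj square_integrable_reflect)

lemma reflect_cnj_abs_l2:
  assumes "square_integrable f" shows "reflect_cnj_l2 (abs_l2 f) = abs_l2 (\<lambda>x. cnj (f (- x)))"
  unfolding reflect_cnj_l2_def
  by (rule abs_l2_cong)
    (use AE_lborel_reflect[OF rep_abs_l2[OF assms]] square_integrableD[OF assms] in
      \<open>auto elim!: eventually_mono intro!: square_integrable_reflect_cnj\<close>)

lemma norm_reflect_cnj_l2: "norm (reflect_cnj_l2 F) = norm F"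
proof -
  have "(norm (reflect_cnj_l2 F))\<^sup>2 = (LINT x|lborel. (norm (rep_l2 F (- x)))\<^sup>2)"
    unfolding reflect_cnj_l2_def by (subst norm_abs_l2) (auto intro: square_integrable_reflect_cnj)
  also have "\<dots> = (norm F)\<^sup>2"
    unfolding norm_rep_l2[of F]
    using lborel_integral_real_affine[of "-1" "\<lambda>x. (norm (rep_l2 F x))\<^sup>2" 0] by simp
  finally show ?thesis by simp
qed

lemma reflect_cnj_l2_diff: "reflect_cnj_l2 (F - G) = reflect_cnj_l2 F - reflect_cnj_l2 G"
  using reflect_cnj_abs_l2[of "\<lambda>x. rep_l2 F x - rep_l2 G x"]
    minus_abs_l2[of "\<lambda>x. cnj (rep_l2 F (- x))" "\<lambda>x. cnj (rep_l2 G (- x))"]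
    minus_abs_l2[of "rep_l2 F" "rep_l2 G"]
  by (simp add: reflect_cnj_l2_def square_integrable_reflect_cnj square_integrable_diff)

lemma tendsto_reflect_cnj_l2:
  assumes "(f \<longlongrightarrow> F) A" shows "((\<lambda>n. reflect_cnj_l2 (f n)) \<longlongrightarrow> reflect_cnj_l2 F) A"
proof -
  have "((\<lambda>n. norm (f n - F)) \<longlongrightarrow> 0) A"
    using assms by (simp add: tendsto_norm_zero_iff LIM_zero_iff)
  then have "((\<lambda>n. norm (reflect_cnj_l2 (f n) - reflect_cnj_l2 F)) \<longlongrightarrow> 0) A"
    by (simp add: norm_reflect_cnj_l2 flip: reflect_cnj_l2_diff)
  then show ?thesis by (simp add: tendsto_norm_zero_iff LIM_zero_iff)
qed

lemma FT_truncate_rep_cnj_l2: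
  "FT (truncate n (rep_l2 (cnj_l2 F))) = FT (\<lambda>x. cnj (truncate n (rep_l2 F) x))"
proof (rule FT_cong_AE)
  have "AE x in lborel. rep_l2 (cnj_l2 F) x = cnj (rep_l2 F x)"
    unfolding cnj_l2_def by (intro rep_abs_l2 square_integrable_cnj) simp
  then show "AE x in lborel. truncate n (rep_l2 (cnj_l2 F)) x = cnj (truncate n (rep_l2 F) x)"
    by eventually_elim (simp add: indicator_def)
qed auto

lemma plancherel_transform_cnj:
  "plancherel_transform (cnj_l2 F) = reflect_cnj_l2 (plancherel_transform F)"
proof (rule LIMSEQ_unique[OF plancherel_transform_LIMSEQ])
  note t = truncate_l2[OF square_integrable_rep]
  have "abs_l2 (FT (truncate n (rep_l2 (cnj_l2 F))))
      = reflect_cnj_l2 (abs_l2 (FT (truncate n (rep_l2 F))))" for n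
    unfolding FT_truncate_rep_cnj_l2 reflect_cnj_abs_l2[OF plancherel(1)[OF t(1,2)]]
    by (simp only: FT_cnj[of "truncate n (rep_l2 F)", abs_def])
  then show "(\<lambda>n. abs_l2 (FT (truncate n (rep_l2 (cnj_l2 F)))))
      \<longlonglongrightarrow> reflect_cnj_l2 (plancherel_transform F)"
    using tendsto_reflect_cnj_l2[OF plancherel_transform_LIMSEQ[of F]] by simp
qed

text \<open>
  On truncations this is \<open>FT_multiplication\<close>; both sides pass to the limit in \<open>L\<^sup>2\<close>.
\<close>

lemma plancherel_transform_adjoint:
  "plancherel_transform F \<bullet> G = F \<bullet> cnj_l2 (plancherel_transform (cnj_l2 G))"
proof (rule LIMSEQ_unique)
  note t = truncate_l2[OF square_integrable_rep]
  let ?f = "\<lambda>n. truncate n (rep_l2 F)" and ?g = "\<lambda>n. truncate n (rep_l2 G)"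
  show "(\<lambda>n. abs_l2 (FT (?f n)) \<bullet> abs_l2 (?g n)) \<longlonglongrightarrow> plancherel_transform F \<bullet> G"
    using tendsto_inner[OF plancherel_transform_LIMSEQ[of F] t(3)[of G]] by simp
  have eq: "abs_l2 (FT (?f n)) \<bullet> abs_l2 (?g n)
      = abs_l2 (?f n) \<bullet> cnj_l2 (abs_l2 (FT (truncate n (rep_l2 (cnj_l2 G)))))" for n
  proof -
    have g': "integrable lborel (\<lambda>x. cnj (?g n x))" "square_integrable (\<lambda>x. cnj (?g n x))"
      by (rule integrable_cnj[OF t(1)], rule square_integrable_cnj[OF t(2)])
    note int = integrable_mult_square_integrable
    have "abs_l2 (FT (?f n)) \<bullet> abs_l2 (?g n) = (LINT x|lborel. Re (FT (?f n) x * cnj (?g n x)))"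
      unfolding inner_abs_l2[OF plancherel(1)[OF t(1,2)] t(2)]
      unfolding Re_mult_cnj ..
    also have "\<dots> = Re (LINT x|lborel. FT (?f n) x * cnj (?g n x))"
      by (rule integral_Re) (intro int plancherel g' t)
    also have "\<dots> = Re (LINT x|lborel. ?f n x * FT (\<lambda>x. cnj (?g n x)) x)"
      by (subst FT_multiplication) (rule t g' refl)+
    also have "\<dots> = (LINT x|lborel. Re (?f n x * FT (\<lambda>x. cnj (?g n x)) x))"
      by (rule integral_Re[symmetric]) (intro int plancherel g' t)
    also have "\<dots> = abs_l2 (?f n) \<bullet> cnj_l2 (abs_l2 (FT (\<lambda>x. cnj (?g n x))))"
      unfolding cnj_abs_l2[OF plancherel(1)[OF g']]
        inner_abs_l2[OF t(2) square_integrable_cnj[OF plancherel(1)[OF g']]]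
      unfolding Re_mult_cnj[symmetric] complex_cnj_cnj ..
    finally show ?thesis unfolding FT_truncate_rep_cnj_l2 .
  qed
  show "(\<lambda>n. abs_l2 (FT (?f n)) \<bullet> abs_l2 (?g n))
      \<longlonglongrightarrow> F \<bullet> cnj_l2 (plancherel_transform (cnj_l2 G))"
    unfolding eq
    using tendsto_inner[OF t(3)[of F] tendsto_cnj_l2[OF plancherel_transform_LIMSEQ[of "cnj_l2 G"]]]
    by simp
qed

text \<open>
  Write \<open>P\<close> for the transform and \<open>Q\<close> for its adjoint; both multiply norms by \<open>sqrt (2 \<pi>)\<close>. Then
  \<open>\<parallel>P Q G - 2 \<pi> G\<parallel>\<^sup>2\<close> expands to \<open>(4 \<pi>\<^sup>2 - 8 \<pi>\<^sup>2 + 4 \<pi>\<^sup>2) \<parallel>G\<parallel>\<^sup>2 = 0\<close>. Hence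
  \<open>P\<close> is onto.
\<close>

lemma plancherel_transform_inverse:
  "plancherel_transform (cnj_l2 (plancherel_transform (cnj_l2 G))) = (2 * pi) *\<^sub>R G"
proof -
  let ?Q = "cnj_l2 (plancherel_transform (cnj_l2 G))"
  have Q: "norm ?Q = sqrt (2 * pi) * norm G"
    by (simp add: norm_cnj_l2 norm_plancherel_transform)
  have PQ: "norm (plancherel_transform ?Q) = 2 * pi * norm G"
    unfolding norm_plancherel_transform Q by simp
  have "plancherel_transform ?Q \<bullet> G = (norm ?Q)\<^sup>2"
    by (simp add: plancherel_transform_adjoint power2_norm_eq_inner)
  also have "\<dots> = 2 * pi * (norm G)\<^sup>2" unfolding Q by (simp add: power_mult_distrib)
  finally have 1: "plancherel_transform ?Q \<bullet> G = 2 * pi * (norm G)\<^sup>2" .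
  have "(norm (plancherel_transform ?Q - (2 * pi) *\<^sub>R G))\<^sup>2
      = (norm (plancherel_transform ?Q))\<^sup>2 - 2 * (2 * pi) * (plancherel_transform ?Q \<bullet> G)
        + (2 * pi)\<^sup>2 * (norm G)\<^sup>2"
    unfolding power2_norm_eq_inner
    by (simp add: inner_diff_left inner_diff_right inner_commute algebra_simps power2_eq_square)
  also have "\<dots> = 0" unfolding PQ 1 by (simp add: power2_eq_square algebra_simps)
  finally show ?thesis by simp
qed

definition complex_l2 :: "real l2 \<Rightarrow> complex l2" where
  "complex_l2 f = abs_l2 (\<lambda>x. complex_of_real (rep_l2 f x))"

lemma square_integrable_of_real:
  "square_integrable f \<Longrightarrow> square_integrable (\<lambda>x. complex_of_real (f x))"
  by (auto simp: square_integrable_def)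

lemma rep_complex_l2: "AE x in lborel. rep_l2 (complex_l2 f) x = complex_of_real (rep_l2 f x)"
  unfolding complex_l2_def by (intro rep_abs_l2 square_integrable_of_real) simp

lemma norm_complex_l2: "norm (complex_l2 f) = norm f"
proof -
  have "(norm (complex_l2 f))\<^sup>2 = (norm f)\<^sup>2"
    unfolding complex_l2_def by (subst norm_abs_l2) (auto intro: square_integrable_of_real simp: norm_rep_l2)
  then show ?thesis by simp
qed

lemma complex_l2_add: "complex_l2 (f + g) = complex_l2 f + complex_l2 g"
  unfolding complex_l2_def
  by (subst plus_abs_l2)
    (use rep_plus_l2[of f g] in \<open>auto intro!: square_integrable_of_real abs_l2_cong elim!: eventually_mono\<close>)

lemma complex_l2_scaleR: "complex_l2 (c *\<^sub>R f) = c *\<^sub>R complex_l2 f"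
  unfolding complex_l2_def
  by (subst scaleR_abs_l2)
    (use rep_scaleR_l2[of c f] in \<open>auto intro!: square_integrable_of_real abs_l2_cong
      elim!: eventually_mono simp: scaleR_conv_of_real\<close>)

lemma cnj_complex_l2: "cnj_l2 (complex_l2 f) = complex_l2 f"
  unfolding complex_l2_def by (subst cnj_abs_l2) (auto intro: square_integrable_of_real)

lemma fourier_eq: "fourier f = plancherel_transform (complex_l2 f)"
proof -
  have "FT (truncate n (rep_l2 (complex_l2 f)))
      = FT (truncate n (\<lambda>x. complex_of_real (rep_l2 f x)))" for n
    by (rule FT_cong_AE)
      (use rep_complex_l2[of f] in \<open>auto elim!: eventually_mono simp: indicator_def\<close>)
  then have "FT (truncate n (rep_l2 (complex_l2 f))) = (\<lambda>\<xi>.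
     LINT x:{- real n..real n}|lborel. cis (- (x * \<xi>)) * complex_of_real (rep_l2 f x))" for n
    by (simp add: FT_def fun_eq_iff set_lebesgue_integral_def)
  then show ?thesis by (simp add: fourier_def plancherel_transform_def)
qed

lemma bounded_linear_fourier: "bounded_linear fourier"
proof -
  have "bounded_linear complex_l2"
    by (rule bounded_linear_intro[of _ 1])
      (simp_all add: complex_l2_add complex_l2_scaleR norm_complex_l2)
  from bounded_linear_compose[OF bounded_linear_plancherel_transform this]
  show ?thesis by (simp add: fourier_eq[abs_def])
qed

lemma norm_fourier: "norm (fourier f) = sqrt (2 * pi) * norm f"
  by (simp add: fourier_eq norm_plancherel_transform norm_complex_l2)

lemma fourier_inject: "fourier f = fourier g \<longleftrightarrow> f = g"
proof
  assume "fourier f = fourier g"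
  then have "fourier (f - g) = 0"
    by (simp add: linear_diff[OF bounded_linear.linear[OF bounded_linear_fourier]])
  then show "f = g" using norm_fourier[of "f - g"] by simp
qed simp

lemma reflect_cnj_l2_fourier: "reflect_cnj_l2 (fourier f) = fourier f"
  unfolding fourier_eq by (simp flip: plancherel_transform_cnj add: cnj_complex_l2)

lemma reflect_cnj_l2_fixed_iff:
  "reflect_cnj_l2 G = G \<longleftrightarrow> (AE x in lborel. cnj (rep_l2 G (- x)) = rep_l2 G x)"
  using abs_l2_eq_iff[of "\<lambda>x. cnj (rep_l2 G (- x))" "rep_l2 G"]
  by (simp add: reflect_cnj_l2_def square_integrable_reflect_cnj)

text \<open>
  The preimage provided by \<open>plancherel_transform_inverse\<close> is real, because its conjugate has the same
  transform.
\<close>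

lemma fourier_surj:
  assumes "reflect_cnj_l2 G = G" shows "\<exists>f. fourier f = G"
proof -
  define g where "g = (1 / (2 * pi)) *\<^sub>R cnj_l2 (plancherel_transform (cnj_l2 G))"
  have g: "plancherel_transform g = G"
    unfolding g_def plancherel_transform_scaleR plancherel_transform_inverse by simp
  have "plancherel_transform (cnj_l2 g) = plancherel_transform g"
    unfolding plancherel_transform_cnj g by (rule assms)
  then have "cnj_l2 g = g" by (rule inj_plancherel_transform)
  then have "AE x in lborel. cnj (rep_l2 g x) = rep_l2 g x"
    using abs_l2_eq_iff[of "\<lambda>x. cnj (rep_l2 g x)" "rep_l2 g"]
    by (simp add: cnj_l2_def square_integrable_cnj)
  then have real: "AE x in lborel. complex_of_real (Re (rep_l2 g x)) = rep_l2 g x"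
    by eventually_elim (simp add: complex_eq_iff)
  have sq: "square_integrable (\<lambda>x. Re (rep_l2 g x))"
    by (rule square_integrable_bound[of "rep_l2 g"]) (auto simp: abs_Re_le_cmod)
  have "complex_l2 (abs_l2 (\<lambda>x. Re (rep_l2 g x))) = abs_l2 (rep_l2 g)"
    unfolding complex_l2_def
    by (rule abs_l2_cong)
      (use rep_abs_l2[OF sq] real in \<open>auto intro!: square_integrable_of_real elim!: eventually_elim2\<close>)
  then show ?thesis using g unfolding fourier_eq by (metis abs_rep_l2)
qed

text \<open>
  By \<open>plancherel_transform_inverse\<close> a function is, up to the factor \<open>2 \<pi>\<close>, the adjoint transform of
  its own transform; if the latter is integrable, the adjoint transform is given by an integral.
\<close>

lemma fourier_inversion:
  assumes i: "integrable lborel (rep_l2 (fourier f))"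
  shows "AE x in lborel. complex_of_real (rep_l2 f x) = FT (rep_l2 (fourier f)) (- x) / (2 * pi)"
proof -
  let ?G = "fourier f"
  let ?c = "\<lambda>x. cnj (rep_l2 ?G x)"
  have c: "integrable lborel ?c" "square_integrable ?c"
    using i by (auto intro: square_integrable_cnj)
  have P: "square_integrable (\<lambda>x. cnj (FT ?c x))"
    by (intro square_integrable_cnj plancherel c)
  have "plancherel_transform (complex_l2 f)
      = plancherel_transform ((1 / (2 * pi)) *\<^sub>R cnj_l2 (plancherel_transform (cnj_l2 ?G)))"
    unfolding plancherel_transform_scaleR plancherel_transform_inverse by (simp add: fourier_eq)
  then have "complex_l2 f = (1 / (2 * pi)) *\<^sub>R cnj_l2 (plancherel_transform (cnj_l2 ?G))"
    by (rule inj_plancherel_transform)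
  also have "\<dots> = abs_l2 (\<lambda>x. (1 / (2 * pi)) *\<^sub>R cnj (FT ?c x))"
    unfolding cnj_l2_def[of ?G] plancherel_transform_abs_l2[OF c] cnj_abs_l2[OF plancherel(1)[OF c]]
      scaleR_abs_l2[OF P] ..
  also have "(\<lambda>x. (1 / (2 * pi)) *\<^sub>R cnj (FT ?c x)) = (\<lambda>x. FT (rep_l2 ?G) (- x) / (2 * pi))"
    by (simp add: FT_cnj fun_eq_iff scaleR_conv_of_real)
  finally have eq: "complex_l2 f = abs_l2 (\<lambda>x. FT (rep_l2 ?G) (- x) / (2 * pi))" .
  have sq: "square_integrable (\<lambda>x. FT (rep_l2 ?G) (- x) / (2 * pi))"
    using square_integrable_scaleR[OF P, of "1 / (2 * pi)"]
    by (simp add: FT_cnj scaleR_conv_of_real)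
  show ?thesis
    using rep_complex_l2[of f] rep_abs_l2[OF sq] unfolding eq
    by eventually_elim simp
qed

section \<open>Fourier multipliers\<close>

text \<open>
  The symmetry is what keeps \<open>m(D) f\<close> real. All symbols needed here are bounded by one, and then
  \<open>m(D)\<close> is a contraction.
\<close>

definition symbol :: "(real \<Rightarrow> complex) \<Rightarrow> bool" where
  "symbol m \<longleftrightarrow> m \<in> borel_measurable borel \<and> (\<forall>\<xi>. m (- \<xi>) = cnj (m \<xi>)) \<and> (\<forall>\<xi>. norm (m \<xi>) \<le> 1)"

lemma symbol_measurable: "symbol m \<Longrightarrow> m \<in> borel_measurable borel"
  by (simp add: symbol_def)

lemma square_integrable_symbol:
  assumes m: "symbol m" and f: "square_integrable f"
  shows "square_integrable (\<lambda>\<xi>. m \<xi> * f \<xi>)"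
proof (rule square_integrable_bound[OF f])
  note [measurable] = symbol_measurable[OF m] square_integrableD(2)[OF f]
  show "(\<lambda>\<xi>. m \<xi> * f \<xi>) \<in> borel_measurable lborel" by measurable
  show "AE \<xi> in lborel. norm (m \<xi> * f \<xi>) \<le> norm (f \<xi>)"
    using m by (auto simp: norm_mult symbol_def intro!: mult_left_le_one_le)
qed

lemma fourier_hermitian: "AE \<xi> in lborel. cnj (rep_l2 (fourier f) (- \<xi>)) = rep_l2 (fourier f) \<xi>"
  using reflect_cnj_l2_fourier reflect_cnj_l2_fixed_iff by blast

lemma exists_fourier_eq:
  assumes f: "square_integrable F" and herm: "AE \<xi> in lborel. cnj (F (- \<xi>)) = F \<xi>"
  obtains f where "fourier f = abs_l2 F"
proof -
  have "reflect_cnj_l2 (abs_l2 F) = abs_l2 F"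
    unfolding reflect_cnj_abs_l2[OF f]
    by (rule abs_l2_cong) (use f herm in \<open>auto intro: square_integrable_reflect_cnj dest: square_integrableD\<close>)
  with that fourier_surj show ?thesis by blast
qed

text \<open>
  Multiplication by a symbol preserves Hermitian functions, so the description that defines
  \<open>fourier_mult\<close> is satisfied by exactly one function.
\<close>

lemma fourier_fourier_mult:
  assumes m: "symbol m"
  shows "fourier (fourier_mult m f) = abs_l2 (\<lambda>\<xi>. m \<xi> * rep_l2 (fourier f) \<xi>)"
proof -
  have "AE \<xi> in lborel. cnj (m (- \<xi>) * rep_l2 (fourier f) (- \<xi>)) = m \<xi> * rep_l2 (fourier f) \<xi>"
    using fourier_hermitian[of f] by eventually_elim (use m in \<open>simp add: symbol_def\<close>)
  from exists_fourier_eq[OF square_integrable_symbol[OF m] this]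
  obtain g where "fourier g = abs_l2 (\<lambda>\<xi>. m \<xi> * rep_l2 (fourier f) \<xi>)" by auto
  then show ?thesis
    unfolding fourier_mult_def by (rule theI) (auto simp flip: fourier_inject simp: \<open>fourier g = _\<close>)
qed

lemma rep_fourier_mult:
  "symbol m \<Longrightarrow> AE \<xi> in lborel. rep_l2 (fourier (fourier_mult m f)) \<xi> = m \<xi> * rep_l2 (fourier f) \<xi>"
  unfolding fourier_fourier_mult by (intro rep_abs_l2 square_integrable_symbol) auto

lemma fourier_eqI:
  "AE \<xi> in lborel. rep_l2 (fourier f) \<xi> = rep_l2 (fourier g) \<xi> \<Longrightarrow> f = g"
  by (simp flip: fourier_inject add: l2_eq_iff)

lemma fourier_mult_add:
  assumes m: "symbol m" shows "fourier_mult m (f + g) = fourier_mult m f + fourier_mult m g"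
proof (rule fourier_eqI)
  interpret bounded_linear fourier by (rule bounded_linear_fourier)
  show "AE \<xi> in lborel. rep_l2 (fourier (fourier_mult m (f + g))) \<xi>
      = rep_l2 (fourier (fourier_mult m f + fourier_mult m g)) \<xi>"
    using rep_fourier_mult[OF m, of "f + g"] rep_fourier_mult[OF m, of f] rep_fourier_mult[OF m, of g]
      rep_plus_l2[of "fourier f" "fourier g"]
      rep_plus_l2[of "fourier (fourier_mult m f)" "fourier (fourier_mult m g)"]
    unfolding add by eventually_elim (simp add: algebra_simps)
qed

lemma fourier_mult_scaleR:
  assumes m: "symbol m" shows "fourier_mult m (c *\<^sub>R f) = c *\<^sub>R fourier_mult m f"
proof (rule fourier_eqI)
  interpret bounded_linear fourier by (rule bounded_linear_fourier)
  show "AE \<xi> in lborel. rep_l2 (fourier (fourier_mult m (c *\<^sub>R f))) \<xi>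
      = rep_l2 (fourier (c *\<^sub>R fourier_mult m f)) \<xi>"
    using rep_fourier_mult[OF m, of "c *\<^sub>R f"] rep_fourier_mult[OF m, of f]
      rep_scaleR_l2[of c "fourier f"] rep_scaleR_l2[of c "fourier (fourier_mult m f)"]
    unfolding scale by eventually_elim simp
qed

lemma norm_fourier_mult_le:
  assumes m: "symbol m" shows "norm (fourier_mult m f) \<le> norm f"
proof -
  let ?F = "rep_l2 (fourier f)"
  have sq: "square_integrable (\<lambda>\<xi>. m \<xi> * ?F \<xi>)"
    by (rule square_integrable_symbol[OF m]) simp
  have "(norm (fourier (fourier_mult m f)))\<^sup>2 = (LINT \<xi>|lborel. (norm (m \<xi> * ?F \<xi>))\<^sup>2)"
    unfolding fourier_fourier_mult[OF m] by (rule norm_abs_l2[OF sq])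
  also have "\<dots> \<le> (LINT \<xi>|lborel. (norm (?F \<xi>))\<^sup>2)"
  proof (rule integral_mono)
    show "(norm (m \<xi> * ?F \<xi>))\<^sup>2 \<le> (norm (?F \<xi>))\<^sup>2" for \<xi>
      using m by (intro power_mono) (auto simp: norm_mult symbol_def intro!: mult_left_le_one_le)
  qed (use square_integrableD(3)[OF sq] square_integrableD(3)[of ?F] in auto)
  also have "\<dots> = (norm (fourier f))\<^sup>2" by (rule norm_rep_l2[symmetric])
  finally have "norm (fourier (fourier_mult m f)) \<le> norm (fourier f)" by simp
  then show ?thesis by (simp add: norm_fourier)
qed

lemma bounded_linear_fourier_mult:
  assumes m: "symbol m" shows "bounded_linear (fourier_mult m)"
  by (rule bounded_linear_intro[of _ 1])
    (use norm_fourier_mult_le[OF m] in \<open>simp_all add: fourier_mult_add[OF m] fourier_mult_scaleR[OF m]\<close>)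

lemma fourier_mult_commute:
  assumes m: "symbol m" and m': "symbol m'"
  shows "fourier_mult m (fourier_mult m' f) = fourier_mult m' (fourier_mult m f)"
proof (rule fourier_eqI)
  show "AE \<xi> in lborel. rep_l2 (fourier (fourier_mult m (fourier_mult m' f))) \<xi>
      = rep_l2 (fourier (fourier_mult m' (fourier_mult m f))) \<xi>"
    using rep_fourier_mult[OF m, of "fourier_mult m' f"] rep_fourier_mult[OF m', of f]
      rep_fourier_mult[OF m', of "fourier_mult m f"] rep_fourier_mult[OF m, of f]
    by eventually_elim simp
qed

lemma tendsto_fourier_mult:
  assumes m: "\<And>n::nat. symbol (m n)" and m': "symbol m'" and lim: "\<And>\<xi>. (\<lambda>n. m n \<xi>) \<longlonglongrightarrow> m' \<xi>"
  shows "(\<lambda>n. fourier_mult (m n) f) \<longlonglongrightarrow> fourier_mult m' f"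
proof -
  let ?F = "rep_l2 (fourier f)"
  interpret F: bounded_linear fourier by (rule bounded_linear_fourier)
  have "(\<lambda>n. abs_l2 (\<lambda>\<xi>. m n \<xi> * ?F \<xi>)) \<longlonglongrightarrow> abs_l2 (\<lambda>\<xi>. m' \<xi> * ?F \<xi>)"
  proof (rule dominated_convergence_l2(3))
    show "square_integrable (\<lambda>\<xi>. norm (?F \<xi>))" by (intro square_integrable_norm) simp
    show "AE \<xi> in lborel. (\<lambda>n. m n \<xi> * ?F \<xi>) \<longlonglongrightarrow> m' \<xi> * ?F \<xi>"
      by (intro AE_I2 tendsto_intros lim)
    show "AE \<xi> in lborel. norm (m n \<xi> * ?F \<xi>) \<le> norm (?F \<xi>)" for n
      using m[of n] by (auto simp: norm_mult symbol_def intro!: mult_left_le_one_le)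
    show "(\<lambda>\<xi>. m n \<xi> * ?F \<xi>) \<in> borel_measurable lborel" for n
      using symbol_measurable[OF m[of n]] by simp
    show "(\<lambda>\<xi>. m' \<xi> * ?F \<xi>) \<in> borel_measurable lborel"
      using symbol_measurable[OF m'] by simp
  qed
  then have "(\<lambda>n. fourier (fourier_mult (m n) f)) \<longlonglongrightarrow> fourier (fourier_mult m' f)"
    by (simp add: fourier_fourier_mult m m')
  then have "(\<lambda>n. norm (fourier (fourier_mult (m n) f - fourier_mult m' f))) \<longlonglongrightarrow> 0"
    by (simp add: F.diff tendsto_norm_zero_iff LIM_zero_iff)
  then have "(\<lambda>n. norm (fourier_mult (m n) f - fourier_mult m' f)) \<longlonglongrightarrow> 0"
    unfolding norm_fourier
    using tendsto_mult_left[of "\<lambda>n. sqrt (2 * pi) * norm (fourier_mult (m n) f - fourier_mult m' f)" 0 _ "1 / sqrt (2 * pi)"]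
    by simp
  then show ?thesis by (simp add: tendsto_norm_zero_iff LIM_zero_iff)
qed

lemma symbol_cis: "symbol (\<lambda>\<xi>. cis (t * \<xi>))"
proof -
  have "(\<lambda>\<xi>. cis (t * \<xi>)) \<in> borel_measurable borel" by measurable
  then show ?thesis by (simp add: symbol_def cis_cnj)
qed

text \<open>
  The derivative is compensated by the decay of \<open>K\<close>: the symbol of \<open>K \<partial>\<^sub>x\<close> is \<open>\<i> tanh \<xi>\<close>.
\<close>

lemma symbol_K_dx: "symbol (\<lambda>\<xi>. complex_of_real (K_symbol \<xi>) * (\<i> * complex_of_real \<xi>))"
proof -
  have eq: "complex_of_real (K_symbol \<xi>) * (\<i> * complex_of_real \<xi>) = \<i> * complex_of_real (tanh \<xi>)" for \<xi>
    by (simp add: K_symbol_def)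
  have "(\<lambda>x. tanh x) \<in> borel_measurable (borel :: real measure)"
    by (intro borel_measurable_continuous_onI continuous_intros) (auto simp: cosh_real_nonzero)
  then have "(\<lambda>\<xi>. \<i> * complex_of_real (tanh \<xi>)) \<in> borel_measurable borel" by measurable
  moreover have "\<bar>tanh \<xi>\<bar> \<le> 1" for \<xi> :: real
    using tanh_real_bounds[of \<xi>] by auto
  ultimately show ?thesis unfolding eq by (simp add: symbol_def norm_mult)
qed

section \<open>Sobolev spaces as images of Bessel potentials\<close>

text \<open>
  The Bessel potential \<open>(1 - \<partial>\<^sub>x\<^sup>2)\<^sup>-\<^sup>s\<^sup>/\<^sup>2\<close>. It identifies \<open>L\<^sup>2\<close> with \<open>H\<^sup>s\<close>, so that statements about
  \<open>H\<^sup>s\<close> become statements about a Banach space that is a type.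
\<close>

definition bessel :: "real \<Rightarrow> real l2 \<Rightarrow> real l2" where
  "bessel s = fourier_mult (\<lambda>\<xi>. complex_of_real ((1 + \<xi>\<^sup>2) powr (- s / 2)))"

lemma symbol_bessel:
  assumes "s \<ge> 0" shows "symbol (\<lambda>\<xi>. complex_of_real ((1 + \<xi>\<^sup>2) powr (- s / 2)))"
proof -
  have "(1 + \<xi>\<^sup>2) powr (- s / 2) \<le> (1 + \<xi>\<^sup>2) powr 0" for \<xi> :: real
    by (rule powr_mono) (use assms in auto)
  moreover have "(1 + \<xi>\<^sup>2 :: real) powr 0 = 1" for \<xi>
    using zero_le_power2[of \<xi>] by (simp add: add_nonneg_eq_0_iff)
  ultimately show ?thesis by (auto simp: symbol_def)
qed

lemma rep_fourier_bessel:
  assumes "s \<ge> 0"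
  shows "AE \<xi> in lborel. rep_l2 (fourier (bessel s g)) \<xi>
    = complex_of_real ((1 + \<xi>\<^sup>2) powr (- s / 2)) * rep_l2 (fourier g) \<xi>"
  unfolding bessel_def by (rule rep_fourier_mult[OF symbol_bessel[OF assms]])

lemma bounded_linear_bessel: "s \<ge> 0 \<Longrightarrow> bounded_linear (bessel s)"
  unfolding bessel_def by (intro bounded_linear_fourier_mult symbol_bessel)

lemma bessel_powr_cancel: "(1 + \<xi>\<^sup>2 :: real) powr a * (1 + \<xi>\<^sup>2) powr (- a) = 1"
  using zero_le_power2[of \<xi>] by (simp add: add_nonneg_eq_0_iff flip: powr_add)

lemma bessel_weight:
  assumes "z = complex_of_real ((1 + \<xi>\<^sup>2) powr (- s / 2)) * y"
  shows "(1 + \<xi>\<^sup>2) powr s * (norm z)\<^sup>2 = (norm y)\<^sup>2"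
proof -
  have "((1 + \<xi>\<^sup>2) powr (- s / 2))\<^sup>2 = (1 + \<xi>\<^sup>2) powr (- s)"
    by (simp add: power2_eq_square flip: powr_add)
  then show ?thesis
    using bessel_powr_cancel[of \<xi> s] unfolding assms
    by (simp add: norm_mult power_mult_distrib flip: mult.assoc)
qed

lemma bessel_in_sobolev:
  assumes s: "s \<ge> 0"
  shows "bessel s g \<in> sobolev s" "sobolev_norm s (bessel s g) = sqrt (2 * pi) * norm g"
proof -
  have ae: "AE \<xi> in lborel. (1 + \<xi>\<^sup>2) powr s * (norm (rep_l2 (fourier (bessel s g)) \<xi>))\<^sup>2
      = (norm (rep_l2 (fourier g) \<xi>))\<^sup>2"
    using rep_fourier_bessel[OF s, of g] by eventually_elim (rule bessel_weight)
  have "integrable lborel (\<lambda>\<xi>. (1 + \<xi>\<^sup>2) powr s * (norm (rep_l2 (fourier (bessel s g)) \<xi>))\<^sup>2)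
      \<longleftrightarrow> integrable lborel (\<lambda>\<xi>. (norm (rep_l2 (fourier g) \<xi>))\<^sup>2)"
    by (rule integrable_cong_AE) (use ae in auto)
  then show "bessel s g \<in> sobolev s"
    using square_integrableD(3)[OF square_integrable_rep[of "fourier g"]] by (simp add: sobolev_def)
  have "(LINT \<xi>|lborel. (1 + \<xi>\<^sup>2) powr s * (norm (rep_l2 (fourier (bessel s g)) \<xi>))\<^sup>2)
      = (LINT \<xi>|lborel. (norm (rep_l2 (fourier g) \<xi>))\<^sup>2)"
    by (rule integral_cong_AE) (use ae in auto)
  then show "sobolev_norm s (bessel s g) = sqrt (2 * pi) * norm g"
    unfolding sobolev_norm_def norm_rep_l2[symmetric] by (simp add: norm_fourier)
qed

lemma sobolev_eq_range_bessel:
  assumes s: "s \<ge> 0" shows "sobolev s = range (bessel s)"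
proof (intro subset_antisym subsetI)
  fix f assume f: "f \<in> sobolev s"
  let ?W = "\<lambda>\<xi>. complex_of_real ((1 + \<xi>\<^sup>2) powr (s / 2)) * rep_l2 (fourier f) \<xi>"
  have "(norm (?W \<xi>))\<^sup>2 = (1 + \<xi>\<^sup>2) powr s * (norm (rep_l2 (fourier f) \<xi>))\<^sup>2" for \<xi>
    by (simp add: norm_mult power_mult_distrib power2_eq_square flip: powr_add)
  then have sq: "square_integrable ?W"
    using f by (simp add: square_integrable_def sobolev_def)
  have "AE \<xi> in lborel. cnj (?W (- \<xi>)) = ?W \<xi>"
    using fourier_hermitian[of f] by eventually_elim simp
  from exists_fourier_eq[OF sq this] obtain g where g: "fourier g = abs_l2 ?W" .
  have "bessel s g = f"
  proof (rule fourier_eqI)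
    have c: "complex_of_real ((1 + \<xi>\<^sup>2) powr (- s / 2)) * ?W \<xi> = rep_l2 (fourier f) \<xi>" for \<xi>
    proof -
      have "complex_of_real ((1 + \<xi>\<^sup>2) powr (- s / 2)) * complex_of_real ((1 + \<xi>\<^sup>2) powr (s / 2)) = 1"
        using bessel_powr_cancel[of \<xi> "s / 2"]
        by (simp add: mult.commute flip: of_real_mult)
      then show ?thesis by (simp flip: mult.assoc)
    qed
    show "AE \<xi> in lborel. rep_l2 (fourier (bessel s g)) \<xi> = rep_l2 (fourier f) \<xi>"
      using rep_fourier_bessel[OF s, of g] rep_abs_l2[OF sq] unfolding g
      by eventually_elim (simp only: c)
  qed
  then show "f \<in> range (bessel s)" by auto
qed (use bessel_in_sobolev[OF s] in auto)

lemma bessel_inject: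
  assumes s: "s \<ge> 0" shows "bessel s f = bessel s g \<longleftrightarrow> f = g"
proof
  interpret bounded_linear "bessel s" by (rule bounded_linear_bessel[OF s])
  assume "bessel s f = bessel s g"
  then have "bessel s (f - g) = bessel s 0" by (simp add: diff)
  then have "sqrt (2 * pi) * norm (f - g) = sqrt (2 * pi) * norm (0 :: real l2)"
    using bessel_in_sobolev(2)[OF s] by metis
  then show "f = g" by simp
qed simp

section \<open>Sobolev spaces above the critical exponent are algebras\<close>

text \<open>
  This is where \<open>s > 1/2\<close> enters: functions in \<open>H\<^sup>s\<close> have integrable Fourier transforms precisely when
  this weight is integrable.
\<close>

lemma integrable_one_plus_square_powr:
  assumes s: "s > 1 / 2" shows "integrable lborel (\<lambda>\<xi>. (1 + \<xi>\<^sup>2) powr (- s) :: real)"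
proof -
  let ?q = "\<lambda>x::real. x powr (- 2 * s) * indicator {1..} x"
  have "(\<integral>\<^sup>+x. ennreal (?q x) \<partial>lborel) = (\<integral>\<^sup>+x. ennreal (x powr (- 2 * s)) * indicator {1..} x \<partial>lborel)"
    by (intro nn_integral_cong) (auto simp: indicator_def)
  also have "\<dots> = ennreal (0 - 1 powr (1 - 2 * s) / (1 - 2 * s))"
  proof (rule nn_integral_FTC_atLeast[where F = "\<lambda>x. x powr (1 - 2 * s) / (1 - 2 * s)"])
    fix x :: real assume "1 \<le> x"
    then show "DERIV (\<lambda>x. x powr (1 - 2 * s) / (1 - 2 * s)) x :> x powr (- 2 * s)"
      using DERIV_cdivide[OF has_real_derivative_powr[of x "1 - 2 * s"], of "1 - 2 * s"] s by simp
  next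
    have "((\<lambda>x::real. x powr (1 - 2 * s)) \<longlongrightarrow> 0) at_top"
      by (rule tendsto_neg_powr) (use s in \<open>auto intro: filterlim_ident\<close>)
    from tendsto_divide[OF this tendsto_const[of "1 - 2 * s"]]
    show "((\<lambda>x::real. x powr (1 - 2 * s) / (1 - 2 * s)) \<longlongrightarrow> 0) at_top"
      using s by simp
  qed auto
  also have "\<dots> < \<infinity>" by simp
  finally have q: "integrable lborel ?q"
    by (intro integrableI_bounded) (auto simp: indicator_def)
  have q': "integrable lborel (\<lambda>x. ?q (- x))"
    using lborel_integrable_real_affine[OF q, of "-1" 0] by simp
  show ?thesis
  proof (rule Bochner_Integration.integrable_bound)
    show "integrable lborel (\<lambda>x. indicator {-1..1} x + ?q x + ?q (- x))"
      by (intro Bochner_Integration.integrable_add q q' integrable_real_indicator)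
        (auto simp: emeasure_lborel_Icc_eq)
    show "AE x in lborel. norm ((1 + x\<^sup>2) powr (- s)) \<le> norm (indicator {-1..1} x + ?q x + ?q (- x))"
    proof (rule AE_I2)
      fix x :: real
      have pos: "0 < 1 + x\<^sup>2" by (simp add: add_pos_nonneg)
      consider "x \<in> {-1..1}" | "x > 1" | "x < -1" by fastforce
      then show "norm ((1 + x\<^sup>2) powr (- s)) \<le> norm (indicator {-1..1} x + ?q x + ?q (- x))"
      proof cases
        case 1
        have "(1 + x\<^sup>2) powr (- s) \<le> (1 + x\<^sup>2) powr 0" by (rule powr_mono) (use s in auto)
        also have "\<dots> = 1" using pos by simp
        also have "1 \<le> indicator {-1..1} x + ?q x + ?q (- x)" using 1 by simp
        finally show ?thesis by simp
      next
        case 2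
        have "(1 + x\<^sup>2) powr (- s) \<le> (x\<^sup>2) powr (- s)"
          by (rule powr_mono2') (use 2 s in auto)
        also have "(x\<^sup>2) powr (- s) = x powr (- 2 * s)"
          using 2 by (simp add: powr_powr flip: powr_numeral)
        finally show ?thesis using 2 by simp
      next
        case 3
        have "(1 + x\<^sup>2) powr (- s) \<le> ((- x)\<^sup>2) powr (- s)"
          using powr_mono2'[of "- s" "(- x)\<^sup>2" "1 + x\<^sup>2"] 3 s by simp
        also have "((- x)\<^sup>2) powr (- s) = (- x) powr (- 2 * s)"
          using 3 powr_powr[of "- x" 2 "- s"] by (simp add: powr_numeral)
        finally show ?thesis using 3 by simp
      qed
    qed
  qed measurable
qed

text \<open>
  Of two frequencies the larger one carries the weight of their sum, up to a constant. In a product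
  all derivatives can thus be put on one of the two factors.
\<close>

lemma one_plus_square_powr_triangle:
  assumes s: "s \<ge> 0"
  shows "(1 + (p + q)\<^sup>2 :: real) powr (s / 2)
    \<le> 4 powr (s / 2) * ((1 + p\<^sup>2) powr (s / 2) + (1 + q\<^sup>2) powr (s / 2))"
proof -
  have *: "(1 + (p + q)\<^sup>2 :: real) powr (s / 2) \<le> 4 powr (s / 2) * (1 + p\<^sup>2) powr (s / 2)"
    if "\<bar>q\<bar> \<le> \<bar>p\<bar>" for p q :: real
  proof -
    have "(p + q)\<^sup>2 \<le> (2 * p)\<^sup>2"
      by (rule iffD1[OF abs_le_square_iff]) (use that in linarith)
    then have "1 + (p + q)\<^sup>2 \<le> 4 * (1 + p\<^sup>2)" by simp
    then have "(1 + (p + q)\<^sup>2) powr (s / 2) \<le> (4 * (1 + p\<^sup>2)) powr (s / 2)"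
      by (intro powr_mono2) (use s in auto)
    then show ?thesis unfolding powr_mult .
  qed
  have nn: "0 \<le> (4::real) powr (s / 2) * (1 + p\<^sup>2) powr (s / 2)"
    "0 \<le> (4::real) powr (s / 2) * (1 + q\<^sup>2) powr (s / 2)" by auto
  show ?thesis
  proof (cases "\<bar>q\<bar> \<le> \<bar>p\<bar>")
    case True
    from *[OF this] nn show ?thesis unfolding distrib_left by linarith
  next
    case False
    then have "(1 + (q + p)\<^sup>2) powr (s / 2) \<le> 4 powr (s / 2) * (1 + q\<^sup>2) powr (s / 2)"
      by (intro *) simp
    with nn show ?thesis unfolding distrib_left add.commute[of p q] by linarith
  qed
qed

text \<open>Young's inequality for \<open>L\<^sup>2 * L\<^sup>1\<close>, with the factor \<open>b\<close> split as \<open>sqrt b * sqrt b\<close>.\<close>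

lemma young_nn_integral:
  fixes a b :: "real \<Rightarrow> real"
  assumes [measurable]: "a \<in> borel_measurable borel" "b \<in> borel_measurable borel"
    and b: "\<And>x. 0 \<le> b x"
  shows "(\<integral>\<^sup>+z. (\<integral>\<^sup>+y. ennreal (a (z - y)) * ennreal (b y) \<partial>lborel)\<^sup>2 \<partial>lborel)
    \<le> (\<integral>\<^sup>+x. (ennreal (a x))\<^sup>2 \<partial>lborel) * (\<integral>\<^sup>+x. ennreal (b x) \<partial>lborel)\<^sup>2"
proof -
  have sq: "(ennreal (sqrt (b y)))\<^sup>2 = ennreal (b y)" for y
    using b by (simp add: ennreal_power)
  have "(\<integral>\<^sup>+y. ennreal (a (z - y)) * ennreal (b y) \<partial>lborel)\<^sup>2
      \<le> (\<integral>\<^sup>+y. (ennreal (a (z - y)))\<^sup>2 * ennreal (b y) \<partial>lborel) * (\<integral>\<^sup>+x. ennreal (b x) \<partial>lborel)" for z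
  proof -
    have "(\<integral>\<^sup>+y. ennreal (a (z - y)) * ennreal (b y) \<partial>lborel)
        = (\<integral>\<^sup>+y. (ennreal (a (z - y)) * ennreal (sqrt (b y))) * ennreal (sqrt (b y)) \<partial>lborel)"
      by (simp add: sq mult.assoc flip: power2_eq_square)
    also have "\<dots>\<^sup>2 \<le> (\<integral>\<^sup>+y. (ennreal (a (z - y)) * ennreal (sqrt (b y)))\<^sup>2 \<partial>lborel)
        * (\<integral>\<^sup>+y. (ennreal (sqrt (b y)))\<^sup>2 \<partial>lborel)"
      by (rule Cauchy_Schwarz_nn_integral) measurable
    finally show ?thesis by (simp add: power_mult_distrib sq)
  qed
  then have "(\<integral>\<^sup>+z. (\<integral>\<^sup>+y. ennreal (a (z - y)) * ennreal (b y) \<partial>lborel)\<^sup>2 \<partial>lborel)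
      \<le> (\<integral>\<^sup>+z. (\<integral>\<^sup>+y. (ennreal (a (z - y)))\<^sup>2 * ennreal (b y) \<partial>lborel)
          * (\<integral>\<^sup>+x. ennreal (b x) \<partial>lborel) \<partial>lborel)"
    by (rule nn_integral_mono)
  also have "\<dots> = (\<integral>\<^sup>+z. \<integral>\<^sup>+y. (ennreal (a (z - y)))\<^sup>2 * ennreal (b y) \<partial>lborel \<partial>lborel)
      * (\<integral>\<^sup>+x. ennreal (b x) \<partial>lborel)"
    by (rule nn_integral_multc) measurable
  also have "\<dots> = (\<integral>\<^sup>+x. (ennreal (a x))\<^sup>2 \<partial>lborel) * (\<integral>\<^sup>+x. ennreal (b x) \<partial>lborel)\<^sup>2"
    by (subst nn_integral_conv[of "\<lambda>x. (ennreal (a x))\<^sup>2" "\<lambda>x. ennreal (b x)"])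
      (auto simp: power2_eq_square mult.assoc)
  finally show ?thesis .
qed

lemma ennreal_power2_add_le: "(x + y)\<^sup>2 \<le> 2 * (x\<^sup>2 + y\<^sup>2 :: ennreal)"
proof (cases "x = top \<or> y = top")
  case True
  then show ?thesis by (auto simp: power2_eq_square ennreal_mult_top ennreal_top_mult)
next
  case False
  then obtain a b where ab: "x = ennreal a" "a \<ge> 0" "y = ennreal b" "b \<ge> 0"
    by (cases x; cases y) auto
  have "(a + b)\<^sup>2 \<le> 2 * (a\<^sup>2 + b\<^sup>2)"
    using sum_squares_bound[of a b] by (simp add: power2_sum)
  then have "ennreal ((a + b)\<^sup>2) \<le> ennreal (2 * (a\<^sup>2 + b\<^sup>2))" by (rule ennreal_leI)
  also have "ennreal (2 * (a\<^sup>2 + b\<^sup>2)) = 2 * (ennreal (a\<^sup>2) + ennreal (b\<^sup>2))"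
    by (simp add: ennreal_mult)
  also have "ennreal ((a + b)\<^sup>2) = (x + y)\<^sup>2"
    using ab by (metis ennreal_plus ennreal_power add_nonneg_nonneg)
  finally show ?thesis using ab by (simp add: ennreal_power)
qed

lemma ennreal_norm_integral_le:
  fixes f :: "'a \<Rightarrow> complex"
  shows "ennreal (norm (integral\<^sup>L M f)) \<le> (\<integral>\<^sup>+x. ennreal (norm (f x)) \<partial>M)"
  by (cases "integrable M f") (auto intro: integral_norm_bound_ennreal simp: not_integrable_integral_eq)

text \<open>
  The transforms of two functions in \<open>H\<^sup>s\<close> are \<open>v A\<close> and \<open>v B\<close> with \<open>A\<close> and \<open>B\<close> in \<open>L\<^sup>2\<close>. By
  \<open>one_plus_square_powr_triangle\<close> the weighted convolution is at most a constant times
  \<open>\<bar>A\<bar> * (v \<bar>B\<bar>) + (v \<bar>A\<bar>) * \<bar>B\<bar>\<close>, where \<open>*\<close> is convolution. In each term one factor is in \<open>L\<^sup>2\<close> and the other one in \<open>L\<^sup>1\<close>, by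
  the Cauchy--Schwarz inequality, so that Young's inequality applies.
\<close>

lemma nn_integral_weighted_conv_le:
  fixes A B :: "real \<Rightarrow> complex"
  assumes s: "s \<ge> 0" and [measurable]: "A \<in> borel_measurable borel" "B \<in> borel_measurable borel"
  defines "v \<equiv> \<lambda>\<xi>::real. (1 + \<xi>\<^sup>2) powr (- s / 2)"
  shows "(\<integral>\<^sup>+\<zeta>. (ennreal (norm (complex_of_real ((1 + \<zeta>\<^sup>2) powr (s / 2))
        * conv (\<lambda>\<xi>. complex_of_real (v \<xi>) * A \<xi>) (\<lambda>\<xi>. complex_of_real (v \<xi>) * B \<xi>) \<zeta>)))\<^sup>2 \<partial>lborel)
    \<le> ennreal ((2 * 4 powr (s / 2))\<^sup>2) * ((\<integral>\<^sup>+\<xi>. (ennreal (v \<xi>))\<^sup>2 \<partial>lborel)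
      * (\<integral>\<^sup>+\<xi>. (ennreal (norm (A \<xi>)))\<^sup>2 \<partial>lborel) * (\<integral>\<^sup>+\<xi>. (ennreal (norm (B \<xi>)))\<^sup>2 \<partial>lborel))"
proof -
  define w where "w = (\<lambda>\<xi>::real. (1 + \<xi>\<^sup>2) powr (s / 2))"
  define C where "C = (4::real) powr (s / 2)"
  have [measurable]: "v \<in> borel_measurable borel" unfolding v_def by measurable
  have wv: "w \<xi> * v \<xi> = 1" for \<xi>
    using bessel_powr_cancel[of \<xi> "s / 2"] by (simp add: w_def v_def)
  have nn: "0 \<le> w \<xi>" "0 \<le> v \<xi>" "0 \<le> C" for \<xi> by (simp_all add: w_def v_def C_def)
  let ?F = "\<lambda>\<xi>. complex_of_real (v \<xi>) * A \<xi>" and ?G = "\<lambda>\<xi>. complex_of_real (v \<xi>) * B \<xi>"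
  let ?a = "\<lambda>\<xi>. norm (A \<xi>)" and ?b = "\<lambda>\<xi>. norm (B \<xi>)"
  define I where "I a b \<zeta> = (\<integral>\<^sup>+y. ennreal (norm (a (\<zeta> - y))) * ennreal (v y * norm (b y)) \<partial>lborel)"
    for a b :: "real \<Rightarrow> complex" and \<zeta>
  have conv_le: "ennreal (norm (complex_of_real (w \<zeta>) * conv ?F ?G \<zeta>)) \<le> ennreal C * (I A B \<zeta> + I B A \<zeta>)" for \<zeta>
  proof -
    have "ennreal (norm (complex_of_real (w \<zeta>) * conv ?F ?G \<zeta>))
        = ennreal (w \<zeta>) * ennreal (norm (conv ?F ?G \<zeta>))"
      using nn(1)[of \<zeta>] by (simp add: norm_mult ennreal_mult)
    also have "\<dots> \<le> ennreal (w \<zeta>) * (\<integral>\<^sup>+y. ennreal (norm (?F (\<zeta> - y) * ?G y)) \<partial>lborel)"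
      unfolding conv_def by (intro mult_left_mono ennreal_norm_integral_le) simp
    also have "\<dots> = (\<integral>\<^sup>+y. ennreal (w \<zeta>) * ennreal (norm (?F (\<zeta> - y) * ?G y)) \<partial>lborel)"
      by (rule nn_integral_cmult[symmetric]) measurable
    also have "\<dots> \<le> (\<integral>\<^sup>+y. ennreal C * (ennreal (?a (\<zeta> - y)) * ennreal (v y * ?b y)
        + ennreal (?b y) * ennreal (v (\<zeta> - y) * ?a (\<zeta> - y))) \<partial>lborel)"
    proof (rule nn_integral_mono)
      fix y
      let ?n = "v (\<zeta> - y) * ?a (\<zeta> - y) * (v y * ?b y)"
      have "w \<zeta> * ?n \<le> C * (w (\<zeta> - y) + w y) * ?n"
        using one_plus_square_powr_triangle[OF s, of "\<zeta> - y" y] nn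
        by (intro mult_right_mono) (auto simp: w_def C_def)
      also have "\<dots> = C * ((w (\<zeta> - y) * v (\<zeta> - y)) * (?a (\<zeta> - y) * (v y * ?b y))
          + (w y * v y) * (?b y * (v (\<zeta> - y) * ?a (\<zeta> - y))))"
        by (simp only: distrib_left distrib_right ac_simps)
      also have "\<dots> = C * (?a (\<zeta> - y) * (v y * ?b y) + ?b y * (v (\<zeta> - y) * ?a (\<zeta> - y)))"
        unfolding wv by simp
      finally have "ennreal (w \<zeta> * ?n)
          \<le> ennreal (C * (?a (\<zeta> - y) * (v y * ?b y) + ?b y * (v (\<zeta> - y) * ?a (\<zeta> - y))))"
        by (rule ennreal_leI)
      then show "ennreal (w \<zeta>) * ennreal (norm (?F (\<zeta> - y) * ?G y))
          \<le> ennreal C * (ennreal (?a (\<zeta> - y)) * ennreal (v y * ?b y)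
            + ennreal (?b y) * ennreal (v (\<zeta> - y) * ?a (\<zeta> - y)))"
        using nn by (simp add: norm_mult ennreal_mult ennreal_plus)
    qed
    also have "\<dots> = ennreal C * ((\<integral>\<^sup>+y. ennreal (?a (\<zeta> - y)) * ennreal (v y * ?b y) \<partial>lborel)
        + (\<integral>\<^sup>+y. ennreal (?b y) * ennreal (v (\<zeta> - y) * ?a (\<zeta> - y)) \<partial>lborel))"
      by (subst nn_integral_cmult, measurable, subst nn_integral_add, measurable)
    also have "(\<integral>\<^sup>+y. ennreal (?b y) * ennreal (v (\<zeta> - y) * ?a (\<zeta> - y)) \<partial>lborel) = I B A \<zeta>"
      unfolding I_def by (subst nn_integral_real_affine[of _ "-1" \<zeta>]) auto
    finally show ?thesis unfolding I_def .
  qed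
  have [measurable]: "I A B \<in> borel_measurable borel" "I B A \<in> borel_measurable borel"
    unfolding I_def by measurable
  have I_le: "(\<integral>\<^sup>+\<zeta>. (I a b \<zeta>)\<^sup>2 \<partial>lborel) \<le> (\<integral>\<^sup>+\<xi>. (ennreal (norm (a \<xi>)))\<^sup>2 \<partial>lborel)
      * ((\<integral>\<^sup>+\<xi>. (ennreal (v \<xi>))\<^sup>2 \<partial>lborel) * (\<integral>\<^sup>+\<xi>. (ennreal (norm (b \<xi>)))\<^sup>2 \<partial>lborel))"
    if [measurable]: "a \<in> borel_measurable borel" "b \<in> borel_measurable borel" for a b
  proof -
    have "(\<integral>\<^sup>+\<zeta>. (I a b \<zeta>)\<^sup>2 \<partial>lborel) \<le> (\<integral>\<^sup>+\<xi>. (ennreal (norm (a \<xi>)))\<^sup>2 \<partial>lborel)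
        * (\<integral>\<^sup>+y. ennreal (v y * norm (b y)) \<partial>lborel)\<^sup>2"
      unfolding I_def by (rule young_nn_integral) (use nn in auto)
    also have "(\<integral>\<^sup>+y. ennreal (v y * norm (b y)) \<partial>lborel)
        = (\<integral>\<^sup>+y. ennreal (v y) * ennreal (norm (b y)) \<partial>lborel)"
      using nn by (simp add: ennreal_mult)
    also have "\<dots>\<^sup>2 \<le> (\<integral>\<^sup>+\<xi>. (ennreal (v \<xi>))\<^sup>2 \<partial>lborel) * (\<integral>\<^sup>+\<xi>. (ennreal (norm (b \<xi>)))\<^sup>2 \<partial>lborel)"
      by (rule Cauchy_Schwarz_nn_integral) measurable
    finally show ?thesis by (simp add: mult_left_mono)
  qed
  let ?V = "\<integral>\<^sup>+\<xi>. (ennreal (v \<xi>))\<^sup>2 \<partial>lborel" and ?A2 = "\<integral>\<^sup>+\<xi>. (ennreal (?a \<xi>))\<^sup>2 \<partial>lborel"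
    and ?B2 = "\<integral>\<^sup>+\<xi>. (ennreal (?b \<xi>))\<^sup>2 \<partial>lborel"
  have "(\<integral>\<^sup>+\<zeta>. (ennreal (norm (complex_of_real (w \<zeta>) * conv ?F ?G \<zeta>)))\<^sup>2 \<partial>lborel)
      \<le> (\<integral>\<^sup>+\<zeta>. (ennreal C)\<^sup>2 * 2 * ((I A B \<zeta>)\<^sup>2 + (I B A \<zeta>)\<^sup>2) \<partial>lborel)"
  proof (rule nn_integral_mono)
    fix \<zeta>
    have "(ennreal (norm (complex_of_real (w \<zeta>) * conv ?F ?G \<zeta>)))\<^sup>2 \<le> (ennreal C * (I A B \<zeta> + I B A \<zeta>))\<^sup>2"
      by (rule power_mono[OF conv_le]) simp
    also have "\<dots> \<le> (ennreal C)\<^sup>2 * (2 * ((I A B \<zeta>)\<^sup>2 + (I B A \<zeta>)\<^sup>2))"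
      unfolding power_mult_distrib by (intro mult_left_mono ennreal_power2_add_le) simp
    finally show "(ennreal (norm (complex_of_real (w \<zeta>) * conv ?F ?G \<zeta>)))\<^sup>2
        \<le> (ennreal C)\<^sup>2 * 2 * ((I A B \<zeta>)\<^sup>2 + (I B A \<zeta>)\<^sup>2)"
      by (simp add: mult.assoc)
  qed
  also have "\<dots> = (ennreal C)\<^sup>2 * 2 * ((\<integral>\<^sup>+\<zeta>. (I A B \<zeta>)\<^sup>2 \<partial>lborel) + (\<integral>\<^sup>+\<zeta>. (I B A \<zeta>)\<^sup>2 \<partial>lborel))"
    by (subst nn_integral_cmult, measurable, subst nn_integral_add, measurable)
  also have "\<dots> \<le> (ennreal C)\<^sup>2 * 2 * (?A2 * (?V * ?B2) + ?B2 * (?V * ?A2))"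
    by (intro mult_left_mono add_mono I_le) auto
  also have "\<dots> = (ennreal C)\<^sup>2 * 2 * (2 * (?V * ?A2 * ?B2))"
    by (simp only: mult_2 ac_simps)
  also have "\<dots> = (ennreal C)\<^sup>2 * (2 * 2) * (?V * ?A2 * ?B2)"
    by (simp only: mult.assoc)
  also have "(2 * 2 :: ennreal) = 4" by simp
  also have "(ennreal C)\<^sup>2 * 4 = ennreal ((2 * C)\<^sup>2)"
    using nn by (simp add: ennreal_power ennreal_mult power_mult_distrib mult.commute)
  finally show ?thesis unfolding w_def C_def .
qed

lemma conv_hermitian:
  assumes [measurable]: "F \<in> borel_measurable borel" "G \<in> borel_measurable borel"
    and F: "AE \<xi> in lborel. cnj (F (- \<xi>)) = F \<xi>" and G: "AE \<xi> in lborel. cnj (G (- \<xi>)) = G \<xi>"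
  shows "cnj (conv F G (- \<zeta>)) = conv F G \<zeta>"
proof -
  have "AE \<xi> in distr lborel borel ((+) (- \<zeta>)). cnj (F (- \<xi>)) = F \<xi>"
    unfolding lborel_distr_plus by (rule F)
  then have "AE y in lborel. cnj (F (- (- \<zeta> + y))) = F (- \<zeta> + y)"
    by (rule AE_distrD[rotated]) simp
  from AE_lborel_reflect[OF this] AE_lborel_reflect[OF G]
  have ae: "AE y in lborel. cnj (F (- \<zeta> - y) * G y) = F (\<zeta> + y) * G (- y)"
  proof eventually_elim
    case (elim y)
    have "cnj (F (- \<zeta> - y)) = F (\<zeta> + y)" using arg_cong[OF elim(1), of cnj] by (simp add: algebra_simps)
    moreover have "cnj (G y) = G (- y)" using elim(2) by simp
    ultimately show ?case by simp
  qed
  have "cnj (conv F G (- \<zeta>)) = (LINT y|lborel. cnj (F (- \<zeta> - y) * G y))"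
    unfolding conv_def by (rule Bochner_Integration.integral_cnj[symmetric])
  also have "\<dots> = (LINT y|lborel. F (\<zeta> + y) * G (- y))"
    by (rule integral_cong_AE) (use ae in auto)
  also have "\<dots> = conv F G \<zeta>"
    unfolding conv_def by (subst (2) lborel_integral_real_affine[of "-1" _ 0]) auto
  finally show ?thesis .
qed

text \<open>
  The function \<open>c\<close> is found on the Fourier side, by prescribing the convolution of the two transforms,
  divided by \<open>2 \<pi>\<close>, as the transform of \<open>bessel s c\<close>. Since the convolution is integrable, \<open>fourier_inversion\<close> and \<open>FT_conv\<close>
  identify \<open>bessel s c\<close> with the pointwise product.
\<close>

lemma bessel_product:
  assumes s: "s > 1 / 2"
  obtains K where "0 \<le> K" "\<And>a b. \<exists>c. norm c \<le> K * norm a * norm b \<and>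
    (AE x in lborel. rep_l2 (bessel s c) x = rep_l2 (bessel s a) x * rep_l2 (bessel s b) x)"
proof
  have s0: "s \<ge> 0" using s by simp
  define v where "v = (\<lambda>\<xi>::real. (1 + \<xi>\<^sup>2) powr (- s / 2))"
  define w where "w = (\<lambda>\<xi>::real. (1 + \<xi>\<^sup>2) powr (s / 2))"
  have wv: "v \<xi> * w \<xi> = 1" for \<xi>
    using bessel_powr_cancel[of \<xi> "s / 2"] by (simp add: w_def v_def mult.commute)
  have [measurable]: "v \<in> borel_measurable borel" "w \<in> borel_measurable borel"
    unfolding v_def w_def by measurable
  have "(norm (v \<xi>))\<^sup>2 = (1 + \<xi>\<^sup>2) powr (- s)" for \<xi>
    by (simp add: v_def power2_eq_square flip: powr_add)
  then have v_sq: "square_integrable v"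
    using integrable_one_plus_square_powr[OF s] by (simp add: square_integrable_def)
  define \<kappa> where "\<kappa> = norm (abs_l2 v)"
  define C where "C = 2 * 4 powr (s / 2)"
  define K where "K = C * \<kappa>"
  show "0 \<le> K" by (simp add: K_def C_def \<kappa>_def)
  fix a b
  let ?A = "rep_l2 (fourier a)" and ?B = "rep_l2 (fourier b)"
  define F where "F \<xi> = complex_of_real (v \<xi>) * ?A \<xi>" for \<xi>
  define G where "G \<xi> = complex_of_real (v \<xi>) * ?B \<xi>" for \<xi>
  have [measurable]: "F \<in> borel_measurable borel" "G \<in> borel_measurable borel"
    unfolding F_def G_def by measurable
  have F_int: "integrable lborel F" and G_int: "integrable lborel G"
    unfolding F_def G_def
    by (intro integrable_mult_square_integrable square_integrable_of_real v_sq square_integrable_rep)+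
  have herm: "AE \<xi> in lborel. cnj (complex_of_real (v (- \<xi>)) * rep_l2 (fourier f) (- \<xi>))
      = complex_of_real (v \<xi>) * rep_l2 (fourier f) \<xi>" for f
    using fourier_hermitian[of f] by eventually_elim (simp add: v_def)
  define H where "H = conv F G"
  have H_int: "integrable lborel H" unfolding H_def by (rule integrable_conv[OF F_int G_int])
  then have [measurable]: "H \<in> borel_measurable borel" using borel_measurable_integrable by force
  let ?W = "\<lambda>\<zeta>. complex_of_real (w \<zeta>) * H \<zeta>"
  have "(\<integral>\<^sup>+\<zeta>. (ennreal (norm (?W \<zeta>)))\<^sup>2 \<partial>lborel)
      \<le> ennreal (C\<^sup>2) * ((\<integral>\<^sup>+\<xi>. (ennreal (v \<xi>))\<^sup>2 \<partial>lborel)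
      * (\<integral>\<^sup>+\<xi>. (ennreal (norm (?A \<xi>)))\<^sup>2 \<partial>lborel) * (\<integral>\<^sup>+\<xi>. (ennreal (norm (?B \<xi>)))\<^sup>2 \<partial>lborel))"
    using nn_integral_weighted_conv_le[OF s0, of ?A ?B]
    unfolding w_def H_def F_def G_def C_def v_def by simp
  also have "(\<integral>\<^sup>+\<xi>. (ennreal (v \<xi>))\<^sup>2 \<partial>lborel) = ennreal (\<kappa>\<^sup>2)"
    using nn_norm_abs_l2[OF v_sq] by (simp add: \<kappa>_def ennreal_power v_def)
  also have "(\<integral>\<^sup>+\<xi>. (ennreal (norm (?A \<xi>)))\<^sup>2 \<partial>lborel) = ennreal ((norm (fourier a))\<^sup>2)"
    using nn_norm_abs_l2[of ?A] by (simp add: ennreal_power)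
  also have "(\<integral>\<^sup>+\<xi>. (ennreal (norm (?B \<xi>)))\<^sup>2 \<partial>lborel) = ennreal ((norm (fourier b))\<^sup>2)"
    using nn_norm_abs_l2[of ?B] by (simp add: ennreal_power)
  also have "ennreal (C\<^sup>2) * (ennreal (\<kappa>\<^sup>2) * ennreal ((norm (fourier a))\<^sup>2) * ennreal ((norm (fourier b))\<^sup>2))
      = ennreal ((K * norm (fourier a) * norm (fourier b))\<^sup>2)"
    by (simp add: K_def power_mult_distrib ennreal_mult mult.assoc)
  finally have nn: "(\<integral>\<^sup>+\<zeta>. ennreal ((norm (?W \<zeta>))\<^sup>2) \<partial>lborel)
      \<le> ennreal ((K * norm (fourier a) * norm (fourier b))\<^sup>2)"
    by (simp add: ennreal_power)
  have W_sq: "square_integrable ?W"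
    by (rule square_integrable_nn) (use nn in \<open>auto intro: le_less_trans\<close>)
  have "(norm (abs_l2 ?W))\<^sup>2 \<le> (K * norm (fourier a) * norm (fourier b))\<^sup>2"
    using nn unfolding nn_norm_abs_l2[OF W_sq] by simp
  then have W_le: "norm (abs_l2 ?W) \<le> K * norm (fourier a) * norm (fourier b)"
    by (rule power2_le_imp_le) (simp add: \<open>0 \<le> K\<close>)
  have "cnj (H (- \<zeta>)) = H \<zeta>" for \<zeta>
    unfolding H_def
    by (rule conv_hermitian) (use herm[of a] herm[of b] in \<open>auto simp: F_def[abs_def] G_def[abs_def]\<close>)
  then have herm_W: "AE \<zeta> in lborel. cnj ((1 / (2 * pi)) *\<^sub>R ?W (- \<zeta>)) = (1 / (2 * pi)) *\<^sub>R ?W \<zeta>"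
    by (simp add: w_def)
  have W'_sq: "square_integrable (\<lambda>\<zeta>. (1 / (2 * pi)) *\<^sub>R ?W \<zeta>)"
    by (rule square_integrable_scaleR[OF W_sq])
  obtain c where c: "fourier c = abs_l2 (\<lambda>\<zeta>. (1 / (2 * pi)) *\<^sub>R ?W \<zeta>)"
    using exists_fourier_eq[OF W'_sq herm_W] by blast
  show "\<exists>c. norm c \<le> K * norm a * norm b \<and>
    (AE x in lborel. rep_l2 (bessel s c) x = rep_l2 (bessel s a) x * rep_l2 (bessel s b) x)"
  proof (intro exI conjI)
    have "norm c \<le> sqrt (2 * pi) * norm c"
      using mult_right_mono[of 1 "sqrt (2 * pi)" "norm c"] pi_ge_two by simp
    also have "\<dots> = (1 / (2 * pi)) * norm (abs_l2 ?W)"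
      unfolding norm_fourier[symmetric] c scaleR_abs_l2[OF W_sq, symmetric] by simp
    also have "\<dots> \<le> (1 / (2 * pi)) * (K * norm (fourier a) * norm (fourier b))"
      by (rule mult_left_mono[OF W_le]) simp
    also have "\<dots> = K * norm a * norm b"
      unfolding norm_fourier by (simp add: field_simps)
    finally show "norm c \<le> K * norm a * norm b" .
    have Fa: "AE \<xi> in lborel. rep_l2 (fourier (bessel s a)) \<xi> = F \<xi>"
      using rep_fourier_bessel[OF s0, of a] by eventually_elim (simp add: F_def v_def)
    have Gb: "AE \<xi> in lborel. rep_l2 (fourier (bessel s b)) \<xi> = G \<xi>"
      using rep_fourier_bessel[OF s0, of b] by eventually_elim (simp add: G_def v_def)
    have cancel: "complex_of_real (v \<xi>) * ((1 / (2 * pi)) *\<^sub>R ?W \<xi>) = (1 / (2 * pi)) *\<^sub>R H \<xi>" for \<xi>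
    proof -
      have "complex_of_real (v \<xi>) * ?W \<xi> = complex_of_real (v \<xi> * w \<xi>) * H \<xi>" by simp
      then show ?thesis unfolding wv by simp
    qed
    have Hc: "AE \<xi> in lborel. rep_l2 (fourier (bessel s c)) \<xi> = (1 / (2 * pi)) *\<^sub>R H \<xi>"
      using rep_fourier_bessel[OF s0, of c] rep_abs_l2[OF W'_sq] unfolding c
      by eventually_elim (simp only: cancel[unfolded v_def])
    have inversion: "AE x in lborel. complex_of_real (rep_l2 f x) = FT h (- x) / (2 * pi)"
      if ae: "AE \<xi> in lborel. rep_l2 (fourier f) \<xi> = h \<xi>" and h: "integrable lborel h" for f h
    proof -
      have [measurable]: "h \<in> borel_measurable borel"
        using borel_measurable_integrable[OF h] by simp
      have "integrable lborel (rep_l2 (fourier f)) \<longleftrightarrow> integrable lborel h"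
        by (rule integrable_cong_AE) (use ae in auto)
      with h have "integrable lborel (rep_l2 (fourier f))" by simp
      from fourier_inversion[OF this] FT_cong_AE[of "rep_l2 (fourier f)" h] ae
      show ?thesis by simp
    qed
    have "integrable lborel (\<lambda>\<xi>. (1 / (2 * pi)) *\<^sub>R H \<xi>)" using H_int by simp
    from inversion[OF Fa F_int] inversion[OF Gb G_int] inversion[OF Hc this]
    show "AE x in lborel. rep_l2 (bessel s c) x = rep_l2 (bessel s a) x * rep_l2 (bessel s b) x"
    proof eventually_elim
      case (elim x)
      have "complex_of_real (rep_l2 (bessel s c) x)
          = complex_of_real (rep_l2 (bessel s a) x * rep_l2 (bessel s b) x)"
        using elim unfolding FT_scaleR H_def FT_conv[OF F_int G_int]
        by (simp add: scaleR_conv_of_real)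
      then show ?case by (simp only: of_real_eq_iff)
    qed
  qed
qed

text \<open>
  The product of \<open>H\<^sup>s\<close> transported to \<open>L\<^sup>2\<close> by the Bessel potential.
\<close>

definition sobolev_mult :: "real \<Rightarrow> real l2 \<Rightarrow> real l2 \<Rightarrow> real l2" where
  "sobolev_mult s a b = (THE c. bessel s c = mult_l2 (bessel s a) (bessel s b))"

lemma sobolev_mult:
  assumes s: "s > 1 / 2"
  shows "AE x in lborel. rep_l2 (bessel s (sobolev_mult s a b)) x
      = rep_l2 (bessel s a) x * rep_l2 (bessel s b) x" (is ?ae)
    and "bessel s (sobolev_mult s a b) = mult_l2 (bessel s a) (bessel s b)" (is ?eq)
    and "bounded_bilinear (sobolev_mult s)" (is ?bil)
proof -
  have s0: "s \<ge> 0" using s by simp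
  interpret J: bounded_linear "bessel s" by (rule bounded_linear_bessel[OF s0])
  obtain K where K: "0 \<le> K" and ex: "\<And>a b. \<exists>c. norm c \<le> K * norm a * norm b \<and>
    (AE x in lborel. rep_l2 (bessel s c) x = rep_l2 (bessel s a) x * rep_l2 (bessel s b) x)"
    using bessel_product[OF s] by metis
  have eqI: "sobolev_mult s a b = c"
    if "AE x in lborel. rep_l2 (bessel s c) x = rep_l2 (bessel s a) x * rep_l2 (bessel s b) x" for a b c
  proof -
    have "bessel s c = mult_l2 (bessel s a) (bessel s b)"
      unfolding mult_l2_def using abs_l2_cong[OF square_integrable_rep[of "bessel s c"] _ that] by simp
    then show ?thesis
      unfolding sobolev_mult_def by (intro the_equality) (auto simp: bessel_inject[OF s0] dest: sym)
  qed
  have ae: "AE x in lborel. rep_l2 (bessel s (sobolev_mult s a b)) x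
      = rep_l2 (bessel s a) x * rep_l2 (bessel s b) x" for a b
    using ex[of a b] eqI by metis
  then show ?ae .
  show ?eq
    unfolding mult_l2_def using abs_l2_cong[OF square_integrable_rep _ ae[of a b]] by simp
  have add: "sobolev_mult s (a + a') b = sobolev_mult s a b + sobolev_mult s a' b" for a a' b
  proof (rule eqI)
    show "AE x in lborel. rep_l2 (bessel s (sobolev_mult s a b + sobolev_mult s a' b)) x
        = rep_l2 (bessel s (a + a')) x * rep_l2 (bessel s b) x"
      using ae[of a b] ae[of a' b] rep_plus_l2[of "bessel s a" "bessel s a'"]
        rep_plus_l2[of "bessel s (sobolev_mult s a b)" "bessel s (sobolev_mult s a' b)"]
      unfolding J.add by eventually_elim (simp add: algebra_simps)
  qed
  have scale: "sobolev_mult s (r *\<^sub>R a) b = r *\<^sub>R sobolev_mult s a b" for r a b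
  proof (rule eqI)
    show "AE x in lborel. rep_l2 (bessel s (r *\<^sub>R sobolev_mult s a b)) x
        = rep_l2 (bessel s (r *\<^sub>R a)) x * rep_l2 (bessel s b) x"
      using ae[of a b] rep_scaleR_l2[of r "bessel s a"]
        rep_scaleR_l2[of r "bessel s (sobolev_mult s a b)"]
      unfolding J.scale by eventually_elim simp
  qed
  have comm: "sobolev_mult s a b = sobolev_mult s b a" for a b
    by (rule eqI) (use ae[of b a] in \<open>auto elim!: eventually_mono\<close>)
  have le: "norm (sobolev_mult s a b) \<le> norm a * norm b * K" for a b
  proof -
    obtain c where c: "norm c \<le> K * norm a * norm b"
      "AE x in lborel. rep_l2 (bessel s c) x = rep_l2 (bessel s a) x * rep_l2 (bessel s b) x"
      using ex by blast
    from c(1) show ?thesis unfolding eqI[OF c(2)] by (simp add: ac_simps)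
  qed
  show ?bil
  proof
    fix a a' b b' :: "real l2" and r :: real
    show "sobolev_mult s (a + a') b = sobolev_mult s a b + sobolev_mult s a' b" by (rule add)
    show "sobolev_mult s a (b + b') = sobolev_mult s a b + sobolev_mult s a b'"
      using add[of b b' a] by (simp add: comm)
    show "sobolev_mult s (r *\<^sub>R a) b = r *\<^sub>R sobolev_mult s a b" by (rule scale)
    show "sobolev_mult s a (r *\<^sub>R b) = r *\<^sub>R sobolev_mult s a b"
      using scale[of r b a] by (simp add: comm)
    show "\<exists>K. \<forall>a b. norm (sobolev_mult s a b) \<le> norm a * norm b * K"
      using le by blast
  qed
qed

section \<open>Power series solutions of quadratic equations\<close>

text \<open>
  The sum over all ways of bracketing a word by the product \<open>Q\<close>, with \<open>L\<close> applied to each letter. On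
  \<open>k\<close> copies of \<open>h\<close> it is the term of order \<open>k\<close> in the formal solution of \<open>w = L h + Q w w\<close>. Words with
  distinct letters supply the corresponding multilinear map.
\<close>

fun bracketings :: "('e \<Rightarrow> 'z::comm_monoid_add) \<Rightarrow> ('z \<Rightarrow> 'z \<Rightarrow> 'z) \<Rightarrow> 'e list \<Rightarrow> 'z" where
  "bracketings L Q xs = (if length xs = 1 then L (hd xs)
     else (\<Sum>i\<in>{1..<length xs}. Q (bracketings L Q (take i xs)) (bracketings L Q (drop i xs))))"

declare bracketings.simps [simp del]

lemma bracketings_Nil [simp]: "bracketings L Q [] = 0"
  by (subst bracketings.simps) simp

lemma bracketings_single [simp]: "bracketings L Q [x] = L x"
  by (subst bracketings.simps) simp

lemma bracketings_split:
  "length xs \<noteq> 1 \<Longrightarrow> bracketings L Q xs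
    = (\<Sum>i\<in>{1..<length xs}. Q (bracketings L Q (take i xs)) (bracketings L Q (drop i xs)))"
  by (subst bracketings.simps) simp

lemma bracketings_replicate_split:
  assumes "k \<noteq> 1"
  shows "bracketings L Q (replicate k h)
    = (\<Sum>i\<in>{1..<k}. Q (bracketings L Q (replicate i h)) (bracketings L Q (replicate (k - i) h)))"
  using assms by (subst bracketings_split) (auto simp: min_def intro!: sum.cong)

lemma bracketings_replicate:
  assumes Q: "\<And>x. Q 0 x = 0" "\<And>x. Q x 0 = 0"
  shows "bracketings L Q (replicate k h) = (if k = 1 then L h else 0)
    + (\<Sum>i\<le>k. Q (bracketings L Q (replicate i h)) (bracketings L Q (replicate (k - i) h)))"
proof -
  let ?b = "\<lambda>i. bracketings L Q (replicate i h)"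
  have sum: "(\<Sum>i\<le>k. Q (?b i) (?b (k - i))) = (\<Sum>i\<in>{1..<k}. Q (?b i) (?b (k - i)))"
  proof (rule sum.mono_neutral_right)
    show "\<forall>i\<in>{..k} - {1..<k}. Q (?b i) (?b (k - i)) = 0"
    proof
      fix i assume "i \<in> {..k} - {1..<k}"
      then have "i = 0 \<or> i = k" by auto
      then show "Q (?b i) (?b (k - i)) = 0" by (auto simp: Q)
    qed
  qed auto
  show ?thesis
  proof (cases "k = 1")
    case True
    then show ?thesis unfolding sum by simp
  next
    case False
    then show ?thesis unfolding sum using bracketings_replicate_split[OF False, of L Q h] by simp
  qed
qed

text \<open>
  The coefficient of \<open>r\<^sup>k\<close> in the power series that solves the scalar equation \<open>w = l r + \<beta> w\<^sup>2\<close>,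
  that is, \<open>l\<^sup>k \<beta>\<^sup>k\<^sup>-\<^sup>1\<close> times a Catalan number for \<open>k \<ge> 1\<close>. It bounds the norms of the multilinear maps.
\<close>

abbreviation majorant :: "real \<Rightarrow> real \<Rightarrow> nat \<Rightarrow> real" where
  "majorant l \<beta> k \<equiv> bracketings (\<lambda>_::unit. l) (\<lambda>x y. \<beta> * x * y) (replicate k ())"

lemma majorant_nonneg:
  assumes "0 \<le> l" "0 \<le> \<beta>" shows "0 \<le> majorant l \<beta> k"
proof (induction k rule: less_induct)
  case (less k)
  show ?case
  proof (cases "k = 1")
    case False
    show ?thesis
      unfolding bracketings_replicate_split[OF False]
      by (intro sum_nonneg mult_nonneg_nonneg less assms) auto
  qed (use assms in simp)
qed

lemma norm_bracketings_le:
  fixes L :: "'e::real_normed_vector \<Rightarrow> 'z::real_normed_vector"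
  assumes L: "\<And>x. norm (L x) \<le> l * norm x" and Q: "\<And>x y. norm (Q x y) \<le> \<beta> * norm x * norm y"
    and l: "0 \<le> l" and \<beta>: "0 \<le> \<beta>"
  shows "norm (bracketings L Q xs) \<le> majorant l \<beta> (length xs) * prod_list (map norm xs)"
proof (induction xs rule: length_induct)
  case (1 xs)
  show ?case
  proof (cases "length xs = 1")
    case True
    then obtain x where "xs = [x]" by (cases xs) auto
    then show ?thesis using L[of x] by simp
  next
    case False
    let ?c = "majorant l \<beta>" and ?p = "\<lambda>xs. prod_list (map norm (xs :: 'e list))"
    have "norm (bracketings L Q xs)
        \<le> (\<Sum>i\<in>{1..<length xs}. norm (Q (bracketings L Q (take i xs)) (bracketings L Q (drop i xs))))"
      unfolding bracketings_split[OF False] by (rule norm_sum)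
    also have "\<dots> \<le> (\<Sum>i\<in>{1..<length xs}. \<beta> * ?c i * ?c (length xs - i) * ?p xs)"
    proof (rule sum_mono)
      fix i assume i: "i \<in> {1..<length xs}"
      have t: "norm (bracketings L Q (take i xs)) \<le> ?c i * ?p (take i xs)"
        using 1[rule_format, of "take i xs"] i by (simp add: min_def)
      have d: "norm (bracketings L Q (drop i xs)) \<le> ?c (length xs - i) * ?p (drop i xs)"
      proof -
        have "length (drop i xs) < length xs" using i by auto
        from 1[rule_format, OF this] show ?thesis by simp
      qed
      have p: "?p (take i xs) * ?p (drop i xs) = ?p xs"
        by (metis append_take_drop_id map_append prod_list.append)
      have "norm (Q (bracketings L Q (take i xs)) (bracketings L Q (drop i xs)))
          \<le> \<beta> * (norm (bracketings L Q (take i xs)) * norm (bracketings L Q (drop i xs)))"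
        using Q by (simp add: mult.assoc)
      also have "\<dots> \<le> \<beta> * ((?c i * ?p (take i xs)) * (?c (length xs - i) * ?p (drop i xs)))"
        by (intro mult_left_mono mult_mono t d \<beta> mult_nonneg_nonneg majorant_nonneg l prod_list_nonneg) auto
      also have "\<dots> = \<beta> * ?c i * ?c (length xs - i) * (?p (take i xs) * ?p (drop i xs))"
        by (simp only: ac_simps)
      finally show "norm (Q (bracketings L Q (take i xs)) (bracketings L Q (drop i xs)))
          \<le> \<beta> * ?c i * ?c (length xs - i) * ?p xs" unfolding p .
    qed
    also have "\<dots> = (\<Sum>i\<in>{1..<length xs}. \<beta> * ?c i * ?c (length xs - i)) * ?p xs"
      by (rule sum_distrib_right[symmetric])
    also have "(\<Sum>i\<in>{1..<length xs}. \<beta> * ?c i * ?c (length xs - i)) = ?c (length xs)"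
      by (rule bracketings_replicate_split[OF False, symmetric])
    finally show ?thesis .
  qed
qed

lemma bracketings_multilinear:
  assumes L: "linear L" and Q: "bounded_bilinear Q"
  shows "i < length xs \<Longrightarrow> bracketings L Q (xs[i := c *\<^sub>R y + d *\<^sub>R z])
    = c *\<^sub>R bracketings L Q (xs[i := y]) + d *\<^sub>R bracketings L Q (xs[i := z])"
proof (induction xs arbitrary: i rule: length_induct)
  case (1 xs)
  interpret Q: bounded_bilinear Q by (rule Q)
  let ?B = "bracketings L Q"
  show ?case
  proof (cases "length xs = 1")
    case True
    then obtain x where "xs = [x]" by (cases xs) auto
    then show ?thesis using 1(2) by (simp add: linear_add[OF L] linear_scale[OF L])
  next
    case False
    let ?t = "\<lambda>v j. Q (?B (take j (xs[i := v]))) (?B (drop j (xs[i := v])))"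
    have B: "?B (xs[i := v]) = (\<Sum>j\<in>{1..<length xs}. ?t v j)" for v
      using False by (subst bracketings_split) simp_all
    have "?t (c *\<^sub>R y + d *\<^sub>R z) j = c *\<^sub>R ?t y j + d *\<^sub>R ?t z j" if j: "j \<in> {1..<length xs}" for j
    proof (cases "i < j")
      case True
      have "?B ((take j xs)[i := c *\<^sub>R y + d *\<^sub>R z])
          = c *\<^sub>R ?B ((take j xs)[i := y]) + d *\<^sub>R ?B ((take j xs)[i := z])"
        using 1(1)[rule_format, of "take j xs" i] j True by simp
      then show ?thesis
        using True by (simp add: take_update_swap Q.add_left Q.scaleR_left)
    next
      case False
      have "?B ((drop j xs)[i - j := c *\<^sub>R y + d *\<^sub>R z])
          = c *\<^sub>R ?B ((drop j xs)[i - j := y]) + d *\<^sub>R ?B ((drop j xs)[i - j := z])"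
        using 1(1)[rule_format, of "drop j xs" "i - j"] j False 1(2) by simp
      then show ?thesis
        using False by (simp add: drop_update_swap Q.add_right Q.scaleR_right)
    qed
    then show ?thesis
      unfolding B by (simp add: sum.distrib scaleR_right.sum)
  qed
qed

lemma sum_Cauchy_product_diff:
  fixes f :: "nat \<Rightarrow> nat \<Rightarrow> 'a::ab_group_add"
  shows "(\<Sum>i<N. \<Sum>j<N. f i j) - (\<Sum>k<N. \<Sum>i\<le>k. f i (k - i))
    = (\<Sum>(i, j)\<in>{(i, j). i < N \<and> j < N \<and> N \<le> i + j}. f i j)"
proof -
  have fin: "finite ({..<N} \<times> {..<N})" by simp
  have "(\<Sum>i<N. \<Sum>j<N. f i j) = (\<Sum>(i, j)\<in>{..<N} \<times> {..<N}. f i j)"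
    by (rule sum.cartesian_product)
  also have "{..<N} \<times> {..<N} = {(i, j). i < N \<and> j < N \<and> N \<le> i + j} \<union> {(i, j). i + j < N}"
    by auto
  also have "(\<Sum>(i, j)\<in>\<dots>. f i j) = (\<Sum>(i, j)\<in>{(i, j). i < N \<and> j < N \<and> N \<le> i + j}. f i j)
      + (\<Sum>(i, j)\<in>{(i, j). i + j < N}. f i j)"
    by (rule sum.union_disjoint) (auto intro: finite_subset[OF _ fin])
  also have "(\<Sum>(i, j)\<in>{(i, j). i + j < N}. f i j) = (\<Sum>k<N. \<Sum>i\<le>k. f i (k - i))"
    by (rule sum.triangle_reindex)
  finally show ?thesis by simp
qed

text \<open>
  The difference between the product of partial sums and the partial sum of the product runs over the
  index pairs in the upper triangle. Its norm is dominated by the same difference for the scalar series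
  of norms, to which the theorem on Cauchy products applies.
\<close>

lemma Cauchy_product_bilinear_LIMSEQ:
  fixes a :: "nat \<Rightarrow> 'z::banach"
  assumes Q: "bounded_bilinear Q" and a: "summable (\<lambda>k. norm (a k))"
  shows "(\<lambda>N. \<Sum>k<N. \<Sum>i\<le>k. Q (a i) (a (k - i))) \<longlonglongrightarrow> Q (\<Sum>k. a k) (\<Sum>k. a k)"
proof -
  interpret Q: bounded_bilinear Q by (rule Q)
  obtain K where K: "0 \<le> K" "\<And>x y. norm (Q x y) \<le> norm x * norm y * K" using Q.nonneg_bounded by blast
  let ?n = "\<lambda>k. norm (a k)"
  let ?s = "\<lambda>N. \<Sum>k<N. a k"
  let ?D = "\<lambda>N. {(i, j). i < N \<and> j < N \<and> N \<le> i + j}"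
  have "a sums (\<Sum>k. a k)" using summable_norm_cancel[OF a] by (rule summable_sums)
  then have "?s \<longlonglongrightarrow> (\<Sum>k. a k)" by (simp add: sums_def)
  then have lim: "(\<lambda>N. Q (?s N) (?s N)) \<longlonglongrightarrow> Q (\<Sum>k. a k) (\<Sum>k. a k)"
    by (intro Q.tendsto)
  have l1: "(\<lambda>N. (\<Sum>k<N. ?n k) * (\<Sum>k<N. ?n k)) \<longlonglongrightarrow> (\<Sum>k. ?n k) * (\<Sum>k. ?n k)"
    by (intro tendsto_mult summable_LIMSEQ a)
  have l2: "(\<lambda>N. \<Sum>k<N. \<Sum>i\<le>k. ?n i * ?n (k - i)) \<longlonglongrightarrow> (\<Sum>k. ?n k) * (\<Sum>k. ?n k)"
    using Cauchy_product_sums[of ?n ?n] a by (simp add: sums_def)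
  have "(\<lambda>N. ((\<Sum>k<N. ?n k) * (\<Sum>k<N. ?n k) - (\<Sum>k<N. \<Sum>i\<le>k. ?n i * ?n (k - i))) * K)
      \<longlonglongrightarrow> ((\<Sum>k. ?n k) * (\<Sum>k. ?n k) - (\<Sum>k. ?n k) * (\<Sum>k. ?n k)) * K"
    by (intro tendsto_mult tendsto_diff l1 l2 tendsto_const)
  then have zero: "(\<lambda>N. (\<Sum>(i, j)\<in>?D N. ?n i * ?n j) * K) \<longlonglongrightarrow> 0"
    by (simp add: sum_product sum_Cauchy_product_diff[of "\<lambda>i j. ?n i * ?n j"])
  have "(\<lambda>N. Q (?s N) (?s N) - (\<Sum>k<N. \<Sum>i\<le>k. Q (a i) (a (k - i)))) \<longlonglongrightarrow> 0"
  proof (rule Lim_null_comparison[OF always_eventually[OF allI] zero])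
    fix N
    have "Q (?s N) (?s N) = (\<Sum>i<N. \<Sum>j<N. Q (a i) (a j))"
      unfolding Q.sum_left Q.sum_right by (rule sum.swap)
    then have "Q (?s N) (?s N) - (\<Sum>k<N. \<Sum>i\<le>k. Q (a i) (a (k - i))) = (\<Sum>(i, j)\<in>?D N. Q (a i) (a j))"
      by (simp add: sum_Cauchy_product_diff[of "\<lambda>i j. Q (a i) (a j)"])
    also have "norm \<dots> \<le> (\<Sum>(i, j)\<in>?D N. ?n i * ?n j * K)"
      by (rule sum_norm_le) (auto simp: K)
    also have "\<dots> = (\<Sum>(i, j)\<in>?D N. ?n i * ?n j) * K"
      by (simp add: sum_distrib_right case_prod_unfold)
    finally show "norm (Q (?s N) (?s N) - (\<Sum>k<N. \<Sum>i\<le>k. Q (a i) (a (k - i))))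
        \<le> (\<Sum>(i, j)\<in>?D N. ?n i * ?n j) * K" .
  qed
  from tendsto_diff[OF lim this] show ?thesis by simp
qed

text \<open>
  The partial sums satisfy \<open>S\<^sub>N\<^sub>+\<^sub>1 \<le> l r + \<beta> S\<^sub>N\<^sup>2\<close>, and under the smallness condition the interval
  \<open>[0, 2 l r]\<close> is invariant under this recursion.
\<close>

lemma majorant_summable:
  assumes l: "0 \<le> l" and \<beta>: "0 \<le> \<beta>" and r: "0 \<le> r" and small: "4 * \<beta> * l * r \<le> 1"
  shows "summable (\<lambda>k. majorant l \<beta> k * r ^ k)"
proof (rule summableI_nonneg_bounded)
  let ?a = "\<lambda>k. majorant l \<beta> k * r ^ k"
  have a0: "?a 0 = 0" by simp
  have nn: "0 \<le> ?a k" for k by (intro mult_nonneg_nonneg majorant_nonneg l \<beta>) (use r in auto)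
  have rec: "?a k = (if k = 1 then l * r else 0) + \<beta> * (\<Sum>i\<le>k. ?a i * ?a (k - i))" for k
  proof -
    have "?a k = ((if k = 1 then l else 0) + (\<Sum>i\<le>k. \<beta> * majorant l \<beta> i * majorant l \<beta> (k - i))) * r ^ k"
      by (subst bracketings_replicate) auto
    also have "\<dots> = (if k = 1 then l * r else 0) + (\<Sum>i\<le>k. \<beta> * majorant l \<beta> i * majorant l \<beta> (k - i) * r ^ k)"
      by (simp add: distrib_right sum_distrib_right)
    also have "(\<Sum>i\<le>k. \<beta> * majorant l \<beta> i * majorant l \<beta> (k - i) * r ^ k) = \<beta> * (\<Sum>i\<le>k. ?a i * ?a (k - i))"
      unfolding sum_distrib_left
    proof (rule sum.cong[OF refl])
      fix i assume "i \<in> {..k}"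
      then have "r ^ k = r ^ i * r ^ (k - i)" by (simp flip: power_add)
      then show "\<beta> * majorant l \<beta> i * majorant l \<beta> (k - i) * r ^ k = \<beta> * (?a i * ?a (k - i))"
        by (simp only: ac_simps)
    qed
    finally show ?thesis .
  qed
  have step: "(\<Sum>k<Suc N. ?a k) \<le> l * r + \<beta> * (\<Sum>k<N. ?a k)\<^sup>2" for N
  proof -
    have "(\<Sum>k<Suc N. ?a k) = (\<Sum>k<Suc N. if k = 1 then l * r else 0) + \<beta> * (\<Sum>k<Suc N. \<Sum>i\<le>k. ?a i * ?a (k - i))"
      by (subst rec) (simp only: sum.distrib sum_distrib_left)
    also have "(\<Sum>k<Suc N. if k = 1 then l * r else 0) \<le> l * r"
      using l r by (simp add: sum.delta)
    also have "(\<Sum>k<Suc N. \<Sum>i\<le>k. ?a i * ?a (k - i)) = (\<Sum>(i, j)\<in>{(i, j). i + j < Suc N}. ?a i * ?a j)"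
      by (rule sum.triangle_reindex[symmetric])
    also have "\<dots> = (\<Sum>(i, j)\<in>{(i, j). i + j < Suc N \<and> 0 < i \<and> 0 < j}. ?a i * ?a j)"
    proof (rule sum.mono_neutral_right)
      show "finite {(i, j). i + j < Suc N}"
        by (rule finite_subset[of _ "{..N} \<times> {..N}"]) auto
    qed (auto intro!: gr0I)
    also have "\<dots> \<le> (\<Sum>(i, j)\<in>{..<N} \<times> {..<N}. ?a i * ?a j)"
      by (rule sum_mono2) (auto intro!: mult_nonneg_nonneg nn simp del: mult_eq_0_iff)
    also have "\<dots> = (\<Sum>k<N. ?a k)\<^sup>2"
      by (simp only: power2_eq_square sum_product sum.cartesian_product)
    finally show ?thesis using \<beta> by (simp add: mult_left_mono)
  qed
  have bound: "(\<Sum>k<N. ?a k) \<le> 2 * (l * r)" for N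
  proof (induction N)
    case (Suc N)
    have "0 \<le> (\<Sum>k<N. ?a k)" by (intro sum_nonneg nn)
    then have "(\<Sum>k<N. ?a k)\<^sup>2 \<le> (2 * (l * r))\<^sup>2" using Suc by (intro power_mono)
    then have "\<beta> * (\<Sum>k<N. ?a k)\<^sup>2 \<le> \<beta> * (2 * (l * r))\<^sup>2" using \<beta> by (intro mult_left_mono)
    also have "\<dots> = (4 * \<beta> * l * r) * (l * r)" by (simp add: power2_eq_square)
    also have "\<dots> \<le> 1 * (l * r)" by (intro mult_right_mono small mult_nonneg_nonneg l r)
    finally show ?case using step[of N] by simp
  qed (use l r in simp)
  show "0 \<le> ?a k" for k by (rule nn)
  show "(\<Sum>k<N. ?a k) \<le> 2 * (l * r)" for N by (rule bound)
qed

lemma bracketings_series_fixpoint: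
  fixes L :: "'e::real_normed_vector \<Rightarrow> 'z::banach"
  assumes bil: "bounded_bilinear Q" and L: "\<And>x. norm (L x) \<le> l * norm x"
    and Q: "\<And>x y. norm (Q x y) \<le> \<beta> * norm x * norm y" and l: "0 \<le> l" and \<beta>: "0 \<le> \<beta>"
    and small: "4 * \<beta> * l * norm h \<le> 1"
  obtains w where "(\<lambda>k. bracketings L Q (replicate k h)) sums w" "w = L h + Q w w"
proof -
  interpret Q: bounded_bilinear Q by (rule bil)
  let ?b = "\<lambda>k. bracketings L Q (replicate k h)"
  have le: "norm (?b k) \<le> majorant l \<beta> k * norm h ^ k" for k
    using norm_bracketings_le[of L l Q \<beta> "replicate k h", OF L Q l \<beta>] by simp
  have summable: "summable (\<lambda>k. norm (?b k))"
  proof (rule summable_comparison_test'[OF majorant_summable[OF l \<beta> norm_ge_zero small], where N = 0])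
    fix k
    show "norm (norm (?b k)) \<le> majorant l \<beta> k * norm h ^ k"
      using le[of k] by (simp only: real_norm_def abs_norm_cancel)
  qed
  then have sums: "?b sums (\<Sum>k. ?b k)" by (rule summable_sums[OF summable_norm_cancel])
  have rec: "(\<Sum>k<N. ?b k) = (\<Sum>k<N. if k = 1 then L h else 0) + (\<Sum>k<N. \<Sum>i\<le>k. Q (?b i) (?b (k - i)))" for N
    by (subst bracketings_replicate) (simp_all only: Q.zero_left Q.zero_right sum.distrib)
  have "eventually (\<lambda>N. (\<Sum>k<N. if k = 1 then L h else 0) = L h) sequentially"
    using eventually_ge_at_top[of 2] by eventually_elim (simp add: sum.delta)
  then have "(\<lambda>N. \<Sum>k<N. if k = 1 then L h else 0) \<longlonglongrightarrow> L h" by (rule tendsto_eventually)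
  then have "(\<lambda>N. \<Sum>k<N. ?b k) \<longlonglongrightarrow> L h + Q (\<Sum>k. ?b k) (\<Sum>k. ?b k)"
    unfolding rec by (intro tendsto_add Cauchy_product_bilinear_LIMSEQ[OF bil summable])
  then have "(\<Sum>k. ?b k) = L h + Q (\<Sum>k. ?b k) (\<Sum>k. ?b k)"
    using sums unfolding sums_def by (rule LIMSEQ_unique[rotated])
  with sums show ?thesis by (rule that)
qed

text \<open>
  Bracketings depend on the order of the letters, while a power series asks for symmetric maps.
  Averaging over permutations leaves the values on the diagonal unchanged.
\<close>

definition symmetrize :: "('e list \<Rightarrow> 'z::real_vector) \<Rightarrow> 'e list \<Rightarrow> 'z" where
  "symmetrize B xs = (1 / fact (length xs)) *\<^sub>R
     (\<Sum>p | p permutes {..<length xs}. B (permute_list p xs))"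

lemma symmetrize_replicate: "symmetrize B (replicate k h) = B (replicate k h)"
proof -
  have "permute_list p (replicate k h) = replicate k h" if "p permutes {..<k}" for p
  proof (rule replicate_eqI)
    fix y assume "y \<in> set (permute_list p (replicate k h))"
    then show "y = h" using that by auto
  qed simp
  then have "(\<Sum>p | p permutes {..<k}. B (permute_list p (replicate k h))) = fact k *\<^sub>R B (replicate k h)"
    by (simp add: card_permutations[of "{..<k}" k] scaleR_conv_of_real sum_constant_scaleR)
  then show ?thesis by (simp add: symmetrize_def)
qed

lemma symmetrize_permute:
  assumes "mset ys = mset xs" shows "symmetrize B ys = symmetrize B xs"
proof -
  obtain q where q: "q permutes {..<length xs}" "permute_list q xs = ys"
    by (rule mset_eq_permutation[OF assms])
  have "(\<Sum>p | p permutes {..<length xs}. B (permute_list p xs))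
      = (\<Sum>p | p permutes {..<length xs}. B (permute_list (q \<circ> p) xs))"
    by (rule setum_permutations_compose_left[OF q(1)])
  also have "\<dots> = (\<Sum>p | p permutes {..<length xs}. B (permute_list p ys))"
    by (rule sum.cong[OF refl]) (simp add: permute_list_compose q(2))
  finally show ?thesis
    using mset_eq_length[OF assms] by (simp add: symmetrize_def)
qed

lemma permute_list_update:
  assumes p: "p permutes {..<length xs}" and i: "i < length xs"
  shows "permute_list p (xs[i := y]) = (permute_list p xs)[inv p i := y]"
proof (rule nth_equalityI)
  fix j assume "j < length (permute_list p (xs[i := y]))"
  then have j: "j < length xs" by simp
  have "p j < length xs" using permutes_in_image[OF p] j by auto
  moreover have "p j = i \<longleftrightarrow> j = inv p i" using permutes_inverses[OF p] by metis
  ultimately show "permute_list p (xs[i := y]) ! j = (permute_list p xs)[inv p i := y] ! j"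
    using p j by (auto simp: permute_list_nth nth_list_update)
qed simp

lemma symmetrize_multilinear:
  assumes B: "\<And>xs i y z c d. i < length xs \<Longrightarrow>
      B (xs[i := c *\<^sub>R y + d *\<^sub>R z]) = c *\<^sub>R B (xs[i := y]) + d *\<^sub>R B (xs[i := z])"
    and i: "i < length xs"
  shows "symmetrize B (xs[i := c *\<^sub>R y + d *\<^sub>R z])
    = c *\<^sub>R symmetrize B (xs[i := y]) + d *\<^sub>R symmetrize B (xs[i := z])"
proof -
  have "B (permute_list p (xs[i := c *\<^sub>R y + d *\<^sub>R z]))
      = c *\<^sub>R B (permute_list p (xs[i := y])) + d *\<^sub>R B (permute_list p (xs[i := z]))"
    if p: "p permutes {..<length xs}" for p
  proof -
    have "inv p i < length (permute_list p xs)"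
      using permutes_in_image[OF permutes_inv[OF p]] i by auto
    from B[OF this] show ?thesis by (simp add: permute_list_update[OF p i])
  qed
  then show ?thesis
    by (simp add: symmetrize_def sum.distrib scaleR_right.sum[symmetric] scaleR_add_right mult.commute)
qed

lemma norm_symmetrize_le:
  fixes B :: "'e::real_normed_vector list \<Rightarrow> 'z::real_normed_vector"
  assumes B: "\<And>xs. length xs = k \<Longrightarrow> norm (B xs) \<le> M * prod_list (map norm xs)" and k: "length xs = k"
  shows "norm (symmetrize B xs) \<le> M * prod_list (map norm xs)"
proof -
  have "norm (B (permute_list p xs)) \<le> M * prod_list (map norm xs)" if p: "p permutes {..<k}" for p
  proof -
    have "prod_list (map norm (permute_list p xs)) = prod_list (map norm xs)"
      using p k by (metis mset_permute_list mset_map prod_mset_prod_list)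
    with B[of "permute_list p xs"] k show ?thesis by simp
  qed
  then have "norm (\<Sum>p | p permutes {..<k}. B (permute_list p xs)) \<le> fact k * (M * prod_list (map norm xs))"
    using sum_norm_bound[of "{p. p permutes {..<k}}" "\<lambda>p. B (permute_list p xs)" "M * prod_list (map norm xs)"]
    by (simp add: card_permutations[of "{..<k}" k])
  then show ?thesis by (simp add: symmetrize_def k field_simps)
qed

lemma half_contraction_resolvent:
  fixes P :: "'z::banach \<Rightarrow> 'z"
  assumes P: "linear P" and half: "\<And>z. norm (P z) \<le> (1 / 2) * norm z"
  obtains R where "linear R" "\<And>z. R z = P (R z) + z" "\<And>z. norm (R z) \<le> 2 * norm z"
proof -
  have "\<exists>!w. P w + z = w" for z
  proof (rule banach_fix_type[of "1 / 2"])
    show "\<forall>x y. dist (P x + z) (P y + z) \<le> 1 / 2 * dist x y"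
      using half by (simp add: dist_norm flip: linear_diff[OF P])
  qed auto
  then obtain R where R: "\<And>z. P (R z) + z = R z" and unique: "\<And>z w. P w + z = w \<Longrightarrow> w = R z"
    by metis
  show ?thesis
  proof (rule that)
    show "linear R"
    proof
      fix x y and c :: real
      have "P (R x + R y) + (x + y) = (P (R x) + x) + (P (R y) + y)" by (simp add: linear_add[OF P])
      then show "R (x + y) = R x + R y" using unique[of "R x + R y" "x + y"] by (simp only: R)
      have "P (c *\<^sub>R R x) + c *\<^sub>R x = c *\<^sub>R (P (R x) + x)" by (simp add: linear_scale[OF P] scaleR_add_right)
      then show "R (c *\<^sub>R x) = c *\<^sub>R R x" using unique[of "c *\<^sub>R R x" "c *\<^sub>R x"] by (simp only: R)
    qed
    show "R z = P (R z) + z" for z by (simp only: R)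
    show "norm (R z) \<le> 2 * norm z" for z
    proof -
      have "norm (R z) \<le> norm (P (R z)) + norm z" using norm_triangle_ineq[of "P (R z)" z] by (simp only: R)
      with half[of "R z"] show ?thesis by simp
    qed
  qed
qed

text \<open>
  With \<open>R\<close> the inverse of \<open>1 - 2 Q (g a)\<close>, the increment of the solution at \<open>a\<close> solves a quadratic
  equation of the same form whose solution at \<open>h = 0\<close> is zero. Its expansion in bracketings is then the power
  series of \<open>g\<close> at \<open>a\<close>. Uniqueness identifies the sum of the series with the increment of \<open>g\<close>.
\<close>

lemma quadratic_solution_real_analytic:
  fixes L :: "'e::real_normed_vector \<Rightarrow> 'z::banach"
  assumes L: "bounded_linear L" and Q: "bounded_bilinear Q" and sym: "\<And>x y. Q x y = Q y x"
    and U: "open U" and sol: "\<And>a. a \<in> U \<Longrightarrow> g a = L a + Q (g a) (g a)"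
    and unique: "\<And>a z. a \<in> U \<Longrightarrow> z = L a + Q z z \<Longrightarrow> z = g a"
    and half: "\<And>a z. a \<in> U \<Longrightarrow> norm (2 *\<^sub>R Q (g a) z) \<le> (1 / 2) * norm z"
  shows "real_analytic_map UNIV norm UNIV norm U g"
  unfolding real_analytic_map_def
proof (intro conjI ballI)
  interpret L: bounded_linear L by (rule L)
  interpret Q: bounded_bilinear Q by (rule Q)
  fix a assume a: "a \<in> U"
  have "linear (\<lambda>z. 2 *\<^sub>R Q (g a) z)"
    by (rule linearI) (simp_all add: Q.add_right Q.scaleR_right scaleR_add_right)
  from half_contraction_resolvent[OF this half[OF a]]
  obtain R where R: "linear R" "\<And>z. R z = 2 *\<^sub>R Q (g a) (R z) + z" "\<And>z. norm (R z) \<le> 2 * norm z"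
    by blast
  obtain K where K: "0 \<le> K" "\<And>x. norm (L x) \<le> norm x * K" using L.nonneg_bounded by blast
  obtain K' where K': "0 \<le> K'" "\<And>x y. norm (Q x y) \<le> norm x * norm y * K'" using Q.nonneg_bounded by blast
  define L' where "L' x = R (L x)" for x
  define Q' where "Q' x y = R (Q x y)" for x y
  define l where "l = 2 * K"
  define \<beta> where "\<beta> = 2 * K'"
  have l: "0 \<le> l" and \<beta>: "0 \<le> \<beta>" using K K' by (simp_all add: l_def \<beta>_def)
  have L': "norm (L' x) \<le> l * norm x" for x
    using R(3)[of "L x"] K(2)[of x] by (simp add: L'_def l_def algebra_simps)
  have Q': "norm (Q' x y) \<le> \<beta> * norm x * norm y" for x y
    using R(3)[of "Q x y"] K'(2)[of x y] by (simp add: Q'_def \<beta>_def algebra_simps)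
  have lin: "linear L'"
    unfolding L'_def by (rule linearI) (simp_all add: L.add L.scale linear_add[OF R(1)] linear_scale[OF R(1)])
  have bil: "bounded_bilinear Q'"
  proof
    show "\<exists>K. \<forall>a b. norm (Q' a b) \<le> norm a * norm b * K"
      using Q' by (intro exI[of _ \<beta>]) (simp add: ac_simps)
  qed (simp_all add: Q'_def Q.add_left Q.add_right Q.scaleR_left Q.scaleR_right
      linear_add[OF R(1)] linear_scale[OF R(1)])
  let ?b = "bracketings L' Q'"
  obtain r1 where r1: "0 < r1" "ball a r1 \<subseteq> U" using U a open_contains_ball by blast
  \<comment> \<open>The second bound on \<open>r\<close> is the smallness condition of \<open>majorant_summable\<close>; adding one keeps the
    denominator positive when \<open>\<beta> l = 0\<close>.\<close>
  define r where "r = min r1 (1 / (4 * \<beta> * l + 1))"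
  have r: "0 < r" using r1 l \<beta> by (simp add: r_def add_nonneg_pos)
  have "4 * \<beta> * l * r \<le> 4 * \<beta> * l * (1 / (4 * \<beta> * l + 1))"
    using l \<beta> by (intro mult_left_mono) (auto simp: r_def)
  also have "\<dots> \<le> 1" using l \<beta> by (simp add: divide_le_eq_1 add_nonneg_pos)
  finally have small: "4 * \<beta> * l * r \<le> 1" .
  define A where "A k xs = (if k = 0 then g a else symmetrize ?b xs)" for k :: nat and xs
  define M where "M k = (if k = 0 then norm (g a) else majorant l \<beta> k)" for k
  have M0: "0 \<le> M k" for k using majorant_nonneg[OF l \<beta>] by (simp add: M_def)
  show "\<exists>r>0. \<exists>A M. (\<forall>k. multilinear_on UNIV UNIV k (A k) \<and> symmetric_on UNIV k (A k)) \<and>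
      (\<forall>k xs. length xs = k \<and> set xs \<subseteq> UNIV \<longrightarrow> norm (A k xs) \<le> M k * prod_list (map norm xs)) \<and>
      (\<forall>k. 0 \<le> M k) \<and> summable (\<lambda>k. M k * r ^ k) \<and>
      (\<forall>h\<in>UNIV. norm h < r \<longrightarrow> a + h \<in> U \<and>
        (\<lambda>N. norm (g (a + h) - (\<Sum>k<N. A k (replicate k h)))) \<longlonglongrightarrow> 0)"
  proof (intro exI[of _ r] conjI exI[of _ A] exI[of _ M] allI ballI impI r M0)
    fix k
    show "multilinear_on UNIV UNIV k (A k)"
      using symmetrize_multilinear[of ?b, OF bracketings_multilinear[OF lin bil]]
      by (auto simp: multilinear_on_def A_def)
    show "symmetric_on UNIV k (A k)"
      using symmetrize_permute by (auto simp: symmetric_on_def A_def)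
    fix xs :: "'e list" assume "length xs = k \<and> set xs \<subseteq> UNIV"
    then have k: "length xs = k" by simp
    have "norm (?b ys) \<le> majorant l \<beta> k * prod_list (map norm ys)" if "length ys = k" for ys
      using norm_bracketings_le[of L' l Q' \<beta> ys, OF L' Q' l \<beta>] that by simp
    from norm_symmetrize_le[of k ?b, OF this k]
    show "norm (A k xs) \<le> M k * prod_list (map norm xs)"
      using k by (auto simp: A_def M_def)
  next
    have "summable (\<lambda>k. M (Suc k) * r ^ Suc k)"
      using majorant_summable[OF l \<beta> less_imp_le[OF r] small]
      by (subst (asm) summable_Suc_iff[symmetric]) (simp add: M_def)
    then show "summable (\<lambda>k. M k * r ^ k)" by (subst summable_Suc_iff[symmetric])
  next
    fix h :: 'e assume h: "norm h < r"
    then have "a + h \<in> ball a r1" by (simp add: r_def dist_norm)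
    then show ah: "a + h \<in> U" using r1 by blast
    have "4 * \<beta> * l * norm h \<le> 4 * \<beta> * l * r"
      using h l \<beta> by (intro mult_left_mono) auto
    with small have "4 * \<beta> * l * norm h \<le> 1" by linarith
    from bracketings_series_fixpoint[OF bil L' Q' l \<beta> this]
    obtain w where w: "(\<lambda>k. ?b (replicate k h)) sums w" "w = L' h + Q' w w" by blast
    have "w = R (L h + Q w w)" using w(2) by (simp add: L'_def Q'_def linear_add[OF R(1)])
    with R(2)[of "L h + Q w w"] have w3: "w = 2 *\<^sub>R Q (g a) w + (L h + Q w w)" by metis
    have "g a + w = L (a + h) + Q (g a + w) (g a + w)"
    proof -
      have "L (a + h) + Q (g a + w) (g a + w)
          = (L a + Q (g a) (g a)) + (2 *\<^sub>R Q (g a) w + (L h + Q w w))"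
        by (simp add: L.add Q.add_left Q.add_right sym[of w "g a"] scaleR_2)
      then show ?thesis using sol[OF a] w3 by simp
    qed
    from unique[OF ah this] have g: "g (a + h) = g a + w" by simp
    have "(\<Sum>k<N. A k (replicate k h)) = (if N = 0 then 0 else g a) + (\<Sum>k<N. ?b (replicate k h))" for N
      by (induction N) (auto simp: A_def symmetrize_replicate)
    moreover have "(\<lambda>N. if N = 0 then 0 else g a) \<longlonglongrightarrow> g a"
      by (rule tendsto_eventually, rule eventually_mono[OF eventually_gt_at_top[of 0]]) simp
    ultimately have "(\<lambda>N. \<Sum>k<N. A k (replicate k h)) \<longlonglongrightarrow> g (a + h)"
      using w(1) unfolding g sums_def by (auto intro: tendsto_add)
    then have "(\<lambda>N. g (a + h) - (\<Sum>k<N. A k (replicate k h))) \<longlonglongrightarrow> g (a + h) - g (a + h)"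
      by (intro tendsto_intros)
    then show "(\<lambda>N. norm (g (a + h) - (\<Sum>k<N. A k (replicate k h)))) \<longlonglongrightarrow> 0"
      by (simp add: tendsto_norm_zero)
  qed
qed auto

text \<open>
  Power series are carried over by a scaled linear isometry onto the source carrier and a bounded
  linear map into the target carrier. This leads from Banach spaces that are types to the carriers
  \<open>X_space\<close> and \<open>XT_space\<close>.
\<close>

lemma real_analytic_map_transfer:
  fixes J :: "'y::real_normed_vector \<Rightarrow> 'a::real_vector" and \<rho> :: "'z::real_normed_vector \<Rightarrow> 'b::real_vector"
  assumes g: "real_analytic_map UNIV norm UNIV norm V g"
    and J: "linear J" "inj J" "\<And>y. nE (J y) = \<kappa> * norm y" and \<kappa>: "0 < \<kappa>"
    and \<rho>: "linear \<rho>" "\<And>z. \<rho> z \<in> F" "\<And>z. 0 \<le> nF (\<rho> z)" "\<And>z. nF (\<rho> z) \<le> c * norm z"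
    and f: "\<And>y. y \<in> V \<Longrightarrow> f (J y) = \<rho> (g y)"
  shows "real_analytic_map (range J) nE F nF (J ` V) f"
  unfolding real_analytic_map_def
proof (intro conjI ballI)
  fix a assume "a \<in> J ` V"
  then obtain a' where a': "a' \<in> V" "a = J a'" by auto
  from bspec[OF g[unfolded real_analytic_map_def, THEN conjunct2, THEN conjunct2] a'(1)]
  obtain r A M where r: "0 < r"
    and symmetric: "\<forall>k. multilinear_on UNIV UNIV k (A k) \<and> symmetric_on UNIV k (A k)"
    and norm_A: "\<forall>k xs. length xs = k \<and> set xs \<subseteq> UNIV \<longrightarrow> norm (A k xs) \<le> M k * prod_list (map norm xs)"
    and M: "\<forall>k. 0 \<le> M k" "summable (\<lambda>k. M k * r ^ k)"
    and expansion: "\<forall>h\<in>UNIV. norm h < r \<longrightarrow> a' + h \<in> V \<and>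
      (\<lambda>N. norm (g (a' + h) - (\<Sum>k<N. A k (replicate k h)))) \<longlonglongrightarrow> 0"
    by (elim exE conjE) (erule that)
  have mult: "multilinear_on UNIV UNIV k (A k)" and sym: "symmetric_on UNIV k (A k)" for k
    using symmetric by blast+
  have bound: "norm (A k xs) \<le> M k * prod_list (map norm xs)" if "length xs = k" for k xs
    using that by (intro norm_A[rule_format]) simp
  \<comment> \<open>The constant \<open>c\<close> may be negative when the source of \<open>\<rho>\<close> is trivial.\<close>
  define c' where "c' = max c 0"
  have \<rho>': "nF (\<rho> z) \<le> c' * norm z" for z
    using \<rho>(4)[of z] mult_right_mono[of c c' "norm z"] by (simp add: c'_def)
  have c': "0 \<le> c'" by (simp add: c'_def)
  have inv: "inv J (J y) = y" for y using J(2) by simp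
  let ?A = "\<lambda>k xs. \<rho> (A k (map (inv J) xs))" and ?M = "\<lambda>k. c' * M k / \<kappa> ^ k"
  have invJ: "\<exists>ys. xs = map J ys" if "set xs \<subseteq> range J" for xs
    using that by (metis ex_map_conv subsetD rangeE)
  have comb: "inv J (c *\<^sub>R J y + d *\<^sub>R J z) = c *\<^sub>R y + d *\<^sub>R z" for c d y z
    using inv[of "c *\<^sub>R y + d *\<^sub>R z"] by (simp add: linear_add[OF J(1)] linear_scale[OF J(1)])
  have map_inv: "map (inv J) (map J ys) = ys" for ys by (simp add: o_def inv)
  show "\<exists>r>0. \<exists>A M. (\<forall>k. multilinear_on (range J) F k (A k) \<and> symmetric_on (range J) k (A k)) \<and>
      (\<forall>k xs. length xs = k \<and> set xs \<subseteq> range J \<longrightarrow> nF (A k xs) \<le> M k * prod_list (map nE xs)) \<and>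
      (\<forall>k. 0 \<le> M k) \<and> summable (\<lambda>k. M k * r ^ k) \<and>
      (\<forall>h\<in>range J. nE h < r \<longrightarrow> a + h \<in> J ` V \<and>
        (\<lambda>N. nF (f (a + h) - (\<Sum>k<N. A k (replicate k h)))) \<longlonglongrightarrow> 0)"
  proof (intro exI[of _ "\<kappa> * r"] conjI exI[of _ ?A] exI[of _ ?M] allI ballI impI)
    fix k
    show "0 < \<kappa> * r" using r \<kappa> by simp
    show "multilinear_on (range J) F k (?A k)"
      unfolding multilinear_on_def
    proof (intro allI impI conjI ballI)
      fix xs i y z and c d :: real
      assume xs: "length xs = k \<and> set xs \<subseteq> range J" and i: "i < k" and y: "y \<in> range J" "z \<in> range J"
      from y obtain y' z' where y': "y = J y'" "z = J z'" by auto
      have "A k ((map (inv J) xs)[i := c *\<^sub>R y' + d *\<^sub>R z'])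
          = c *\<^sub>R A k ((map (inv J) xs)[i := y']) + d *\<^sub>R A k ((map (inv J) xs)[i := z'])"
        using mult[of k] xs i unfolding multilinear_on_def by simp
      then show "?A k (xs[i := c *\<^sub>R y + d *\<^sub>R z]) = c *\<^sub>R ?A k (xs[i := y]) + d *\<^sub>R ?A k (xs[i := z])"
        by (simp add: y' map_update comb inv linear_add[OF \<rho>(1)] linear_scale[OF \<rho>(1)])
    qed (rule \<rho>(2))
    show "symmetric_on (range J) k (?A k)"
      unfolding symmetric_on_def
    proof (intro allI impI)
      fix xs ys assume "length xs = k \<and> set xs \<subseteq> range J \<and> mset ys = mset xs"
      then have "A k (map (inv J) ys) = A k (map (inv J) xs)"
        using sym[of k] unfolding symmetric_on_def by (simp add: mset_map)
      then show "?A k ys = ?A k xs" by simp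
    qed
    show "0 \<le> ?M k" using c' M \<kappa> by simp
    fix xs :: "'a list" assume xs: "length xs = k \<and> set xs \<subseteq> range J"
    then obtain ys where ys: "xs = map J ys" "length ys = k" using invJ by fastforce
    have prod: "prod_list (map nE (map J ys)) = \<kappa> ^ length ys * prod_list (map norm ys)" for ys
      by (induction ys) (simp_all add: J(3))
    have "nF (?A k xs) \<le> c' * (M k * prod_list (map norm ys))"
      unfolding ys(1) map_inv using \<rho>'[of "A k ys"] mult_left_mono[OF bound[OF ys(2)] c'] by linarith
    also have "\<dots> = ?M k * prod_list (map nE xs)"
      unfolding ys(1) prod ys(2) using \<kappa> by simp
    finally show "nF (?A k xs) \<le> ?M k * prod_list (map nE xs)" .
  next
    have "summable (\<lambda>k. c' * (M k * r ^ k))" by (rule summable_mult[OF M(2)])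
    moreover have "?M k * (\<kappa> * r) ^ k = c' * (M k * r ^ k)" for k
      using \<kappa> by (simp add: power_mult_distrib)
    ultimately show "summable (\<lambda>k. ?M k * (\<kappa> * r) ^ k)" by simp
  next
    fix h assume "h \<in> range J" and h: "nE h < \<kappa> * r"
    then obtain h' where h': "h = J h'" by auto
    then have "norm h' < r" using h J(3) \<kappa> by simp
    with expansion have V: "a' + h' \<in> V"
      and lim': "(\<lambda>N. norm (g (a' + h') - (\<Sum>k<N. A k (replicate k h')))) \<longlonglongrightarrow> 0" by auto
    have ah: "a + h = J (a' + h')" by (simp add: a' h' linear_add[OF J(1)])
    then show "a + h \<in> J ` V" using V by auto
    have eq: "f (a + h) - (\<Sum>k<N. ?A k (replicate k h)) = \<rho> (g (a' + h') - (\<Sum>k<N. A k (replicate k h')))" for N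
      unfolding ah f[OF V] by (simp add: linear_diff[OF \<rho>(1)] linear_sum[OF \<rho>(1)] h' inv)
    have "(\<lambda>N. c' * norm (g (a' + h') - (\<Sum>k<N. A k (replicate k h')))) \<longlonglongrightarrow> c' * 0"
      by (intro tendsto_intros lim')
    then show "(\<lambda>N. nF (f (a + h) - (\<Sum>k<N. ?A k (replicate k h)))) \<longlonglongrightarrow> 0"
      unfolding eq
      by (intro tendsto_sandwich[OF always_eventually[OF allI[OF \<rho>(3)]] always_eventually[OF allI[OF \<rho>']]])
        auto
  qed
qed (use f \<rho>(2) in auto)

section \<open>The integral equation in a Banach space\<close>

instance bcontfun :: (metric_space, banach) banach ..

text \<open>
  The equation \<open>z(t) = S(t) y - \<integral>\<^sub>0\<^sup>t S(t - \<tau>) N(z(\<tau>), z(\<tau>)) d\<tau>\<close> on \<open>[0, T]\<close>, for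
  strongly continuous contractions with \<open>S(t + t') = S(t) S(t')\<close> and a bounded bilinear map \<open>N\<close>.
\<close>

locale mild_equation =
  fixes S :: "real \<Rightarrow> 'y::banach \<Rightarrow> 'y" and N :: "'y \<Rightarrow> 'y \<Rightarrow> 'y" and T B :: real
  assumes linear_S: "linear (S t)" and norm_S: "norm (S t y) \<le> norm y"
    and continuous_S: "continuous_on UNIV (\<lambda>t. S t y)" and S_add: "S (t + t') y = S t (S t' y)"
    and bilinear_N: "bounded_bilinear N" and N_le: "norm (N x y) \<le> B * norm x * norm y"
    and B: "0 \<le> B" and T: "0 \<le> T"
begin

sublocale N: bounded_bilinear N by (rule bilinear_N)

text \<open>
  Paths on \<open>[0, T]\<close> are represented by bounded continuous functions on the line. Both terms of the
  equation are composed with \<open>clip\<close>, so solutions are constant outside the interval.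
\<close>

definition clip :: "real \<Rightarrow> real" where "clip t = max 0 (min T t)"

lemma clip: "0 \<le> clip t" "clip t \<le> T" and clip_id: "t \<in> {0..T} \<Longrightarrow> clip t = t"
  using T by (auto simp: clip_def)

lemma continuous_clip: "continuous_on UNIV clip"
  unfolding clip_def by (intro continuous_intros)

lemma bounded_linear_S: "bounded_linear (S t)"
  using linear_S[of t] norm_S[of t] by (intro bounded_linear.intro bounded_linear_axioms.intro exI[of _ 1]) auto

lemma continuous_on_S:
  assumes \<phi>: "continuous_on A \<phi>" and u: "continuous_on A u"
  shows "continuous_on A (\<lambda>t::real. S (\<phi> t) (u t))"
  unfolding continuous_on_def
proof
  fix t assume t: "t \<in> A"
  have "((\<lambda>t'. norm (u t' - u t)) \<longlongrightarrow> 0) (at t within A)"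
    using u t by (simp add: continuous_on_def tendsto_norm_zero_iff LIM_zero_iff)
  moreover have "((\<lambda>t'. S (\<phi> t') (u t)) \<longlongrightarrow> S (\<phi> t) (u t)) (at t within A)"
    using continuous_on_compose2[OF continuous_S[of "u t"] \<phi>] t by (auto simp: continuous_on_def)
  then have "((\<lambda>t'. norm (S (\<phi> t') (u t) - S (\<phi> t) (u t))) \<longlongrightarrow> 0) (at t within A)"
    by (simp add: tendsto_norm_zero_iff LIM_zero_iff)
  ultimately have lim: "((\<lambda>t'. norm (u t' - u t) + norm (S (\<phi> t') (u t) - S (\<phi> t) (u t))) \<longlongrightarrow> 0) (at t within A)"
    using tendsto_add by fastforce
  have "((\<lambda>t'. S (\<phi> t') (u t') - S (\<phi> t) (u t)) \<longlongrightarrow> 0) (at t within A)"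
  proof (rule Lim_null_comparison[OF always_eventually[OF allI] lim])
    fix t'
    have eq: "S (\<phi> t') (u t') - S (\<phi> t) (u t) = S (\<phi> t') (u t' - u t) + (S (\<phi> t') (u t) - S (\<phi> t) (u t))"
      by (simp add: linear_diff[OF linear_S])
    show "norm (S (\<phi> t') (u t') - S (\<phi> t) (u t))
        \<le> norm (u t' - u t) + norm (S (\<phi> t') (u t) - S (\<phi> t) (u t))"
      unfolding eq using norm_triangle_ineq[of "S (\<phi> t') (u t' - u t)" "S (\<phi> t') (u t) - S (\<phi> t) (u t)"]
        norm_S[of "\<phi> t'" "u t' - u t"] by linarith
  qed
  then show "((\<lambda>t'. S (\<phi> t') (u t')) \<longlongrightarrow> S (\<phi> t) (u t)) (at t within A)"
    by (simp add: LIM_zero_iff)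
qed

definition duhamel_integral :: "(real \<Rightarrow> 'y) \<Rightarrow> real \<Rightarrow> 'y" where
  "duhamel_integral f t = integral {0..t} (\<lambda>\<tau>. S (t - \<tau>) (f \<tau>))"

lemma integrable_duhamel:
  assumes f: "continuous_on UNIV f" shows "(\<lambda>\<tau>. S (t - \<tau>) (f \<tau>)) integrable_on {a..b}"
  by (intro integrable_continuous_real continuous_on_S continuous_intros continuous_on_subset[OF f]) auto

text \<open>
  The group law takes the dependence on \<open>t\<close> out of the integrand. Continuity in \<open>t\<close> then reduces to
  the continuity of an indefinite integral.
\<close>

lemma duhamel_integral_group:
  assumes f: "continuous_on UNIV f"
  shows "duhamel_integral f t = S t (integral {0..t} (\<lambda>\<tau>. S (- \<tau>) (f \<tau>)))"
proof -
  have "(\<lambda>\<tau>. S (- \<tau>) (f \<tau>)) integrable_on {0..t}"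
    using integrable_duhamel[OF f, of 0] by simp
  from integral_linear[OF this bounded_linear_S[of t]] show ?thesis
    by (simp add: duhamel_integral_def o_def flip: S_add)
qed

lemma continuous_duhamel_integral:
  assumes f: "continuous_on UNIV f" shows "continuous_on UNIV (\<lambda>t. duhamel_integral f (clip t))"
proof -
  have "(\<lambda>\<tau>. S (- \<tau>) (f \<tau>)) integrable_on {0..T}"
    using integrable_duhamel[OF f, of 0] by simp
  from indefinite_integral_continuous_1[OF this]
  have "continuous_on UNIV (\<lambda>t. integral {0..clip t} (\<lambda>\<tau>. S (- \<tau>) (f \<tau>)))"
    by (rule continuous_on_compose2[OF _ continuous_clip]) (use clip in auto)
  then show ?thesis
    unfolding duhamel_integral_group[OF f] by (intro continuous_on_S continuous_clip)
qed

lemma norm_duhamel_integral_le: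
  assumes f: "continuous_on UNIV f" and t: "0 \<le> t"
    and g: "g integrable_on {0..t}" and le: "\<And>\<tau>. \<tau> \<in> {0..t} \<Longrightarrow> norm (f \<tau>) \<le> g \<tau>"
  shows "norm (duhamel_integral f t) \<le> integral {0..t} g"
  unfolding duhamel_integral_def
  by (rule integral_norm_bound_integral[OF integrable_duhamel[OF f] g])
    (rule order_trans[OF norm_S le])

lemma norm_duhamel_integral_le_const:
  assumes f: "continuous_on UNIV f" and le: "\<And>\<tau>. norm (f \<tau>) \<le> c"
  shows "norm (duhamel_integral f (clip t)) \<le> T * c"
proof -
  have "norm (duhamel_integral f (clip t)) \<le> integral {0..clip t} (\<lambda>_. c)"
    by (rule norm_duhamel_integral_le[OF f clip(1)]) (auto simp: le)
  also have "\<dots> = clip t * c" using clip by simp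
  also have "\<dots> \<le> T * c"
    using clip(2) order_trans[OF norm_ge_zero le] by (intro mult_right_mono)
  finally show ?thesis .
qed

lemma continuous_N:
  "continuous_on UNIV (\<lambda>\<tau>. N (apply_bcontfun u \<tau>) (apply_bcontfun v \<tau>))"
  by (intro N.continuous_on continuous_on_apply_bcontfun)

lemma N_bcontfun_le: "norm (N (apply_bcontfun u \<tau>) (apply_bcontfun v \<tau>)) \<le> B * norm u * norm v"
proof -
  have "norm (N (apply_bcontfun u \<tau>) (apply_bcontfun v \<tau>))
      \<le> B * norm (apply_bcontfun u \<tau>) * norm (apply_bcontfun v \<tau>)" by (rule N_le)
  also have "\<dots> \<le> B * norm u * norm v"
    by (intro mult_mono norm_bounded mult_nonneg_nonneg B) auto
  finally show ?thesis .
qed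

definition free :: "'y \<Rightarrow> real \<Rightarrow>\<^sub>C 'y" where
  "free y = Bcontfun (\<lambda>t. S (clip t) y)"

definition interaction :: "(real \<Rightarrow>\<^sub>C 'y) \<Rightarrow> (real \<Rightarrow>\<^sub>C 'y) \<Rightarrow> real \<Rightarrow>\<^sub>C 'y" where
  "interaction u v = Bcontfun (\<lambda>t. - duhamel_integral (\<lambda>\<tau>. N (apply_bcontfun u \<tau>) (apply_bcontfun v \<tau>)) (clip t))"

lemma apply_free: "apply_bcontfun (free y) t = S (clip t) y"
proof -
  have "(\<lambda>t. S (clip t) y) \<in> bcontfun"
    by (rule bcontfun_normI[of _ "norm y"])
      (auto intro!: continuous_on_S continuous_clip norm_S)
  then show ?thesis by (simp add: free_def Bcontfun_inverse)
qed

lemma apply_interaction: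
  "apply_bcontfun (interaction u v) t
    = - duhamel_integral (\<lambda>\<tau>. N (apply_bcontfun u \<tau>) (apply_bcontfun v \<tau>)) (clip t)"
proof -
  have "(\<lambda>t. - duhamel_integral (\<lambda>\<tau>. N (apply_bcontfun u \<tau>) (apply_bcontfun v \<tau>)) (clip t)) \<in> bcontfun"
  proof (rule bcontfun_normI)
    show "continuous_on UNIV (\<lambda>t. - duhamel_integral (\<lambda>\<tau>. N (apply_bcontfun u \<tau>) (apply_bcontfun v \<tau>)) (clip t))"
      by (intro continuous_intros continuous_duhamel_integral continuous_N)
    show "norm (- duhamel_integral (\<lambda>\<tau>. N (apply_bcontfun u \<tau>) (apply_bcontfun v \<tau>)) (clip t))
        \<le> T * (B * norm u * norm v)" for t
      unfolding norm_minus_cancel by (rule norm_duhamel_integral_le_const[OF continuous_N N_bcontfun_le])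
  qed
  then show ?thesis by (simp add: interaction_def Bcontfun_inverse)
qed

lemma norm_interaction_le: "norm (interaction u v) \<le> T * B * norm u * norm v"
proof (rule norm_bound)
  show "norm (apply_bcontfun (interaction u v) t) \<le> T * B * norm u * norm v" for t
    using norm_duhamel_integral_le_const[OF continuous_N N_bcontfun_le, of u v t]
    by (simp add: apply_interaction mult.assoc)
qed

lemma bounded_linear_free: "bounded_linear free"
proof (rule bounded_linear_intro[of _ 1])
  show "free (x + y) = free x + free y" for x y
    by (rule bcontfun_eqI) (simp add: apply_free linear_add[OF linear_S])
  show "free (r *\<^sub>R x) = r *\<^sub>R free x" for r x
    by (rule bcontfun_eqI) (simp add: apply_free linear_scale[OF linear_S])
  show "norm (free x) \<le> norm x * 1" for x
    by (rule norm_bound) (simp add: apply_free norm_S)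
qed

lemma norm_free_le: "norm (free y) \<le> norm y"
  by (rule norm_bound) (simp add: apply_free norm_S)

lemma duhamel_integral_add:
  assumes "continuous_on UNIV f" "continuous_on UNIV g"
  shows "duhamel_integral (\<lambda>\<tau>. f \<tau> + g \<tau>) t = duhamel_integral f t + duhamel_integral g t"
  unfolding duhamel_integral_def linear_add[OF linear_S]
  by (rule Henstock_Kurzweil_Integration.integral_add) (intro integrable_duhamel assms)+

lemma duhamel_integral_scaleR: "duhamel_integral (\<lambda>\<tau>. c *\<^sub>R f \<tau>) t = c *\<^sub>R duhamel_integral f t"
  unfolding duhamel_integral_def linear_scale[OF linear_S] by (rule integral_cmul)

lemma bounded_bilinear_interaction: "bounded_bilinear interaction"
proof
  fix u u' v v' :: "real \<Rightarrow>\<^sub>C 'y" and r :: real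
  show "interaction (u + u') v = interaction u v + interaction u' v"
    by (rule bcontfun_eqI)
      (simp add: apply_interaction N.add_left duhamel_integral_add[OF continuous_N continuous_N])
  show "interaction u (v + v') = interaction u v + interaction u v'"
    by (rule bcontfun_eqI)
      (simp add: apply_interaction N.add_right duhamel_integral_add[OF continuous_N continuous_N])
  show "interaction (r *\<^sub>R u) v = r *\<^sub>R interaction u v"
    by (rule bcontfun_eqI) (simp add: apply_interaction N.scaleR_left duhamel_integral_scaleR)
  show "interaction u (r *\<^sub>R v) = r *\<^sub>R interaction u v"
    by (rule bcontfun_eqI) (simp add: apply_interaction N.scaleR_right duhamel_integral_scaleR)
  show "\<exists>K. \<forall>u v. norm (interaction u v) \<le> norm u * norm v * K"
    using norm_interaction_le by (intro exI[of _ "T * B"]) (simp add: ac_simps)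
qed

text \<open>
  Banach's fixed point theorem in the ball of radius \<open>2 \<parallel>y\<parallel>\<close>, where \<open>4 B T \<parallel>y\<parallel>\<close> is a Lipschitz
  constant.
\<close>

lemma mild_solution_exists:
  assumes small: "4 * B * T * norm y < 1"
  obtains z where "z = free y + interaction z z" "norm z \<le> 2 * norm y"
proof -
  interpret I: bounded_bilinear interaction by (rule bounded_bilinear_interaction)
  let ?F = "\<lambda>z. free y + interaction z z"
  have "\<exists>!z\<in>cball 0 (2 * norm y). ?F z = z"
  proof (rule Banach_fix[of _ "4 * B * T * norm y"])
    show "Topological_Spaces.complete (cball 0 (2 * norm y) :: (real \<Rightarrow>\<^sub>C 'y) set)"
      by (simp add: complete_eq_closed)
    show "cball 0 (2 * norm y) \<noteq> ({} :: (real \<Rightarrow>\<^sub>C 'y) set)" by simp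
    show "0 \<le> 4 * B * T * norm y" using B T by simp
    show "4 * B * T * norm y < 1" by (rule small)
    show "?F ` cball 0 (2 * norm y) \<subseteq> cball 0 (2 * norm y)"
    proof (rule image_subsetI)
      fix z :: "real \<Rightarrow>\<^sub>C 'y" assume "z \<in> cball 0 (2 * norm y)"
      then have z: "norm z \<le> 2 * norm y" by simp
      have "norm (interaction z z) \<le> T * B * norm z * norm z" by (rule norm_interaction_le)
      also have "\<dots> \<le> T * B * (2 * norm y) * (2 * norm y)"
        by (intro mult_mono z mult_nonneg_nonneg B T) auto
      also have "\<dots> = (4 * B * T * norm y) * norm y" by simp
      also have "\<dots> \<le> 1 * norm y" by (intro mult_right_mono less_imp_le[OF small]) simp
      finally show "?F z \<in> cball 0 (2 * norm y)"
        using norm_triangle_ineq[of "free y" "interaction z z"] norm_free_le[of y] by simp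
    qed
    fix z z' :: "real \<Rightarrow>\<^sub>C 'y"
    assume "z \<in> cball 0 (2 * norm y)" "z' \<in> cball 0 (2 * norm y)"
    then have z: "norm z \<le> 2 * norm y" "norm z' \<le> 2 * norm y" by simp_all
    have "?F z - ?F z' = interaction (z - z') z + interaction z' (z - z')"
      by (simp add: I.diff_left I.diff_right)
    also have "norm \<dots> \<le> T * B * norm (z - z') * norm z + T * B * norm z' * norm (z - z')"
      by (intro norm_triangle_mono norm_interaction_le)
    also have "\<dots> \<le> T * B * norm (z - z') * (2 * norm y) + T * B * (2 * norm y) * norm (z - z')"
      by (intro add_mono mult_left_mono mult_right_mono z mult_nonneg_nonneg B T) auto
    also have "\<dots> = 4 * B * T * norm y * dist z z'" by (simp add: dist_norm)
    finally show "dist (?F z) (?F z') \<le> 4 * B * T * norm y * dist z z'" by (simp add: dist_norm)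
  qed
  then obtain z where z: "z \<in> cball 0 (2 * norm y)" "?F z = z" by blast
  from z(1) have "norm z \<le> 2 * norm y" by simp
  with z(2)[symmetric] show ?thesis by (rule that)
qed

text \<open>
  Gronwall's argument: the difference \<open>d\<close> of two solutions satisfies \<open>\<parallel>d(t)\<parallel> \<le> K \<integral>\<^sub>0\<^sup>t \<parallel>d\<parallel>\<close>, and
  iteration bounds it by the terms of the exponential series. The two solutions may be of any size.
\<close>

lemma mild_solution_unique:
  assumes z: "z = free y + interaction z z" and z': "z' = free y + interaction z' z'"
  shows "z = z'"
proof -
  interpret I: bounded_bilinear interaction by (rule bounded_bilinear_interaction)
  define d where "d = z - z'"
  define K where "K = B * (norm z + norm z')"
  define D where "D = norm d"
  have K: "0 \<le> K" using B by (simp add: K_def)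
  have D: "0 \<le> D" by (simp add: D_def)
  have "d = interaction d z + interaction z' d"
    using z z' by (simp add: d_def I.diff_left I.diff_right) (metis add_diff_cancel_left)
  then have eq: "apply_bcontfun d t = - duhamel_integral
      (\<lambda>\<tau>. N (apply_bcontfun d \<tau>) (apply_bcontfun z \<tau>) + N (apply_bcontfun z' \<tau>) (apply_bcontfun d \<tau>)) (clip t)" for t
    unfolding duhamel_integral_add[OF continuous_N continuous_N]
    by (metis (no_types, lifting) apply_interaction minus_add_distrib plus_bcontfun.rep_eq)
  have step: "norm (N (apply_bcontfun d \<tau>) (apply_bcontfun z \<tau>) + N (apply_bcontfun z' \<tau>) (apply_bcontfun d \<tau>))
      \<le> K * norm (apply_bcontfun d \<tau>)" for \<tau>
  proof -
    have "norm (N (apply_bcontfun d \<tau>) (apply_bcontfun z \<tau>) + N (apply_bcontfun z' \<tau>) (apply_bcontfun d \<tau>))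
        \<le> B * norm (apply_bcontfun d \<tau>) * norm (apply_bcontfun z \<tau>)
          + B * norm (apply_bcontfun z' \<tau>) * norm (apply_bcontfun d \<tau>)"
      by (intro norm_triangle_mono N_le)
    also have "\<dots> \<le> B * norm (apply_bcontfun d \<tau>) * norm z + B * norm z' * norm (apply_bcontfun d \<tau>)"
      by (intro add_mono mult_left_mono mult_right_mono norm_bounded mult_nonneg_nonneg B) auto
    finally show ?thesis by (simp add: K_def algebra_simps)
  qed
  have cont: "continuous_on UNIV
      (\<lambda>\<tau>. N (apply_bcontfun d \<tau>) (apply_bcontfun z \<tau>) + N (apply_bcontfun z' \<tau>) (apply_bcontfun d \<tau>))"
    by (intro continuous_on_add continuous_N)
  have bound: "norm (apply_bcontfun d t) \<le> D * (K * t) ^ n / fact n" if "t \<in> {0..T}" for n t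
    using that
  proof (induction n arbitrary: t)
    case 0
    then show ?case by (simp add: D_def norm_bounded)
  next
    case (Suc n)
    let ?G = "\<lambda>\<tau>. D * (K * \<tau>) ^ Suc n / fact (Suc n)" and ?g = "\<lambda>\<tau>. K * (D * (K * \<tau>) ^ n / fact n)"
    have I: "(?g has_integral ?G t - ?G 0) {0..t}"
    proof (rule fundamental_theorem_of_calculus)
      fix \<tau> assume "\<tau> \<in> {0..t}"
      have "((\<lambda>\<tau>. (K * \<tau>) ^ Suc n) has_real_derivative (1 + real n) * (K * (K * \<tau>) ^ n)) (at \<tau> within {0..t})"
        by (rule DERIV_power_Suc) (rule DERIV_cmult_Id)
      then have "(?G has_real_derivative D * ((1 + real n) * (K * (K * \<tau>) ^ n)) / fact (Suc n)) (at \<tau> within {0..t})"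
        by (intro DERIV_cdivide DERIV_cmult)
      moreover have "D * ((1 + real n) * (K * (K * \<tau>) ^ n)) / fact (Suc n) = ?g \<tau>"
      proof -
        have "fact (Suc n) = (1 + real n) * fact n" by simp
        moreover have "1 + real n \<noteq> 0" by linarith
        ultimately show ?thesis by (simp only:) (simp add: ac_simps)
      qed
      ultimately show "(?G has_vector_derivative ?g \<tau>) (at \<tau> within {0..t})"
        by (simp only: has_real_derivative_iff_has_vector_derivative)
    qed (use Suc in auto)
    have g1: "?g integrable_on {0..t}" using I by (rule has_integral_integrable)
    have "?G 0 = 0" by simp
    then have g2: "integral {0..t} ?g = ?G t"
      using integral_unique[OF I] by (simp only: diff_zero)
    have "norm (apply_bcontfun d t) \<le> integral {0..t} ?g"
      unfolding eq[of t] norm_minus_cancel clip_id[OF Suc.prems]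
    proof (rule norm_duhamel_integral_le[OF cont _ g1])
      fix \<tau> assume \<tau>: "\<tau> \<in> {0..t}"
      then have "norm (apply_bcontfun d \<tau>) \<le> D * (K * \<tau>) ^ n / fact n"
        using Suc.prems by (intro Suc.IH) auto
      from order_trans[OF step[of \<tau>] mult_left_mono[OF this K]]
      show "norm (N (apply_bcontfun d \<tau>) (apply_bcontfun z \<tau>) + N (apply_bcontfun z' \<tau>) (apply_bcontfun d \<tau>)) \<le> ?g \<tau>" .
    qed (use Suc.prems in simp)
    then show ?case unfolding g2 .
  qed
  have zero: "apply_bcontfun d t = 0" if t: "t \<in> {0..T}" for t
  proof -
    have "(\<lambda>n. inverse (fact n) * (K * t) ^ n) \<longlonglongrightarrow> 0"
      by (rule summable_LIMSEQ_zero[OF summable_exp])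
    then have "(\<lambda>n. D * (inverse (fact n) * (K * t) ^ n)) \<longlonglongrightarrow> D * 0"
      by (intro tendsto_intros)
    then have "(\<lambda>n. D * (K * t) ^ n / fact n) \<longlonglongrightarrow> 0"
      by (simp add: field_simps)
    from LIMSEQ_le_const[OF this, of "norm (apply_bcontfun d t)"] bound[OF t]
    show ?thesis by auto
  qed
  have "apply_bcontfun d t = apply_bcontfun d (clip t)" for t
    unfolding eq[of t] eq[of "clip t"] using clip[of t] by (simp add: clip_id)
  then have "apply_bcontfun d t = 0" for t using zero[of "clip t"] clip[of t] by simp
  then have "d = 0" by (intro bcontfun_eqI) simp
  then show ?thesis by (simp add: d_def)
qed

end

section \<open>The linear group and the nonlinearity\<close>

lemma fourier_mult_compose:
  assumes m: "symbol m" and m': "symbol m'" and mm': "symbol (\<lambda>\<xi>. m \<xi> * m' \<xi>)"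
  shows "fourier_mult m (fourier_mult m' f) = fourier_mult (\<lambda>\<xi>. m \<xi> * m' \<xi>) f"
proof (rule fourier_eqI)
  show "AE \<xi> in lborel. rep_l2 (fourier (fourier_mult m (fourier_mult m' f))) \<xi>
      = rep_l2 (fourier (fourier_mult (\<lambda>\<xi>. m \<xi> * m' \<xi>) f)) \<xi>"
    using rep_fourier_mult[OF m, of "fourier_mult m' f"] rep_fourier_mult[OF m', of f]
      rep_fourier_mult[OF mm', of f]
    by eventually_elim simp
qed

text \<open>
  Each component of the group is a translation, expressed as a Fourier multiplier.
\<close>

definition translation :: "real \<Rightarrow> real l2 \<Rightarrow> real l2" where
  "translation t = fourier_mult (\<lambda>\<xi>. cis (t * \<xi>))"

lemma bounded_linear_translation: "bounded_linear (translation t)"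
  unfolding translation_def by (intro bounded_linear_fourier_mult symbol_cis)

lemma norm_translation_le: "norm (translation t f) \<le> norm f"
  unfolding translation_def by (intro norm_fourier_mult_le symbol_cis)

lemma translation_add: "translation (t + t') f = translation t (translation t' f)"
proof -
  have "(\<lambda>\<xi>. cis (t * \<xi>) * cis (t' * \<xi>)) = (\<lambda>\<xi>. cis ((t + t') * \<xi>))"
    by (simp add: cis_mult distrib_right)
  then show ?thesis
    unfolding translation_def using symbol_cis by (subst fourier_mult_compose) auto
qed

lemma continuous_translation: "continuous_on UNIV (\<lambda>t. translation t f)"
  unfolding continuous_on_sequentially translation_def o_def
  by (intro ballI allI impI tendsto_fourier_mult symbol_cis tendsto_intros) auto

lemma translation_bessel: "s \<ge> 0 \<Longrightarrow> translation t (bessel s f) = bessel s (translation t f)"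
  unfolding translation_def bessel_def by (intro fourier_mult_commute symbol_cis symbol_bessel)

lemma evol_eq:
  "evol t = rot \<circ> map_prod (translation (- t)) (translation t) \<circ> rot"
  by (simp add: evol_def translation_def map_prod_def)

lemma linear_rot: "linear rot"
  by (rule linearI) (auto simp: rot_def algebra_simps)

lemma rot_rot: "rot (rot w) = w"
proof (cases w)
  case (Pair a b)
  have "rot (rot (a, b)) = ((1 / 2) *\<^sub>R (a + b + (a - b)), (1 / 2) *\<^sub>R (a + b - (a - b)))"
    by (simp add: rot_def flip: scaleR_add_right scaleR_diff_right)
  also have "\<dots> = (a, b)" by (simp flip: scaleR_2)
  finally show ?thesis by (simp add: Pair)
qed

lemma norm_rot: "norm (rot w) = norm w"
proof (cases w)
  case (Pair a b)
  have "(norm (rot (a, b)))\<^sup>2 = (norm (a, b))\<^sup>2"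
    by (simp add: rot_def power2_norm_eq_inner inner_add_left inner_add_right inner_diff_left
        inner_diff_right inner_commute field_simps)
  then show ?thesis by (simp add: Pair)
qed

lemma bounded_linear_rot: "bounded_linear rot"
  by (rule bounded_linear_intro[of _ 1]) (simp_all add: linear_add[OF linear_rot] linear_scale[OF linear_rot] norm_rot)

lemma norm_map_prod_le:
  assumes "\<And>x. norm (f x) \<le> norm x" "\<And>x. norm (g x) \<le> norm x"
  shows "norm (map_prod f g w) \<le> norm w"
  using assms by (cases w) (auto simp: norm_Pair intro!: add_mono power_mono)

lemma linear_map_prod: "linear f \<Longrightarrow> linear g \<Longrightarrow> linear (map_prod f g)"
  by (rule linearI) (auto simp: linear_add linear_scale)

lemma linear_evol: "linear (evol t)"
  unfolding evol_eq
  by (intro linear_compose linear_rot linear_map_prod bounded_linear.linear bounded_linear_translation)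

lemma norm_evol_le: "norm (evol t w) \<le> norm w"
  using norm_map_prod_le[of "translation (- t)" "translation t" "rot w", OF norm_translation_le norm_translation_le]
  by (simp add: evol_eq norm_rot)

lemma evol_add: "evol (t + t') w = evol t (evol t' w)"
proof -
  have "map_prod (translation (- (t + t'))) (translation (t + t')) u
      = map_prod (translation (- t)) (translation t) (map_prod (translation (- t')) (translation t') u)" for u
    using translation_add[of "- t" "- t'"] translation_add[of t t'] by (cases u) simp
  then show ?thesis by (simp add: evol_eq rot_rot)
qed

lemma continuous_evol: "continuous_on UNIV (\<lambda>t. evol t w)"
proof -
  have "continuous_on UNIV (\<lambda>t. map_prod (translation (- t)) (translation t) (rot w))"
    by (cases "rot w")
      (auto intro!: continuous_on_Pair continuous_translation
        continuous_on_compose2[OF continuous_translation] continuous_intros)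
  then show ?thesis
    unfolding evol_eq o_def by (rule bounded_linear.continuous_on[OF bounded_linear_rot])
qed

definition state_bessel :: "real \<Rightarrow> state \<Rightarrow> state" where
  "state_bessel s = map_prod (bessel s) (bessel s)"

lemma state_bessel:
  assumes s: "s \<ge> 0"
  shows "linear (state_bessel s)" "inj (state_bessel s)" "range (state_bessel s) = X_space s"
    "X_norm s (state_bessel s w) = sqrt (2 * pi) * norm w"
    "evol t (state_bessel s w) = state_bessel s (evol t w)"
proof -
  have lin: "linear (bessel s)" by (rule bounded_linear.linear[OF bounded_linear_bessel[OF s]])
  then show "linear (state_bessel s)" unfolding state_bessel_def by (intro linear_map_prod)
  show "inj (state_bessel s)"
    unfolding state_bessel_def by (intro prod.inj_map injI) (simp_all add: bessel_inject[OF s])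
  show "range (state_bessel s) = X_space s"
    by (auto simp: state_bessel_def X_space_def sobolev_eq_range_bessel[OF s])
  show "X_norm s (state_bessel s w) = sqrt (2 * pi) * norm w"
    by (cases w) (simp add: X_norm_def state_bessel_def bessel_in_sobolev[OF s] norm_Pair
        power_mult_distrib real_sqrt_mult flip: distrib_left)
  have "rot (state_bessel s u) = state_bessel s (rot u)" for u
    by (cases u) (simp add: rot_def state_bessel_def linear_add[OF lin] linear_diff[OF lin] linear_scale[OF lin])
  moreover have "map_prod (translation (- t)) (translation t) (state_bessel s u)
      = state_bessel s (map_prod (translation (- t)) (translation t) u)" for u
    by (cases u) (simp add: state_bessel_def translation_bessel[OF s])
  ultimately show "evol t (state_bessel s w) = state_bessel s (evol t w)"
    by (simp add: evol_eq)
qed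

lemma bounded_linear_state_bessel: "s \<ge> 0 \<Longrightarrow> bounded_linear (state_bessel s)"
  using norm_map_prod_le[of "bessel s" "bessel s"] state_bessel(1)[of s]
    norm_fourier_mult_le[OF symbol_bessel[of s]]
  by (intro bounded_linear.intro bounded_linear_axioms.intro exI[of _ 1])
    (auto simp: state_bessel_def bessel_def)

text \<open>
  The nonlinearity transported to \<open>L\<^sup>2 \<times> L\<^sup>2\<close> and polarized to a symmetric bilinear map, as
  linearization at a solution requires.
\<close>

definition potential_nonlin :: "real \<Rightarrow> state \<Rightarrow> state \<Rightarrow> state" where
  "potential_nonlin s v w =
     ((1 / 2) *\<^sub>R K_dx (sobolev_mult s (fst v) (snd w) + sobolev_mult s (fst w) (snd v)),
      (1 / 2) *\<^sub>R K_dx (sobolev_mult s (snd v) (snd w)))"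

lemma bounded_linear_K_dx: "bounded_linear K_dx" and norm_K_dx_le: "norm (K_dx f) \<le> norm f"
  unfolding K_dx_def by (intro bounded_linear_fourier_mult norm_fourier_mult_le symbol_K_dx)+

lemma sobolev_mult_commute:
  assumes s: "s > 1 / 2" shows "sobolev_mult s a b = sobolev_mult s b a"
proof -
  have "bessel s (sobolev_mult s a b) = bessel s (sobolev_mult s b a)"
    unfolding sobolev_mult(2)[OF s] by (simp add: mult_l2_def mult.commute)
  then show ?thesis using bessel_inject[of s] s by simp
qed

lemma potential_nonlin_commute: "s > 1 / 2 \<Longrightarrow> potential_nonlin s v w = potential_nonlin s w v"
  by (simp add: potential_nonlin_def add.commute sobolev_mult_commute[of s "snd v"])

lemma bounded_bilinear_potential_nonlin:
  assumes s: "s > 1 / 2" shows "bounded_bilinear (potential_nonlin s)"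
proof -
  interpret M: bounded_bilinear "sobolev_mult s" by (rule sobolev_mult(3)[OF s])
  interpret K: bounded_linear K_dx by (rule bounded_linear_K_dx)
  obtain C where C: "0 \<le> C" "\<And>a b. norm (sobolev_mult s a b) \<le> norm a * norm b * C"
    using M.nonneg_bounded by blast
  show ?thesis
  proof
    fix v v' w w' :: state and r :: real
    show "potential_nonlin s (v + v') w = potential_nonlin s v w + potential_nonlin s v' w"
      by (simp add: potential_nonlin_def M.add_left M.add_right K.add algebra_simps)
    show "potential_nonlin s v (w + w') = potential_nonlin s v w + potential_nonlin s v w'"
      by (simp add: potential_nonlin_def M.add_left M.add_right K.add algebra_simps)
    show "potential_nonlin s (r *\<^sub>R v) w = r *\<^sub>R potential_nonlin s v w"
      by (simp add: potential_nonlin_def M.scaleR_left M.scaleR_right K.scale K.add scaleR_add_right mult.commute)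
    show "potential_nonlin s v (r *\<^sub>R w) = r *\<^sub>R potential_nonlin s v w"
      by (simp add: potential_nonlin_def M.scaleR_left M.scaleR_right K.scale K.add scaleR_add_right mult.commute)
    show "\<exists>K. \<forall>v w. norm (potential_nonlin s v w) \<le> norm v * norm w * K"
    proof (intro exI[of _ "3 / 2 * C"] allI)
      fix v w :: state
      define X where "X = norm v * norm w * C"
      have m: "norm (sobolev_mult s a b) \<le> X" if "norm a * norm b \<le> norm v * norm w" for a b
        unfolding X_def using C(2)[of a b] mult_right_mono[OF that C(1)] by linarith
      have fst_snd: "norm (fst u) \<le> norm u" "norm (snd u) \<le> norm u" for u :: state
        by (cases u; simp add: norm_fst_le norm_snd_le)+
      have "norm (fst v) * norm (snd w) \<le> norm v * norm w"
        "norm (snd v) * norm (snd w) \<le> norm v * norm w"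
        "norm (snd v) * norm (fst w) \<le> norm v * norm w"
        by - (intro mult_mono fst_snd; simp)+
      then have le: "norm (sobolev_mult s (fst v) (snd w)) \<le> X"
        "norm (sobolev_mult s (snd v) (snd w)) \<le> X" "norm (sobolev_mult s (fst w) (snd v)) \<le> X"
        by (intro m; simp add: mult.commute)+
      have "norm (potential_nonlin s v w)
          \<le> norm ((1 / 2) *\<^sub>R K_dx (sobolev_mult s (fst v) (snd w) + sobolev_mult s (fst w) (snd v)))
            + norm ((1 / 2) *\<^sub>R K_dx (sobolev_mult s (snd v) (snd w)))"
        unfolding potential_nonlin_def by (rule norm_Pair_le)
      also have "\<dots> \<le> (1 / 2) * norm (sobolev_mult s (fst v) (snd w) + sobolev_mult s (fst w) (snd v))
            + (1 / 2) * norm (sobolev_mult s (snd v) (snd w))"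
        using norm_K_dx_le by (intro add_mono) simp_all
      also have "\<dots> \<le> (1 / 2) * (X + X) + (1 / 2) * X"
        by (intro add_mono mult_left_mono norm_triangle_mono le) simp_all
      also have "\<dots> = norm v * norm w * (3 / 2 * C)" by (simp add: X_def)
      finally show "norm (potential_nonlin s v w) \<le> norm v * norm w * (3 / 2 * C)" .
    qed
  qed
qed

lemma nonlin_state_bessel:
  assumes s: "s > 1 / 2"
  shows "nonlin (state_bessel s w) = state_bessel s (potential_nonlin s w w)"
proof (cases w)
  case (Pair a b)
  have s0: "s \<ge> 0" using s by simp
  interpret J: bounded_linear "bessel s" by (rule bounded_linear_bessel[OF s0])
  interpret K: bounded_linear K_dx by (rule bounded_linear_K_dx)
  have comm: "K_dx (bessel s f) = bessel s (K_dx f)" for f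
    unfolding K_dx_def bessel_def by (intro fourier_mult_commute symbol_K_dx symbol_bessel s0)
  show ?thesis
    by (simp add: Pair nonlin_def state_bessel_def potential_nonlin_def K.add K.scale J.scale comm
        flip: sobolev_mult(2)[OF s] scaleR_2)
qed

section \<open>Solutions of the integral equation\<close>

text \<open>
  The path in \<open>X_space s\<close> that is represented by a path in \<open>L\<^sup>2 \<times> L\<^sup>2\<close>.
\<close>

definition restrict_path :: "real \<Rightarrow> real \<Rightarrow> (real \<Rightarrow>\<^sub>C state) \<Rightarrow> real \<Rightarrow> state" where
  "restrict_path s T w t = (if t \<in> {0..T} then state_bessel s (apply_bcontfun w t) else 0)"

lemma linear_restrict_path:
  assumes "s \<ge> 0" shows "linear (restrict_path s T)"
proof -
  note lin = state_bessel(1)[OF assms]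
  show ?thesis
    by (rule linearI) (auto simp: restrict_path_def fun_eq_iff linear_add[OF lin] linear_scale[OF lin] scaleR_fun_def)
qed

lemma X_norm_state_bessel_diff:
  assumes "s \<ge> 0"
  shows "X_norm s (state_bessel s v - state_bessel s w) = sqrt (2 * pi) * norm (v - w)"
  using state_bessel(4)[OF assms, of "v - w"] by (simp add: linear_diff[OF state_bessel(1)[OF assms]])

lemma restrict_path_in_XT_space:
  assumes s: "s \<ge> 0" shows "restrict_path s T w \<in> XT_space s T"
proof -
  have "((\<lambda>t'. X_norm s (restrict_path s T w t' - restrict_path s T w t)) \<longlongrightarrow> 0) (at t within {0..T})"
    if t: "t \<in> {0..T}" for t
  proof -
    have "((\<lambda>t'. apply_bcontfun w t') \<longlongrightarrow> apply_bcontfun w t) (at t within {0..T})"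
      using continuous_on_apply_bcontfun[of "{0..T}" w] t by (auto simp: continuous_on_def)
    then have "((\<lambda>t'. sqrt (2 * pi) * norm (apply_bcontfun w t' - apply_bcontfun w t)) \<longlongrightarrow> sqrt (2 * pi) * 0)
        (at t within {0..T})"
      by (intro tendsto_intros tendsto_norm_zero) (simp add: LIM_zero_iff)
    moreover have "eventually (\<lambda>t'. sqrt (2 * pi) * norm (apply_bcontfun w t' - apply_bcontfun w t)
        = X_norm s (restrict_path s T w t' - restrict_path s T w t)) (at t within {0..T})"
      unfolding eventually_at_filter
      by (rule always_eventually)
        (use t in \<open>simp add: restrict_path_def X_norm_state_bessel_diff[OF s]\<close>)
    ultimately show ?thesis by (auto intro: Lim_transform_eventually)
  qed
  then show ?thesis
    using state_bessel(3)[OF s] by (auto simp: XT_space_def restrict_path_def)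
qed

lemma XT_norm_restrict_path:
  assumes s: "s \<ge> 0" and T: "0 \<le> T"
  shows "0 \<le> XT_norm s T (restrict_path s T w)"
    "XT_norm s T (restrict_path s T w) \<le> sqrt (2 * pi) * norm w"
proof -
  have le: "X_norm s (restrict_path s T w t) \<le> sqrt (2 * pi) * norm w" if "t \<in> {0..T}" for t
    using that by (simp add: restrict_path_def state_bessel(4)[OF s] norm_bounded)
  then show "XT_norm s T (restrict_path s T w) \<le> sqrt (2 * pi) * norm w"
    unfolding XT_norm_def using T by (intro cSUP_least) auto
  have "0 \<le> X_norm s (restrict_path s T w 0)" by (simp add: X_norm_def)
  also have "\<dots> \<le> XT_norm s T (restrict_path s T w)"
    unfolding XT_norm_def using T le by (intro cSUP_upper bdd_aboveI2[where M = "sqrt (2 * pi) * norm w"]) auto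
  finally show "0 \<le> XT_norm s T (restrict_path s T w)" .
qed

text \<open>
  Every continuous path in \<open>X_space s\<close> is obtained from \<open>L\<^sup>2 \<times> L\<^sup>2\<close>, which lets uniqueness there
  imply uniqueness in the whole of \<open>XT_space s T\<close>. The representing path is made constant outside
  \<open>[0, T]\<close>.
\<close>

lemma XT_space_eq_restrict_path:
  assumes s: "s \<ge> 0" and T: "0 \<le> T" and v: "v \<in> XT_space s T"
  obtains w where "v = restrict_path s T w"
    "\<And>t. apply_bcontfun w t = apply_bcontfun w (max 0 (min T t))"
proof -
  let ?c = "\<lambda>t. max 0 (min T t)"
  define u where "u t = inv (state_bessel s) (v t)" for t
  have u: "state_bessel s (u t) = v t" if "t \<in> {0..T}" for t
    using v that unfolding u_def XT_space_def by (intro f_inv_into_f) (simp add: state_bessel(3)[OF s])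
  have "continuous_on {0..T} u"
    unfolding continuous_on_def
  proof
    fix t assume t: "t \<in> {0..T}"
    have scale: "X_norm s (v t' - v t) = sqrt (2 * pi) * norm (u t' - u t)" if "0 \<le> t'" "t' \<le> T" for t'
      using X_norm_state_bessel_diff[OF s, of "u t'" "u t"] u[of t'] u[OF t] that by simp
    have "((\<lambda>t'. X_norm s (v t' - v t) / sqrt (2 * pi)) \<longlongrightarrow> 0 / sqrt (2 * pi)) (at t within {0..T})"
      by (intro tendsto_intros) (use v t in \<open>auto simp: XT_space_def\<close>)
    moreover have "eventually (\<lambda>t'. X_norm s (v t' - v t) / sqrt (2 * pi) = norm (u t' - u t)) (at t within {0..T})"
      unfolding eventually_at_filter
      by (rule always_eventually) (simp add: scale)
    ultimately have "((\<lambda>t'. norm (u t' - u t)) \<longlongrightarrow> 0) (at t within {0..T})"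
      by (auto intro: Lim_transform_eventually)
    then show "(u \<longlongrightarrow> u t) (at t within {0..T})"
      by (simp add: tendsto_norm_zero_iff LIM_zero_iff)
  qed
  moreover have "?c ` UNIV \<subseteq> {0..T}" using T by auto
  ultimately have cont: "continuous_on UNIV (\<lambda>t. u (?c t))" and bdd: "bounded (u ` {0..T})"
    by (auto intro!: continuous_on_compose2[of "{0..T}" u] continuous_intros
        compact_imp_bounded compact_continuous_image)
  have "bounded (range (\<lambda>t. u (?c t)))"
    by (rule bounded_subset[OF bdd]) (use T in auto)
  with cont have "(\<lambda>t. u (?c t)) \<in> bcontfun" by (simp add: bcontfun_def)
  then obtain w where w: "(\<lambda>t. u (?c t)) = apply_bcontfun w" by (rule bcontfunE)
  have wt: "apply_bcontfun w t = u (?c t)" for t by (simp flip: w)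
  have clamp: "?c t = t" if "t \<in> {0..T}" for t using that by auto
  have "v t = restrict_path s T w t" for t
  proof (cases "t \<in> {0..T}")
    case True
    then show ?thesis by (simp only: restrict_path_def if_True wt clamp u)
  next
    case False
    then show ?thesis using v by (auto simp: restrict_path_def XT_space_def)
  qed
  moreover have "?c (?c t) = ?c t" for t using T by auto
  ultimately show ?thesis using that[of w] by (auto simp: wt)
qed

locale whitham_problem =
  fixes s T B :: real
  assumes s: "s > 1 / 2" and T_nonneg: "0 \<le> T" and B_nonneg: "0 \<le> B"
    and nonlin_le: "norm (potential_nonlin s v w) \<le> B * norm v * norm w"
begin

sublocale mild_equation evol "potential_nonlin s" T B
  by (rule mild_equation.intro)
    (rule linear_evol norm_evol_le continuous_evol evol_add
      bounded_bilinear_potential_nonlin[OF s] nonlin_le B_nonneg T_nonneg)+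

lemma s_nonneg: "0 \<le> s" using s by simp

text \<open>
  The isomorphism \<open>state_bessel s\<close> commutes with the group, intertwines the nonlinearities and,
  being bounded and linear, commutes with the integral.
\<close>

lemma solves_restrict_path_iff:
  "solves s T (state_bessel s y) (restrict_path s T w)
    \<longleftrightarrow> (\<forall>t\<in>{0..T}. apply_bcontfun w t = apply_bcontfun (free y + interaction w w) t)"
proof -
  let ?J = "state_bessel s" and ?N = "\<lambda>\<tau>. potential_nonlin s (apply_bcontfun w \<tau>) (apply_bcontfun w \<tau>)"
  have "duhamel (restrict_path s T w) (?J y) t = ?J (apply_bcontfun (free y + interaction w w) t)"
    if t: "t \<in> {0..T}" for t
  proof -
    have "integral {0..t} (\<lambda>\<tau>. evol (t - \<tau>) (nonlin (restrict_path s T w \<tau>)))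
        = integral {0..t} (?J \<circ> (\<lambda>\<tau>. evol (t - \<tau>) (?N \<tau>)))"
      by (rule Henstock_Kurzweil_Integration.integral_cong)
        (use t in \<open>simp add: restrict_path_def nonlin_state_bessel[OF s] state_bessel(5)[OF s_nonneg]\<close>)
    also have "\<dots> = ?J (duhamel_integral ?N t)"
      unfolding duhamel_integral_def
      by (rule integral_linear[OF integrable_duhamel[OF continuous_N]
          bounded_linear_state_bessel[OF s_nonneg]])
    finally show ?thesis
      using linear_diff[OF state_bessel(1)[OF s_nonneg], of "evol t y" "duhamel_integral ?N t"]
      by (simp add: duhamel_def apply_free apply_interaction clip_id[OF t] state_bessel(5)[OF s_nonneg])
  qed
  then show ?thesis
    using restrict_path_in_XT_space[OF s_nonneg, of T w]
    by (simp add: solves_def restrict_path_def inj_eq[OF state_bessel(2)[OF s_nonneg]])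
qed

lemma solution:
  assumes "4 * B * T * norm y < 1"
  obtains z where "z = free y + interaction z z" "norm z \<le> 2 * norm y"
    "\<exists>!v. solves s T (state_bessel s y) v" "flow s T (state_bessel s y) = restrict_path s T z"
proof -
  obtain z where z: "z = free y + interaction z z" "norm z \<le> 2 * norm y"
    using mild_solution_exists[OF assms] by blast
  have sol: "solves s T (state_bessel s y) (restrict_path s T z)"
    unfolding solves_restrict_path_iff using arg_cong[OF z(1), of apply_bcontfun] by metis
  have uniq: "v = restrict_path s T z" if v: "solves s T (state_bessel s y) v" for v
  proof -
    have "v \<in> XT_space s T" using v by (simp add: solves_def)
    then obtain w where w: "v = restrict_path s T w"
      "\<And>t. apply_bcontfun w t = apply_bcontfun w (max 0 (min T t))"
      using XT_space_eq_restrict_path[OF s_nonneg T_nonneg] by metis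
    have "w = free y + interaction w w"
    proof (rule bcontfun_eqI)
      fix t
      have clip2: "clip (clip t) = clip t" using clip by (intro clip_id) simp
      have "apply_bcontfun w t = apply_bcontfun w (clip t)" by (subst w(2)) (simp only: clip_def)
      also have "\<dots> = apply_bcontfun (free y + interaction w w) (clip t)"
        using v clip unfolding w(1) solves_restrict_path_iff by simp
      also have "\<dots> = apply_bcontfun (free y + interaction w w) t"
        by (simp add: apply_free apply_interaction clip2)
      finally show "apply_bcontfun w t = apply_bcontfun (free y + interaction w w) t" .
    qed
    from mild_solution_unique[OF this z(1)] show ?thesis using w(1) by simp
  qed
  have "flow s T (state_bessel s y) = restrict_path s T z"
    unfolding flow_def using sol uniq by (rule the_equality)
  with z sol uniq show ?thesis by (intro that[of z]) blast+
qed

lemma flow_real_analytic: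
  assumes r: "0 < r" and small: "8 * B * T * r \<le> 1"
  shows "real_analytic_map (X_space s) (X_norm s) (XT_space s T) (XT_norm s T)
    (state_bessel s ` ball 0 r) (flow s T)"
proof -
  have ex: "\<exists>z. z = free y + interaction z z \<and> norm z \<le> 2 * norm y \<and>
      flow s T (state_bessel s y) = restrict_path s T z" if "y \<in> ball 0 r" for y
  proof -
    have "4 * B * T * norm y \<le> 4 * B * T * r"
      using that B_nonneg T_nonneg by (intro mult_left_mono) auto
    then have "4 * B * T * norm y < 1" using small by linarith
    from solution[OF this] show ?thesis by metis
  qed
  then obtain g where g: "\<And>y. y \<in> ball 0 r \<Longrightarrow> g y = free y + interaction (g y) (g y)"
    "\<And>y. y \<in> ball 0 r \<Longrightarrow> norm (g y) \<le> 2 * norm y"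
    "\<And>y. y \<in> ball 0 r \<Longrightarrow> flow s T (state_bessel s y) = restrict_path s T (g y)"
    by metis
  have "real_analytic_map UNIV norm UNIV norm (ball 0 r) g"
  proof (rule quadratic_solution_real_analytic[OF bounded_linear_free bounded_bilinear_interaction])
    show "interaction x y = interaction y x" for x y
      by (simp add: interaction_def potential_nonlin_commute[OF s, of "apply_bcontfun x _"])
    show "z = g a" if "a \<in> ball 0 r" "z = free a + interaction z z" for a z
      by (rule mild_solution_unique[OF that(2) g(1)[OF that(1)]])
    show "norm (2 *\<^sub>R interaction (g a) z) \<le> 1 / 2 * norm z" if a: "a \<in> ball 0 r" for a z
    proof -
      have "norm (2 *\<^sub>R interaction (g a) z) \<le> 2 * (T * B * norm (g a) * norm z)"
        using norm_interaction_le[of "g a" z] by simp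
      also have "\<dots> \<le> 2 * (T * B * (2 * r) * norm z)"
        using g(2)[OF a] a B_nonneg T_nonneg
        by (intro mult_left_mono mult_right_mono mult_nonneg_nonneg) auto
      also have "\<dots> = (8 * B * T * r) * (1 / 2 * norm z)" by simp
      also have "\<dots> \<le> 1 * (1 / 2 * norm z)" by (intro mult_right_mono small) simp
      finally show ?thesis by simp
    qed
  qed (use g(1) in simp_all)
  from real_analytic_map_transfer[OF this state_bessel(1,2,4)[OF s_nonneg] _
      linear_restrict_path[OF s_nonneg] restrict_path_in_XT_space[OF s_nonneg]
      XT_norm_restrict_path[OF s_nonneg T_nonneg] g(3)]
  show ?thesis by (simp add: state_bessel(3)[OF s_nonneg])
qed

end

lemma exists_whitham_problem:
  assumes s: "s > 1 / 2"
  obtains B where "0 < B" "\<And>T. 0 \<le> T \<Longrightarrow> whitham_problem s T B"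
proof -
  interpret bounded_bilinear "potential_nonlin s" by (rule bounded_bilinear_potential_nonlin[OF s])
  obtain B where B: "0 < B" "\<And>v w. norm (potential_nonlin s v w) \<le> norm v * norm w * B"
    using pos_bounded by blast
  have "whitham_problem s T B" if "0 \<le> T" for T
    using B that s by unfold_locales (auto simp: ac_simps)
  with B(1) show ?thesis by (rule that)
qed

theorem lemma2p1:
  fixes s :: real
  assumes "s > 1 / 2"
  shows "(\<exists>C>0. \<forall>v0\<in>X_space s. v0 \<noteq> 0 \<longrightarrow>
            (\<exists>!v. solves s (1 / (7 * C * X_norm s v0)) v0 v)) \<and>
         (\<forall>R>0. \<exists>T>0.
            (\<forall>v0\<in>{v0 \<in> X_space s. X_norm s v0 < R}. \<exists>!v. solves s T v0 v) \<and>
            real_analytic_map (X_space s) (X_norm s) (XT_space s T) (XT_norm s T)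
              {v0 \<in> X_space s. X_norm s v0 < R} (flow s T))"
proof -
  have s0: "s \<ge> 0" using assms by simp
  obtain B where B_pos: "0 < B" and problem: "\<And>T. 0 \<le> T \<Longrightarrow> whitham_problem s T B"
    using exists_whitham_problem[OF assms] by blast
  have sqrt: "1 \<le> sqrt (2 * pi)" using pi_ge_two by simp
  have norm_le: "norm y \<le> X_norm s (state_bessel s y)" for y
    using mult_right_mono[OF sqrt norm_ge_zero[of y]] by (simp add: state_bessel(4)[OF s0])
  \<comment> \<open>A bound of the bilinear map serves as \<open>C\<close>. As \<open>\<parallel>y\<parallel>\<close> is at most the norm of the datum, the
    Lipschitz constant of the contraction is then at most \<open>4/7\<close>.\<close>
  have "\<exists>C>0. \<forall>v0\<in>X_space s. v0 \<noteq> 0 \<longrightarrow> (\<exists>!v. solves s (1 / (7 * C * X_norm s v0)) v0 v)"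
  proof (intro exI[of _ B] conjI B_pos impI ballI)
    fix v0 assume "v0 \<in> X_space s" and nz: "v0 \<noteq> 0"
    then obtain y where y: "v0 = state_bessel s y" using state_bessel(3)[OF s0] by (metis rangeE)
    let ?n = "X_norm s v0" and ?T = "1 / (7 * B * X_norm s v0)"
    have "y \<noteq> 0" using nz linear_0[OF state_bessel(1)[OF s0]] y by auto
    then have n: "0 < ?n" using norm_le[of y] unfolding y by (smt (verit) zero_less_norm_iff)
    interpret whitham_problem s ?T B using B_pos n by (intro problem) simp
    have "norm y \<le> ?n" unfolding y by (rule norm_le)
    then have "4 * B * ?T * norm y \<le> 4 * B * ?T * ?n"
      using B_pos n by (intro mult_left_mono) auto
    also have "\<dots> < 1" using B_pos n by (simp add: field_simps)
    finally have "\<exists>!v. solves s ?T (state_bessel s y) v" by (rule solution)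
    then show "\<exists>!v. solves s ?T v0 v" by (simp only: y)
  qed
  moreover have "\<exists>T>0. (\<forall>v0\<in>{v0 \<in> X_space s. X_norm s v0 < R}. \<exists>!v. solves s T v0 v) \<and>
      real_analytic_map (X_space s) (X_norm s) (XT_space s T) (XT_norm s T)
        {v0 \<in> X_space s. X_norm s v0 < R} (flow s T)" if R: "0 < R" for R
  proof -
    \<comment> \<open>The time makes \<open>4 B T \<parallel>y\<parallel> < 1\<close>, for existence, and \<open>\<parallel>2 Q (g y)\<parallel> \<le> 1/2\<close>, for analyticity. The
      radius \<open>r\<close> is that of the corresponding ball in \<open>L\<^sup>2 \<times> L\<^sup>2\<close>.\<close>
    define T where "T = 1 / (8 * B * R)"
    define r where "r = R / sqrt (2 * pi)"
    have T_pos: "0 < T" using B_pos R by (simp add: T_def)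
    have r: "0 < r" "r \<le> R" using R sqrt by (simp_all add: r_def divide_le_eq_1_pos field_simps)
    interpret whitham_problem s T B using T_pos by (intro problem) simp
    have "8 * B * T * r \<le> 8 * B * T * R" using B_pos T_pos r by (intro mult_left_mono) auto
    also have "\<dots> = 1" using B_pos R by (simp add: T_def)
    finally have small: "8 * B * T * r \<le> 1" .
    have ball: "{v0 \<in> X_space s. X_norm s v0 < R} = state_bessel s ` ball 0 r"
      using sqrt by (auto simp: r_def state_bessel(4)[OF s0] field_simps simp flip: state_bessel(3)[OF s0])
    have unique: "\<exists>!v. solves s T v0 v" if v0: "v0 \<in> state_bessel s ` ball 0 r" for v0
    proof -
      obtain y where y: "v0 = state_bessel s y" "y \<in> ball 0 r" using v0 by (rule imageE)
      have "norm y < r" using y(2) by simp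
      then have "4 * B * T * norm y \<le> 4 * B * T * r" using B_pos T_pos by (intro mult_left_mono) simp_all
      then have "4 * B * T * norm y < 1" using small by linarith
      then show ?thesis unfolding y(1) by (rule solution)
    qed
    show ?thesis
      unfolding ball
      by (intro exI[of _ T] conjI ballI T_pos unique flow_real_analytic r(1) small)
  qed
  ultimately show ?thesis by blast
qed

end
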